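(* Let $G$ be of type $G_2$ (connected, over $\mathbb{C}$). The following is the complete list of Tymoczko's dot actions of the Weyl group $W$ on the cohomology of the regular semisimple Hessenberg varieties of $G$. For each Hessenberg ideal $I$, with dual Hessenberg subspace $M$ (so $I=M^\perp$), and $y\in\mathfrak{g}$ regular semisimple, the polynomial $P_M(q)=\sum_{i\ge 0}\chi_{H^{2i}(\operatorname{Hess}(M,y))}\,q^i$, whose coefficients are the characters of the $W$-representations $H^{2i}(\operatorname{Hess}(M,y))$, is: \begin{itemize} \item $I=I_{\emptyset}$: $\ \mathbf{1}+\mathbf{2}q+\mathbf{2}q^2+\mathbf{2}q^3+\mathbf{2}q^4+\mathbf{2}q^5+\mathbf{1}q^6$; \item $I=I_{2\beta+3\alpha}$: $\ \mathbf{1}+\mathbf{2}q+(\mathbf{2}+\epsilon_1)q^2+(\mathbf{2}+\epsilon_1)q^3+\mathbf{2}q^4+\mathbf{1}q^5$; \item $I=I_{\beta+3\alpha}$: $\ \mathbf{1}+(\mathbf{2}+\epsilon_1)q+(\mathbf{2}+2\epsilon_1)q^2+(\mathbf{2}+\epsilon_1)q^3+\mathbf{1}q^4$; \item $I=I_{\beta+2\alpha}$: $\ \mathbf{1}+(\mathbf{2}+\epsilon_1+\chi_2)q+(\mathbf{2}+\epsilon_1+\chi_2)q^2+\mathbf{1}q^3$; \item $I=I_{\beta+\alpha}$: $\ \mathbf{1}+(\mathbf{2}+\epsilon_1+2\chi_2+\chi_1+\epsilon_2)q+\mathbf{1}q^2$; \item $I=I_{\alpha}$: $\ (\mathbf{1}+\chi_2+\chi_1+\epsilon_2)(1+q)$;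 \item $I=I_{\beta}$: $\ (\mathbf{1}+\epsilon_1+\chi_2+\chi_1)(1+q)$; \item $I=I_{\alpha,\beta}$: $\ \mathbf{1}+\epsilon_1+2\chi_2+2\chi_1+\epsilon_2+\epsilon$. \end{itemize}
   Context: Setup. $B\subset G$ is a Borel subgroup, $T\subset B$ a maximal torus, $\mathfrak{g},\mathfrak{b},\mathfrak{t}$ their Lie algebras, $\mathfrak{u}$ the nilradical of $\mathfrak{b}$, $\Phi$ the root system, $\mathfrak{g}_\gamma$ the root spaces. The simple roots are $\alpha$ (short) and $\beta$ (long); the positive roots are $\alpha,\beta,\beta+\alpha,\beta+2\alpha,\beta+3\alpha,2\beta+3\alpha$. Write $\gamma\le\delta$ if $\delta-\gamma$ is a nonnegative combination of $\alpha,\beta$. Hessenberg ideals: $\operatorname{ad}(\mathfrak{b})$-stable subspaces $I\subset\mathfrak{u}$. In type $G_2$ they are $I_\emptyset=0$, $I_{\alpha,\beta}=\mathfrak{u}$, and $I_\gamma=\bigoplus_{\delta\ge\gamma}\mathfrak{g}_\delta$ for $\gamma$ a positive root. Hessenberg subspaces: $\operatorname{ad}(\mathfrak{b})$-stable subspaces $M$ with $\mathfrak{b}\subset M\subset\mathfrak{g}$. They are in bijection with Hessenberg ideals via $I=M^\perp$, meaning $\Phi(I)=-(\Phi\setminus\Phi(M))$, where $M=\mathfrak{t}\oplus\bigoplus_{\gamma\in\Phi(M)}\mathfrak{g}_\gamma$ and $I=\bigoplus_{\gamma\in\Phi(I)}\mathfrak{g}_\gamma$. For $y\in\mathfrak{g}$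 regular semisimple, $\operatorname{Hess}(M,y)=\{gB\in G/B\mid \operatorname{Ad}(g^{-1})y\in M\}$, a smooth projective variety paved by affines. Cohomology is ordinary singular cohomology with coefficients in $\mathbb{C}$ (it is concentrated in even degrees). Tymoczko's dot action. Take $y\in\mathfrak{t}$ regular (for other regular semisimple $y$ transport along conjugation; the resulting isomorphism class of $W$-representation does not depend on $y$). Then $\operatorname{Hess}(M,y)^T=\{wB\mid w\in W\}$, and restriction to fixed points identifies $H_T^*(\operatorname{Hess}(M,y))$ with the ring of functions $f:W\to \operatorname{Sym}(\mathfrak{t}^* )$ such that $f(w)-f(ws_\delta)\in (w\delta)$ for all $w\in W$ and all negative roots $\delta\in\Phi(M)$. The group $W$ acts by $(u\cdot f)(w)=u(f(u^{-1}w))$; this descends to $H^*(\operatorname{Hess}(M,y))$, the quotient of $H^*_T$ by the ideal generated by the constant functions with value of positive degree. (Equivalently, it is the monodromy action of $\pi_1(\mathfrak{g}^{rs},y)$, which factors through $W$, on the fibers of $G\times^B M\to\mathfrak{g}$ over the regular semisimple locus $\mathfrak{g}^{rs}$.) Characters of $W$. Let $s=s_\alpha$, $t=s_\beta$; $W=\langle s,t\mid s^2=t^2=(st)^6=e\rangle$ is dihedral of order $12$. The irreducible characters are: $\mathbf{1}$ trivial; $\epsilon_1$ with $\epsilon_1(s)=1,\epsilon_1(t)=-1$; $\epsilon_2$ with $\epsilon_2(s)=-1,\epsilon_2(t)=1$; $\epsilon$ the sign character ($\epsilon(s)=\epsilon(t)=-1$); $\chi_1$ of degree $2$ with values $0,0,1,-1,-2$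 on $s,t,st,(st)^2,(st)^3$; $\chi_2$ of degree $2$ with values $0,0,-1,-1,2$ on $s,t,st,(st)^2,(st)^3$. The symbol $\mathbf{2}$ denotes $\mathbf{1}\oplus\mathbf{1}$. *)

theory Defs
  imports
    "HOL-Analysis.Analysis"
    "HOL-Homology.Homology"
    "HOL-Algebra.Solvable_Groups"
    "HOL-Computational_Algebra.Polynomial"
    "HOL-Library.Function_Algebras"
    "HOL-Library.Set_Algebras"
begin

section \<open>The root system and the Weyl group\<close>

text \<open>A pair \<open>(m, n)\<close> stands for the weight \<open>m \<alpha> + n \<beta>\<close>; \<open>\<alpha>\<close> is the short simple root.\<close>

type_synonym weight = "int \<times> int"

definition pos_roots :: "weight set" where
  "pos_roots = {(1,0), (0,1), (1,1), (2,1), (3,1), (3,2)}"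

definition roots :: "weight set" where
  "roots = pos_roots \<union> uminus ` pos_roots"

definition root_le :: "weight \<Rightarrow> weight \<Rightarrow> bool" where
  "root_le \<gamma> \<delta> \<longleftrightarrow> fst \<gamma> \<le> fst \<delta> \<and> snd \<gamma> \<le> snd \<delta>"

text \<open>The invariant form, with \<open>(\<alpha>, \<alpha>) = 2\<close>, \<open>(\<alpha>, \<beta>) = -3\<close> and \<open>(\<beta>, \<beta>) = 6\<close>.\<close>

definition form :: "weight \<Rightarrow> weight \<Rightarrow> int" where
  "form \<gamma> \<delta> = 2 * fst \<gamma> * fst \<delta> - 3 * (fst \<gamma> * snd \<delta> + snd \<gamma> * fst \<delta>) + 6 * snd \<gamma> * snd \<delta>"

text \<open>For a root \<open>\<delta>\<close> the division is exact: it is the Cartan integer.\<close>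

definition refl :: "weight \<Rightarrow> weight \<Rightarrow> weight" where
  "refl \<delta> \<gamma> = (let k = (2 * form \<gamma> \<delta>) div form \<delta> \<delta> in (fst \<gamma> - k * fst \<delta>, snd \<gamma> - k * snd \<delta>))"

type_synonym weyl = "weight \<Rightarrow> weight"

abbreviation s\<^sub>\<alpha> :: weyl where "s\<^sub>\<alpha> \<equiv> refl (1,0)"
abbreviation s\<^sub>\<beta> :: weyl where "s\<^sub>\<beta> \<equiv> refl (0,1)"

inductive_set W :: "weyl set" where
  one: "id \<in> W"
| mult_s: "w \<in> W \<Longrightarrow> s\<^sub>\<alpha> \<circ> w \<in> W"
| mult_t: "w \<in> W \<Longrightarrow> s\<^sub>\<beta> \<circ> w \<in> W"

section \<open>Characters\<close>

definition conj_W :: "weyl \<Rightarrow> weyl \<Rightarrow> bool" where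
  "conj_W v w \<longleftrightarrow> (\<exists>g\<in>W. v \<circ> g = g \<circ> w)"

text \<open>The class function with given values on \<open>e, s, t, st, (st)\<^sup>2, (st)\<^sup>3\<close>
  (where \<open>s = s\<^sub>\<alpha>\<close>, \<open>t = s\<^sub>\<beta>\<close>), which represent all
  conjugacy classes. With the pointwise operations on functions, the trivial
  character is \<open>1\<close> and \<open>1 \<oplus> 1\<close> is \<open>2\<close>.\<close>

definition class_function ::
  "complex \<Rightarrow> complex \<Rightarrow> complex \<Rightarrow> complex \<Rightarrow> complex \<Rightarrow> complex \<Rightarrow> weyl \<Rightarrow> complex" where
  "class_function a0 a1 a2 a3 a4 a5 w =
    (if w = id then a0
     else if conj_W w s\<^sub>\<alpha> then a1
     else if conj_W w s\<^sub>\<beta> then a2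
     else if conj_W w (s\<^sub>\<alpha> \<circ> s\<^sub>\<beta>) then a3
     else if conj_W w ((s\<^sub>\<alpha> \<circ> s\<^sub>\<beta>) ^^ 2) then a4
     else if conj_W w ((s\<^sub>\<alpha> \<circ> s\<^sub>\<beta>) ^^ 3) then a5
     else 0)"

definition \<epsilon>\<^sub>1 :: "weyl \<Rightarrow> complex" where "\<epsilon>\<^sub>1 = class_function 1 1 (-1) (-1) 1 (-1)"
definition \<epsilon>\<^sub>2 :: "weyl \<Rightarrow> complex" where "\<epsilon>\<^sub>2 = class_function 1 (-1) 1 (-1) 1 (-1)"
definition \<epsilon> :: "weyl \<Rightarrow> complex" where "\<epsilon> = class_function 1 (-1) (-1) 1 1 1"
definition \<chi>\<^sub>1 :: "weyl \<Rightarrow> complex" where "\<chi>\<^sub>1 = class_function 2 0 0 1 (-1) (-2)"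
definition \<chi>\<^sub>2 :: "weyl \<Rightarrow> complex" where "\<chi>\<^sub>2 = class_function 2 0 0 (-1) (-1) 2"

text \<open>\<open>F\<close> acts on the set of cosets \<open>Z/N\<close>. Its trace is \<open>\<tau>\<close> if \<open>Z/N\<close> has a finite basis
  \<open>v 0 + N, \<dots>, v (n - 1) + N\<close> in which \<open>F\<close> has a matrix \<open>A\<close> with \<open>tr A = \<tau>\<close>.\<close>

definition has_trace ::
  "(complex \<Rightarrow> 'v \<Rightarrow> 'v) \<Rightarrow> 'v::ab_group_add set \<Rightarrow> 'v set \<Rightarrow> ('v set \<Rightarrow> 'v set) \<Rightarrow> complex \<Rightarrow> bool" where
  "has_trace scl Z N F \<tau> \<longleftrightarrow>
    (\<exists>(n::nat) v A.
      (\<forall>i<n. v i \<in> Z) \<and>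
      (\<forall>z\<in>Z. \<exists>!a. (\<forall>i\<ge>n. a i = 0) \<and> z - (\<Sum>i<n. scl (a i) (v i)) \<in> N) \<and>
      (\<forall>j<n. F (v j +o N) = (\<Sum>i<n. scl (A i j) (v i)) +o N) \<and>
      \<tau> = (\<Sum>i<n. A i i))"

section \<open>The dot action on the ring of the moment graph\<close>

text \<open>\<open>Sym(t\<^sup>*)\<close> is the ring of polynomial functions on \<open>t\<close>, a point \<open>h\<close> of which is
  given by its coordinates \<open>(\<alpha>(h), \<beta>(h))\<close>.\<close>

type_synonym symt = "complex \<times> complex \<Rightarrow> complex"

definition wt_eval :: "weight \<Rightarrow> symt" where
  "wt_eval \<gamma> = (\<lambda>(x, y). of_int (fst \<gamma>) * x + of_int (snd \<gamma>) * y)"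

definition Sym :: "symt set" where
  "Sym = {p. \<exists>N a. p = (\<lambda>(x, y). \<Sum>j\<le>(N::nat). \<Sum>k\<le>N. a j k * x ^ j * y ^ k)}"

definition Sym_deg :: "nat \<Rightarrow> symt set" where
  "Sym_deg d = {p. \<exists>a. p = (\<lambda>(x, y). \<Sum>j\<le>d. a j * x ^ j * y ^ (d - j))}"

text \<open>The algebra automorphism extending \<open>\<gamma> \<mapsto> u \<gamma>\<close> on weights.\<close>

definition act_Sym :: "weyl \<Rightarrow> symt \<Rightarrow> symt" where
  "act_Sym u p = (\<lambda>h. p (wt_eval (u (1,0)) h, wt_eval (u (0,1)) h))"

text \<open>Functions on \<open>W\<close> are extended by \<open>0\<close>. The parameter \<open>D\<close> is \<open>\<Phi>(M)\<close>.\<close>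

definition gkm :: "weight set \<Rightarrow> (weyl \<Rightarrow> symt) set" where
  "gkm D = {f. (\<forall>w. w \<notin> W \<longrightarrow> f w = 0) \<and> (\<forall>w\<in>W. f w \<in> Sym) \<and>
     (\<forall>w\<in>W. \<forall>\<delta>\<in>D \<inter> uminus ` pos_roots. \<exists>q\<in>Sym. f w - f (w \<circ> refl \<delta>) = wt_eval (w \<delta>) * q)}"

definition gkm_deg :: "weight set \<Rightarrow> nat \<Rightarrow> (weyl \<Rightarrow> symt) set" where
  "gkm_deg D i = {f \<in> gkm D. \<forall>w\<in>W. f w \<in> Sym_deg i}"

definition gkm_scale :: "complex \<Rightarrow> (weyl \<Rightarrow> symt) \<Rightarrow> weyl \<Rightarrow> symt" where
  "gkm_scale c f = (\<lambda>w h. c * f w h)"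

text \<open>The ideal generated by the constant functions with value homogeneous of positive degree.\<close>

definition gkm_ideal :: "weight set \<Rightarrow> (weyl \<Rightarrow> symt) set" where
  "gkm_ideal D = module.span gkm_scale {\<lambda>w. p * f w | p f. f \<in> gkm D \<and> (\<exists>d>0. p \<in> Sym_deg d)}"

definition dot :: "weyl \<Rightarrow> (weyl \<Rightarrow> symt) \<Rightarrow> weyl \<Rightarrow> symt" where
  "dot u f = (\<lambda>w. if w \<in> W then act_Sym u (f (inv_into UNIV u \<circ> w)) else 0)"

section \<open>Singular cohomology with complex coefficients\<close>

text \<open>Cochains are extended by \<open>0\<close> to chains that are not chains of \<open>X\<close>; the elements of
  \<open>cohomology k X\<close> are cosets of \<open>coboundaries k X\<close>.\<close>

definition cochains :: "nat \<Rightarrow> 'a topology \<Rightarrow> ('a chain \<Rightarrow> complex) set" where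
  "cochains k X = {\<phi>. (\<forall>c. \<not> singular_chain k X c \<longrightarrow> \<phi> c = 0) \<and>
     (\<forall>c d. singular_chain k X c \<and> singular_chain k X d \<longrightarrow> \<phi> (c + d) = \<phi> c + \<phi> d)}"

definition cocycles :: "nat \<Rightarrow> 'a topology \<Rightarrow> ('a chain \<Rightarrow> complex) set" where
  "cocycles k X = {\<phi> \<in> cochains k X.
     \<forall>c. singular_chain (Suc k) X c \<longrightarrow> \<phi> (chain_boundary (Suc k) c) = 0}"

text \<open>For \<open>k = 0\<close> this is \<open>{0}\<close>, because \<open>chain_boundary 0 c = 0\<close>.\<close>

definition coboundaries :: "nat \<Rightarrow> 'a topology \<Rightarrow> ('a chain \<Rightarrow> complex) set" where
  "coboundaries k X = {\<phi> \<in> cochains k X. \<exists>\<psi>\<in>cochains (k - 1) X.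
     \<forall>c. singular_chain k X c \<longrightarrow> \<phi> c = \<psi> (chain_boundary k c)}"

definition cohomology :: "nat \<Rightarrow> 'a topology \<Rightarrow> ('a chain \<Rightarrow> complex) set set" where
  "cohomology k X = (\<lambda>\<phi>. \<phi> +o coboundaries k X) ` cocycles k X"

definition cochain_scale :: "complex \<Rightarrow> ('a chain \<Rightarrow> complex) \<Rightarrow> 'a chain \<Rightarrow> complex" where
  "cochain_scale c \<phi> = (\<lambda>z. c * \<phi> z)"

text \<open>The map \<open>H\<^sup>k(Y) \<rightarrow> H\<^sup>k(X)\<close> induced by a continuous map \<open>h : X \<rightarrow> Y\<close>, on cosets.\<close>

definition pullback ::
  "nat \<Rightarrow> 'a topology \<Rightarrow> ('a \<Rightarrow> 'b) \<Rightarrow> ('b chain \<Rightarrow> complex) set \<Rightarrow> ('a chain \<Rightarrow> complex) set" where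
  "pullback k X h K =
    (\<lambda>\<phi> c. if singular_chain k X c then \<phi> (chain_map k h c) else 0) ` K + coboundaries k X"

section \<open>Linear algebraic groups and their Lie algebras\<close>

type_synonym 'n cmat = "complex^'n^'n"

definition cscale :: "complex \<Rightarrow> 'n::finite cmat \<Rightarrow> 'n cmat" where
  "cscale c X = mat c ** X"

definition bracket :: "'n::finite cmat \<Rightarrow> 'n cmat \<Rightarrow> 'n cmat" where
  "bracket X Y = X ** Y - Y ** X"

definition GLn :: "'n::finite cmat monoid" where
  "GLn = \<lparr>carrier = {A. invertible A}, monoid.mult = (**), one = mat 1\<rparr>"

inductive_set poly_fun :: "('n::finite cmat \<Rightarrow> complex) set" where
  const: "(\<lambda>A. c) \<in> poly_fun"
| entry: "(\<lambda>A. A $ i $ j) \<in> poly_fun"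
| add: "p \<in> poly_fun \<Longrightarrow> q \<in> poly_fun \<Longrightarrow> (\<lambda>A. p A + q A) \<in> poly_fun"
| mult: "p \<in> poly_fun \<Longrightarrow> q \<in> poly_fun \<Longrightarrow> (\<lambda>A. p A * q A) \<in> poly_fun"

text \<open>For a Zariski closed subgroup of \<open>GL\<^sub>n(\<complex>)\<close>, being connected in the Zariski topology and in
  the Euclidean topology are the same; the latter is used here.\<close>

definition connected_linear_group :: "'n::finite cmat set \<Rightarrow> bool" where
  "connected_linear_group H \<longleftrightarrow> subgroup H GLn \<and>
     (\<exists>P\<subseteq>poly_fun. H = {A. invertible A \<and> (\<forall>p\<in>P. p A = 0)}) \<and> connected H"

definition lie :: "'n::finite cmat set \<Rightarrow> 'n cmat set" where
  "lie H = {X. \<exists>c::real \<Rightarrow> 'n cmat. (\<forall>r. c r \<in> H) \<and> c 0 = mat 1 \<and> (c has_vector_derivative X) (at 0)}"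

definition diagonal_mat :: "'n::finite cmat \<Rightarrow> bool" where
  "diagonal_mat A \<longleftrightarrow> (\<forall>i j. i \<noteq> j \<longrightarrow> A $ i $ j = 0)"

definition torus :: "'n::finite cmat set \<Rightarrow> bool" where
  "torus H \<longleftrightarrow> connected_linear_group H \<and>
     (\<exists>P::'n cmat. invertible P \<and> (\<forall>A\<in>H. diagonal_mat (matrix_inv P ** A ** P)))"

definition maximal_torus :: "'n::finite cmat set \<Rightarrow> 'n cmat set \<Rightarrow> bool" where
  "maximal_torus G T \<longleftrightarrow> torus T \<and> T \<subseteq> G \<and> (\<forall>H. torus H \<and> H \<subseteq> G \<and> T \<subseteq> H \<longrightarrow> H = T)"

definition solvable_group :: "'n::finite cmat set \<Rightarrow> bool" where
  "solvable_group H \<longleftrightarrow> connected_linear_group H \<and> solvable (GLn\<lparr>carrier := H\<rparr>)"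

definition Borel :: "'n::finite cmat set \<Rightarrow> 'n cmat set \<Rightarrow> bool" where
  "Borel G B \<longleftrightarrow> solvable_group B \<and> B \<subseteq> G \<and> (\<forall>H. solvable_group H \<and> H \<subseteq> G \<and> B \<subseteq> H \<longrightarrow> H = B)"

section \<open>Groups of type \<open>G\<^sub>2\<close>\<close>

text \<open>Given simple roots \<open>\<alpha>, \<beta> : t \<rightarrow> \<complex>\<close> (functions on all matrices, of which only the restriction
  to \<open>t\<close> matters), the following data determine root spaces and sums of root spaces.\<close>

record 'n g2 =
  gp :: "'n cmat set"                     \<comment> \<open>\<open>G\<close>\<close>
  bor :: "'n cmat set"                    \<comment> \<open>\<open>B\<close>\<close>
  tor :: "'n cmat set"                    \<comment> \<open>\<open>T\<close>\<close>
  ralpha :: "'n cmat \<Rightarrow> complex"   \<comment> \<open>\<open>\<alpha>\<close>\<close>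
  rbeta :: "'n cmat \<Rightarrow> complex"    \<comment> \<open>\<open>\<beta>\<close>\<close>

definition coords :: "'n::finite g2 \<Rightarrow> 'n cmat \<Rightarrow> complex \<times> complex" where
  "coords \<G> h = (ralpha \<G> h, rbeta \<G> h)"

definition root_space :: "'n::finite g2 \<Rightarrow> weight \<Rightarrow> 'n cmat set" where
  "root_space \<G> \<gamma> = {X \<in> lie (gp \<G>). \<forall>h\<in>lie (tor \<G>). bracket h X = cscale (wt_eval \<gamma> (coords \<G> h)) X}"

definition root_sum :: "'n::finite g2 \<Rightarrow> weight set \<Rightarrow> 'n cmat set" where
  "root_sum \<G> S = {\<Sum>\<gamma>\<in>S. X \<gamma> | X. \<forall>\<gamma>\<in>S. X \<gamma> \<in> root_space \<G> \<gamma>}"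

text \<open>\<open>G\<close> is of type \<open>G\<^sub>2\<close>, stated through the root decomposition relative to \<open>T \<subseteq> B\<close>.
  The last two conditions, which hold in every semisimple Lie algebra, are what makes this Lie
  algebra semisimple: an ideal of \<open>g\<close> containing a root space \<open>g\<^sub>\<gamma>\<close> contains a copy of \<open>sl\<^sub>2\<close>, and an
  ideal contained in \<open>t\<close> is \<open>0\<close> because \<open>\<alpha>, \<beta>\<close> span \<open>t\<^sup>*\<close>.\<close>

definition type_G2 :: "'n::finite g2 \<Rightarrow> bool" where
  "type_G2 \<G> \<longleftrightarrow>
     connected_linear_group (gp \<G>) \<and> Borel (gp \<G>) (bor \<G>) \<and> maximal_torus (gp \<G>) (tor \<G>) \<and>
     tor \<G> \<subseteq> bor \<G> \<and>
     (\<forall>h\<in>lie (tor \<G>). \<forall>k\<in>lie (tor \<G>). coords \<G> (h + k) = coords \<G> h + coords \<G> k) \<and>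
     (\<forall>c. \<forall>h\<in>lie (tor \<G>). coords \<G> (cscale c h) = (c * ralpha \<G> h, c * rbeta \<G> h)) \<and>
     bij_betw (coords \<G>) (lie (tor \<G>)) UNIV \<and>
     lie (gp \<G>) = lie (tor \<G>) + root_sum \<G> roots \<and>
     lie (bor \<G>) = lie (tor \<G>) + root_sum \<G> pos_roots \<and>
     (\<forall>\<gamma>\<in>roots. \<exists>e. e \<noteq> 0 \<and> root_space \<G> \<gamma> = range (\<lambda>c. cscale c e)) \<and>
     (\<forall>\<gamma>\<in>roots. \<forall>\<delta>\<in>roots. \<gamma> + \<delta> \<in> roots \<longrightarrow>
        (\<exists>X\<in>root_space \<G> \<gamma>. \<exists>Y\<in>root_space \<G> \<delta>. bracket X Y \<noteq> 0)) \<and>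
     (\<forall>\<gamma>\<in>roots. \<exists>X\<in>root_space \<G> \<gamma>. \<exists>Y\<in>root_space \<G> (- \<gamma>).
        wt_eval \<gamma> (coords \<G> (bracket X Y)) \<noteq> 0)"

section \<open>Hessenberg ideals, Hessenberg subspaces and Hessenberg varieties\<close>

text \<open>The nilradical \<open>u\<close> of \<open>b\<close> is the sum of the positive root spaces.\<close>

definition nilrad :: "'n::finite g2 \<Rightarrow> 'n cmat set" where
  "nilrad \<G> = root_sum \<G> pos_roots"

definition hessenberg_ideal :: "'n::finite g2 \<Rightarrow> 'n cmat set \<Rightarrow> bool" where
  "hessenberg_ideal \<G> I \<longleftrightarrow> module.subspace cscale I \<and> I \<subseteq> nilrad \<G> \<and>
     (\<forall>X\<in>lie (bor \<G>). \<forall>Y\<in>I. bracket X Y \<in> I)"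

definition I_above :: "'n::finite g2 \<Rightarrow> weight \<Rightarrow> 'n cmat set" where
  "I_above \<G> \<gamma> = root_sum \<G> {\<delta> \<in> pos_roots. root_le \<gamma> \<delta>}"

definition root_set :: "'n::finite g2 \<Rightarrow> 'n cmat set \<Rightarrow> weight set" where
  "root_set \<G> V = {\<gamma> \<in> roots. root_space \<G> \<gamma> \<subseteq> V}"

definition dual_subspace :: "'n::finite g2 \<Rightarrow> 'n cmat set \<Rightarrow> 'n cmat set" where
  "dual_subspace \<G> I = lie (tor \<G>) + root_sum \<G> (roots - uminus ` root_set \<G> I)"

text \<open>In the Lie algebra of a linear algebraic group, semisimple elements are the diagonalizable
  matrices; regular ones are those whose centralizer has dimension \<open>dim t\<close>.\<close>

definition regular_semisimple :: "'n::finite g2 \<Rightarrow> 'n cmat \<Rightarrow> bool" where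
  "regular_semisimple \<G> y \<longleftrightarrow> y \<in> lie (gp \<G>) \<and>
     (\<exists>P::'n cmat. invertible P \<and> diagonal_mat (matrix_inv P ** y ** P)) \<and>
     vector_space.dim cscale {X \<in> lie (gp \<G>). bracket X y = 0} = vector_space.dim cscale (lie (tor \<G>))"

definition quotient_top :: "'a topology \<Rightarrow> ('a \<Rightarrow> 'b) \<Rightarrow> 'b topology" where
  "quotient_top X f = topology (\<lambda>U. U \<subseteq> f ` topspace X \<and> openin X {x \<in> topspace X. f x \<in> U})"

lemma openin_quotient_top:
  "openin (quotient_top X f) U \<longleftrightarrow> U \<subseteq> f ` topspace X \<and> openin X {x \<in> topspace X. f x \<in> U}"
proof -
  have "istopology (\<lambda>U. U \<subseteq> f ` topspace X \<and> openin X {x \<in> topspace X. f x \<in> U})"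
    unfolding istopology_def
  proof (intro conjI allI impI; (elim conjE)?)
    fix S U
    assume S: "openin X {x \<in> topspace X. f x \<in> S}" and U: "openin X {x \<in> topspace X. f x \<in> U}"
    have "{x \<in> topspace X. f x \<in> S \<inter> U} = {x \<in> topspace X. f x \<in> S} \<inter> {x \<in> topspace X. f x \<in> U}"
      by auto
    with S U show "openin X {x \<in> topspace X. f x \<in> S \<inter> U}"
      by auto
  next
    fix \<K>
    assume *: "\<forall>K\<in>\<K>. K \<subseteq> f ` topspace X \<and> openin X {x \<in> topspace X. f x \<in> K}"
    have "{x \<in> topspace X. f x \<in> \<Union>\<K>} = (\<Union>K\<in>\<K>. {x \<in> topspace X. f x \<in> K})"
      by auto
    with * show "openin X {x \<in> topspace X. f x \<in> \<Union>\<K>}"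
      by auto
  qed auto
  then show ?thesis
    by (simp add: quotient_top_def topology_inverse')
qed

text \<open>Points of \<open>G/B\<close> are the cosets \<open>gB\<close>, as sets of matrices.\<close>

definition lcoset :: "'n::finite cmat \<Rightarrow> 'n cmat set \<Rightarrow> 'n cmat set" where
  "lcoset g C = (\<lambda>b. g ** b) ` C"

definition flag_variety :: "'n::finite g2 \<Rightarrow> 'n cmat set topology" where
  "flag_variety \<G> = quotient_top (top_of_set (gp \<G>)) (\<lambda>g. lcoset g (bor \<G>))"

definition Ad :: "'n::finite cmat \<Rightarrow> 'n cmat \<Rightarrow> 'n cmat" where
  "Ad g X = g ** X ** matrix_inv g"

definition Hess :: "'n::finite g2 \<Rightarrow> 'n cmat set \<Rightarrow> 'n cmat \<Rightarrow> 'n cmat set topology" where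
  "Hess \<G> M y = subtopology (flag_variety \<G>)
     {lcoset g (bor \<G>) | g. g \<in> gp \<G> \<and> Ad (matrix_inv g) y \<in> M}"

section \<open>Equivariant cohomology and the dot action\<close>

text \<open>As a contractible space with a free \<open>GL\<^sub>n\<close>-action we take the injective matrices with \<open>n\<close> columns
  and rows indexed by the natural numbers, with the product topology and right multiplication;
  it is contracted to a point by linear homotopies, via a shift of the rows. As a right \<open>T\<close>-space
  it serves as \<open>ET\<close>.\<close>

definition frames :: "(nat \<Rightarrow> complex^'n::finite) set" where
  "frames = {A. inj (\<lambda>(x::complex^'n) k. \<Sum>i\<in>UNIV. A k $ i * x $ i)}"

definition frame_mult :: "(nat \<Rightarrow> complex^'n::finite) \<Rightarrow> 'n cmat \<Rightarrow> nat \<Rightarrow> complex^'n" where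
  "frame_mult A g = (\<lambda>k. A k v* g)"

definition BT :: "'n::finite g2 \<Rightarrow> (nat \<Rightarrow> complex^'n) set topology" where
  "BT \<G> = quotient_top (top_of_set frames) (\<lambda>A. {frame_mult A h | h. h \<in> tor \<G>})"

definition orbit ::
  "'n::finite g2 \<Rightarrow> (nat \<Rightarrow> complex^'n) \<times> 'n cmat set \<Rightarrow> ((nat \<Rightarrow> complex^'n) \<times> 'n cmat set) set" where
  "orbit \<G> = (\<lambda>(A, x). {(frame_mult A h, lcoset (matrix_inv h) x) | h. h \<in> tor \<G>})"

text \<open>The Borel construction \<open>ET \<times>\<^sup>T X\<close>, for \<open>X\<close> a \<open>T\<close>-stable subspace of \<open>G/B\<close>.\<close>

definition borel_space ::
  "'n::finite g2 \<Rightarrow> 'n cmat set topology \<Rightarrow> ((nat \<Rightarrow> complex^'n) \<times> 'n cmat set) set topology" where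
  "borel_space \<G> X = quotient_top (prod_topology (top_of_set frames) X) (orbit \<G>)"

text \<open>\<open>n \<in> N(T)\<close> represents \<open>w\<close> if \<open>(w \<lambda>)(h) = \<lambda>(Ad(n\<inverse>) h)\<close> for all weights \<open>\<lambda>\<close>.\<close>

definition represents :: "'n::finite g2 \<Rightarrow> 'n cmat \<Rightarrow> weyl \<Rightarrow> bool" where
  "represents \<G> n w \<longleftrightarrow> n \<in> gp \<G> \<and>
     (\<lambda>h. n ** h ** matrix_inv n) ` tor \<G> = tor \<G> \<and>
     (\<forall>h\<in>lie (tor \<G>). coords \<G> (Ad (matrix_inv n) h) =
        (wt_eval (w (1,0)) (coords \<G> h), wt_eval (w (0,1)) (coords \<G> h)))"

text \<open>A graded linear identification of \<open>Sym(t\<^sup>*)\<close> with \<open>H\<^sub>T\<^sup>*(pt) = H\<^sup>*(BT)\<close>, doubling degrees.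
  The usual one sends a weight to the first Chern class of its line bundle; no normalization is imposed.\<close>

definition point_identification ::
  "'n::finite g2 \<Rightarrow> (nat \<Rightarrow> symt \<Rightarrow> ((nat \<Rightarrow> complex^'n) set chain \<Rightarrow> complex) set) \<Rightarrow> bool" where
  "point_identification \<G> c \<longleftrightarrow> (\<forall>i.
     bij_betw (c i) (Sym_deg i) (cohomology (2 * i) (BT \<G>)) \<and>
     (\<forall>p\<in>Sym_deg i. \<forall>q\<in>Sym_deg i. c i (p + q) = c i p + c i q) \<and>
     (\<forall>p\<in>Sym_deg i. \<forall>a. \<forall>\<phi>\<in>c i p. cochain_scale a \<phi> \<in> c i (\<lambda>h. a * p h)))"

text \<open>The class \<open>\<xi> \<in> H\<^sub>T\<^bsup>2i\<^esup>(X)\<close> restricts to \<open>f w\<close> at each fixed point \<open>wB\<close>. The inclusion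
  of a fixed point \<open>x\<close> induces \<open>BT \<rightarrow> ET \<times>\<^sup>T X\<close>, sending an orbit \<open>K\<close> to \<open>K \<times> {x}\<close>.\<close>

definition restricts_to ::
  "'n::finite g2 \<Rightarrow> (nat \<Rightarrow> symt \<Rightarrow> ((nat \<Rightarrow> complex^'n) set chain \<Rightarrow> complex) set) \<Rightarrow> nat
   \<Rightarrow> (((nat \<Rightarrow> complex^'n) \<times> 'n cmat set) set chain \<Rightarrow> complex) set \<Rightarrow> (weyl \<Rightarrow> symt) \<Rightarrow> bool" where
  "restricts_to \<G> c i \<xi> f \<longleftrightarrow> (\<forall>w\<in>W. \<forall>n. represents \<G> n w \<longrightarrow>
     pullback (2 * i) (BT \<G>) (\<lambda>K. K \<times> {lcoset n (bor \<G>)}) \<xi> = c i (f w))"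

text \<open>\<open>\<rho> i u\<close> is the action of \<open>u\<close> on \<open>H\<^bsup>2i\<^esup>(Hess(M, y))\<close>. The localization theorem for
  \<open>H\<^sub>T\<^sup>*\<close> is part of this definition, because the action exists only by virtue of it. Here \<open>g \<in> G\<close> conjugates \<open>y\<close> into \<open>t\<close>,
  \<open>X\<^sub>0 = Hess(M, Ad(g\<inverse>) y)\<close>, and \<open>\<iota>\<close> is the isomorphism \<open>Hess(M, y) \<rightarrow> X\<^sub>0\<close>, \<open>x \<mapsto> g\<inverse> x\<close>, followed by the
  inclusion of the fibre \<open>X\<^sub>0\<close> into \<open>ET \<times>\<^sup>T X\<^sub>0\<close>. The first condition on \<open>i\<close> says that restriction to
  fixed points identifies \<open>H\<^sub>T\<^bsup>2i\<^esup>(X\<^sub>0)\<close> with the ring of the moment graph, the next two that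
  \<open>H\<^sup>*(Hess(M, y))\<close> is the quotient by the ideal, the last one that \<open>\<rho>\<close> is induced by the dot action.\<close>

definition dot_action ::
  "'n::finite g2 \<Rightarrow> 'n cmat set \<Rightarrow> 'n cmat
   \<Rightarrow> (nat \<Rightarrow> weyl \<Rightarrow> ('n cmat set chain \<Rightarrow> complex) set \<Rightarrow> ('n cmat set chain \<Rightarrow> complex) set) \<Rightarrow> bool" where
  "dot_action \<G> M y \<rho> \<longleftrightarrow> (\<exists>g A\<^sub>0 c.
     g \<in> gp \<G> \<and> Ad (matrix_inv g) y \<in> lie (tor \<G>) \<and> A\<^sub>0 \<in> frames \<and> point_identification \<G> c \<and>
     (let D = root_set \<G> M;
          X\<^sub>0 = Hess \<G> M (Ad (matrix_inv g) y);
          \<iota> = (\<lambda>x. orbit \<G> (A\<^sub>0, lcoset (matrix_inv g) x))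
      in \<forall>i.
        ((\<forall>\<xi>\<in>cohomology (2 * i) (borel_space \<G> X\<^sub>0). \<exists>!f. f \<in> gkm_deg D i \<and> restricts_to \<G> c i \<xi> f) \<and>
         (\<forall>f\<in>gkm_deg D i. \<exists>!\<xi>. \<xi> \<in> cohomology (2 * i) (borel_space \<G> X\<^sub>0) \<and> restricts_to \<G> c i \<xi> f)) \<and>
        pullback (2 * i) (Hess \<G> M y) \<iota> ` cohomology (2 * i) (borel_space \<G> X\<^sub>0)
          = cohomology (2 * i) (Hess \<G> M y) \<and>
        (\<forall>\<xi>\<in>cohomology (2 * i) (borel_space \<G> X\<^sub>0). \<forall>f\<in>gkm_deg D i. restricts_to \<G> c i \<xi> f \<longrightarrow>
           (pullback (2 * i) (Hess \<G> M y) \<iota> \<xi> = coboundaries (2 * i) (Hess \<G> M y)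
            \<longleftrightarrow> f \<in> gkm_ideal D)) \<and>
        (\<forall>u\<in>W. \<forall>\<xi>\<in>cohomology (2 * i) (borel_space \<G> X\<^sub>0). \<forall>\<eta>\<in>cohomology (2 * i) (borel_space \<G> X\<^sub>0).
           \<forall>f\<in>gkm_deg D i. restricts_to \<G> c i \<xi> f \<and> restricts_to \<G> c i \<eta> (dot u f) \<longrightarrow>
             \<rho> i u (pullback (2 * i) (Hess \<G> M y) \<iota> \<xi>) = pullback (2 * i) (Hess \<G> M y) \<iota> \<eta>)))"

text \<open>The coefficient of \<open>q\<^sup>i\<close> in \<open>P\<close> is the character of the dot action in degree \<open>2i\<close>: on the quotient
  of the ring of the moment graph by its ideal, and on \<open>H\<^bsup>2i\<^esup>(Hess(M, y))\<close>.\<close>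

definition gkm_character :: "weight set \<Rightarrow> (weyl \<Rightarrow> complex) poly \<Rightarrow> bool" where
  "gkm_character D P \<longleftrightarrow> (\<forall>i. \<forall>w\<in>W.
     has_trace gkm_scale (gkm_deg D i) (gkm_ideal D \<inter> gkm_deg D i) (\<lambda>K. dot w ` K) (poly.coeff P i w))"

definition cohomology_character ::
  "'a topology \<Rightarrow> (nat \<Rightarrow> weyl \<Rightarrow> ('a chain \<Rightarrow> complex) set \<Rightarrow> ('a chain \<Rightarrow> complex) set)
   \<Rightarrow> (weyl \<Rightarrow> complex) poly \<Rightarrow> bool" where
  "cohomology_character X \<rho> P \<longleftrightarrow> (\<forall>i. \<forall>w\<in>W.
     has_trace cochain_scale (cocycles (2 * i) X) (coboundaries (2 * i) X) (\<rho> i w) (poly.coeff P i w))"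

end

theory Submission imports Defs begin

text \<open>Let \<open>D = \<Phi>(M)\<close> and let \<open>\<gamma>\<close> be a simple root with \<open>-\<gamma> \<in> D\<close> such that \<open>s\<^sub>\<gamma>\<close> permutes the other positive
  roots \<open>\<delta>\<close> with \<open>-\<delta> \<in> D\<close>. Right multiplication by \<open>s\<^sub>\<gamma>\<close> splits a function \<open>f\<close> in the ring of the moment
  graph into a symmetric and an antisymmetric part, and the latter is divisible by the function
  \<open>w \<mapsto> w \<gamma>\<close>. So the ring is \<open>N \<oplus> \<gamma> N\<close>, where \<open>N\<close> consists of functions on the orbit \<open>W \<omega>\<close> of a weight fixed
  by \<open>s\<^sub>\<gamma>\<close>, i.e. on the vertices of a hexagon of short or long roots, that satisfy congruences along
  some of the edges between these vertices. In each case \<open>N\<close> is free over \<open>Sym(t\<^sup>*)\<close>, with a homogeneous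
  basis that \<open>W\<close> permutes up to scalars, and the character in each degree is the sum of the scalars of
  the basis elements that are fixed. For \<open>I\<^bsub>\<beta>+\<alpha>\<^esub>\<close> the two summands satisfy different congruences, and for
  \<open>I\<^bsub>\<alpha>,\<beta>\<^esub>\<close> the sign character takes the place of \<open>\<gamma>\<close>.

  Since the localization theorem is part of \<^const>\<open>dot_action\<close>, the passage from the ring to
  \<open>H\<^sup>*(Hess(M, y))\<close> is formal. A Hessenberg ideal is stable under some \<open>h \<in> t\<close> at which the positive
  roots take distinct values, so it is a sum of root spaces, given by an upward closed set of positive
  roots.\<close>

section \<open>Polynomial functions on the Cartan subalgebra\<close>

text \<open>The function w \<mapsto> w \<gamma> is fixed by the dot action, so \<gamma> N repeats
  the character of N one degree higher and P = (1 + q) Q, with Q the character of N. The choice of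
  \<gamma> is dictated by stability: omitting 3\<alpha> + 2\<beta> alone is compatible with
  s_\<alpha> only, which brings in the long hexagon. When \<alpha> and \<beta> are the only roots
  left, neither simple reflection preserves the other one, and for the whole nilradical there is no
  simple root left to divide by. On the polynomial side the difficulty is divisibility by several
  roots at once. Divisibility by a linear form is read as vanishing on its kernel. Kernels of
  non-proportional forms meet only at the origin, so the origin is left out of the congruences and
  recovered by continuity. With the vertices of a hexagon taken in cyclic order, the degrees of the
  basis are the numbers of earlier neighbours of the vertices. This predicts how many basis elements
  each degree needs; what remains is to choose them so that \<open>W\<close> permutes them up to
  scalars.\<close>

lemma Sym_degI: "p = (\<lambda>(x, y). \<Sum>j\<le>d. a j * x ^ j * y ^ (d - j)) \<Longrightarrow> p \<in> Sym_deg d"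
  by (auto simp: Sym_deg_def)

lemma SymI: "p = (\<lambda>(x, y). \<Sum>j\<le>(N::nat). \<Sum>k\<le>N. a j k * x ^ j * y ^ k) \<Longrightarrow> p \<in> Sym"
  by (auto simp: Sym_def)

lemma Sym_deg_zero: "0 \<in> Sym_deg d"
  by (auto simp: Sym_deg_def fun_eq_iff intro!: exI[of _ "\<lambda>_. 0"])

lemma Sym_deg_add:
  assumes "p \<in> Sym_deg d" "q \<in> Sym_deg d"
  shows "p + q \<in> Sym_deg d"
proof -
  obtain a b where "p = (\<lambda>(x, y). \<Sum>j\<le>d. a j * x ^ j * y ^ (d - j))"
    "q = (\<lambda>(x, y). \<Sum>j\<le>d. b j * x ^ j * y ^ (d - j))"
    using assms by (auto simp: Sym_deg_def)
  then have "p + q = (\<lambda>(x, y). \<Sum>j\<le>d. (a j + b j) * x ^ j * y ^ (d - j))"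
    by (simp add: fun_eq_iff sum.distrib distrib_right)
  then show ?thesis
    by (rule Sym_degI)
qed

lemma Sym_deg_scale:
  assumes "p \<in> Sym_deg d"
  shows "(\<lambda>h. c * p h) \<in> Sym_deg d"
proof -
  obtain a where "p = (\<lambda>(x, y). \<Sum>j\<le>d. a j * x ^ j * y ^ (d - j))"
    using assms by (auto simp: Sym_deg_def)
  then have "(\<lambda>h. c * p h) = (\<lambda>(x, y). \<Sum>j\<le>d. (c * a j) * x ^ j * y ^ (d - j))"
    by (simp add: fun_eq_iff sum_distrib_left mult.assoc)
  then show ?thesis
    by (rule Sym_degI)
qed

lemma Sym_deg_sum: "(\<And>i. i \<in> I \<Longrightarrow> p i \<in> Sym_deg d) \<Longrightarrow> sum p I \<in> Sym_deg d"
  by (induction I rule: infinite_finite_induct) (auto simp: Sym_deg_zero Sym_deg_add)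

lemma sum_fun_apply: "(sum f I) x = (\<Sum>i\<in>I. f i x)"
  by (induction I rule: infinite_finite_induct) auto

lemma monomial_Sym_deg: "(\<lambda>(x, y). c * x ^ j * y ^ k) \<in> Sym_deg (j + k)"
proof -
  have "(\<lambda>(x, y). c * x ^ j * y ^ k) =
    (\<lambda>(x, y). \<Sum>i\<le>j + k. (if i = j then c else 0) * x ^ i * y ^ (j + k - i))"
    by (simp add: fun_eq_iff if_distrib [of "\<lambda>z. z * _"] sum.delta cong: if_cong)
  then show ?thesis
    by (rule Sym_degI)
qed

lemma Sym_deg_mult:
  assumes "p \<in> Sym_deg d" "q \<in> Sym_deg e"
  shows "p * q \<in> Sym_deg (d + e)"
proof -
  obtain a b where pq: "p = (\<lambda>(x, y). \<Sum>j\<le>d. a j * x ^ j * y ^ (d - j))"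
    "q = (\<lambda>(x, y). \<Sum>k\<le>e. b k * x ^ k * y ^ (e - k))"
    using assms by (auto simp: Sym_deg_def)
  have "p * q = (\<Sum>j\<le>d. \<Sum>k\<le>e. (\<lambda>(x, y). (a j * b k) * x ^ (j + k) * y ^ (d - j + (e - k))))"
    by (simp add: pq fun_eq_iff sum_fun_apply sum_product power_add mult_ac del: add_diff_assoc add_diff_assoc2 Nat.add_diff_assoc Nat.add_diff_assoc2 Nat.diff_add_assoc)
  also have "\<dots> \<in> Sym_deg (d + e)"
  proof (intro Sym_deg_sum)
    fix j k assume "j \<in> {..d}" "k \<in> {..e}"
    then have "j + k + (d - j + (e - k)) = d + e" by auto
    then show "(\<lambda>(x, y). (a j * b k) * x ^ (j + k) * y ^ (d - j + (e - k))) \<in> Sym_deg (d + e)"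
      using monomial_Sym_deg[of "a j * b k" "j + k" "d - j + (e - k)"] by simp
  qed
  finally show ?thesis .
qed

lemma Sym_deg_const: "(\<lambda>_. c) \<in> Sym_deg 0"
  using monomial_Sym_deg[of c 0 0] by (simp add: case_prod_unfold)

lemma Sym_deg_one: "1 \<in> Sym_deg 0"
  using Sym_deg_const[of 1] by (simp add: one_fun_def)

lemma Sym_deg_wt_eval: "wt_eval \<gamma> \<in> Sym_deg 1"
proof -
  have "wt_eval \<gamma> = (\<lambda>(x, y). of_int (fst \<gamma>) * x ^ 1 * y ^ 0) + (\<lambda>(x, y). of_int (snd \<gamma>) * x ^ 0 * y ^ 1)"
    by (simp add: fun_eq_iff wt_eval_def)
  then show ?thesis
    using Sym_deg_add[of _ 1] monomial_Sym_deg[of _ 1 0] monomial_Sym_deg[of _ 0 1] by simp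
qed

lemma Sym_deg_wt_eval_power: "wt_eval \<gamma> ^ m \<in> Sym_deg m"
proof (induction m)
  case 0
  show ?case unfolding power_0 by (rule Sym_deg_one)
next
  case (Suc m)
  then show ?case unfolding power_Suc using Sym_deg_mult[OF Sym_deg_wt_eval, of "wt_eval \<gamma> ^ m" m \<gamma>] unfolding plus_1_eq_Suc by blast
qed

lemma Sym_deg_homogeneous:
  assumes "p \<in> Sym_deg d"
  shows "p (t * x, t * y) = t ^ d * p (x, y)"
proof -
  obtain a where p: "p = (\<lambda>(x, y). \<Sum>j\<le>d. a j * x ^ j * y ^ (d - j))"
    using assms by (auto simp: Sym_deg_def)
  have "t ^ j * t ^ (d - j) = t ^ d" if "j \<le> d" for j
    using that by (simp flip: power_add)
  then show ?thesis
    unfolding p by (auto simp: sum_distrib_left power_mult_distrib mult_ac intro!: sum.cong)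
qed

lemma Sym_zero: "0 \<in> Sym"
  by (auto simp: Sym_def fun_eq_iff intro!: exI[of _ "\<lambda>_ _. 0"])

lemma Sym_degE:
  assumes "p \<in> Sym"
  obtains M c where "\<And>i. c i \<in> Sym_deg i" "p = (\<Sum>i\<le>(M::nat). c i)"
proof -
  obtain N a where p: "p = (\<lambda>(x, y). \<Sum>j\<le>(N::nat). \<Sum>k\<le>N. a j k * x ^ j * y ^ k)"
    using assms by (auto simp: Sym_def)
  define c where "c i = (\<Sum>j\<le>N. \<Sum>k\<le>N. if j + k = i then (\<lambda>(x, y). a j k * x ^ j * y ^ k) else 0)" for i
  have "c i \<in> Sym_deg i" for i
    unfolding c_def using monomial_Sym_deg by (intro Sym_deg_sum) (auto simp: Sym_deg_zero)
  moreover have "p = (\<Sum>i\<le>2 * N. c i)"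
  proof -
    have "(\<Sum>i\<le>2 * N. c i) = (\<Sum>j\<le>N. \<Sum>k\<le>N. \<Sum>i\<le>2 * N. if j + k = i then (\<lambda>(x, y). a j k * x ^ j * y ^ k) else 0)"
      unfolding c_def by (rule trans[OF sum.swap], rule sum.cong[OF refl], rule sum.swap)
    also have "\<dots> = (\<Sum>j\<le>N. \<Sum>k\<le>N. (\<lambda>(x, y). a j k * x ^ j * y ^ k))"
      by (intro sum.cong refl) (simp add: sum.delta)
    also have "\<dots> = p"
      by (simp add: p fun_eq_iff sum_fun_apply)
    finally show ?thesis ..
  qed
  ultimately show ?thesis using that by blast
qed

lemma Sym_add:
  assumes "p \<in> Sym" "q \<in> Sym"
  shows "p + q \<in> Sym"
proof -
  obtain N a M b where pq: "p = (\<lambda>(x, y). \<Sum>j\<le>(N::nat). \<Sum>k\<le>N. a j k * x ^ j * y ^ k)"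
    "q = (\<lambda>(x, y). \<Sum>j\<le>(M::nat). \<Sum>k\<le>M. b j k * x ^ j * y ^ k)"
    using assms by (auto simp: Sym_def)
  have ext: "(\<Sum>j\<le>(N::nat). \<Sum>k\<le>N. a j k * x ^ j * y ^ k) =
    (\<Sum>j\<le>(K::nat). \<Sum>k\<le>K. (if j \<le> N \<and> k \<le> N then a j k else 0) * x ^ j * y ^ k)"
    if "N \<le> K" for K N x y and a :: "nat \<Rightarrow> nat \<Rightarrow> complex"
  proof -
    have "(\<Sum>k\<le>N. a j k * x ^ j * y ^ k) = (\<Sum>k\<le>K. (if j \<le> N \<and> k \<le> N then a j k else 0) * x ^ j * y ^ k)"
      if "j \<le> N" for j
      using that \<open>N \<le> K\<close> by (intro sum.mono_neutral_cong_left) auto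
    then show ?thesis
      using \<open>N \<le> K\<close> by (intro sum.mono_neutral_cong_left) auto
  qed
  define c where "c j k = (if j \<le> N \<and> k \<le> N then a j k else 0) + (if j \<le> M \<and> k \<le> M then b j k else 0)" for j k
  have "p + q = (\<lambda>(x, y). \<Sum>j\<le>N + M. \<Sum>k\<le>N + M. c j k * x ^ j * y ^ k)"
    by (simp add: pq fun_eq_iff c_def ext[of N "N + M"] ext[of M "N + M"] distrib_right sum.distrib)
  then show ?thesis
    by (rule SymI)
qed

lemma Sym_sum: "(\<And>i. i \<in> I \<Longrightarrow> p i \<in> Sym) \<Longrightarrow> sum p I \<in> Sym"
  by (induction I rule: infinite_finite_induct) (auto simp: Sym_zero Sym_add)

lemma Sym_deg_subset: "p \<in> Sym_deg d \<Longrightarrow> p \<in> Sym"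
proof -
  assume "p \<in> Sym_deg d"
  then obtain a where "p = (\<lambda>(x, y). \<Sum>j\<le>d. a j * x ^ j * y ^ (d - j))"
    by (auto simp: Sym_deg_def)
  also have "\<dots> = (\<lambda>(x, y). \<Sum>j\<le>d. \<Sum>k\<le>d. (if k = d - j then a j else 0) * x ^ j * y ^ k)"
    by (simp add: fun_eq_iff if_distrib [of "\<lambda>z. z * _"] sum.delta cong: if_cong)
  finally show "p \<in> Sym"
    by (rule SymI)
qed

lemma Sym_mult:
  assumes "p \<in> Sym" "q \<in> Sym"
  shows "p * q \<in> Sym"
proof -
  obtain M c where c: "\<And>i. c i \<in> Sym_deg i" "p = (\<Sum>i\<le>(M::nat). c i)"
    using Sym_degE[OF assms(1)] by blast
  obtain N d where d: "\<And>i. d i \<in> Sym_deg i" "q = (\<Sum>i\<le>(N::nat). d i)"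
    using Sym_degE[OF assms(2)] by blast
  show ?thesis
    unfolding c(2) d(2) sum_product by (intro Sym_sum) (blast intro: Sym_deg_subset Sym_deg_mult c(1) d(1))
qed

lemma Sym_const: "(\<lambda>_. c) \<in> Sym"
  using Sym_deg_const Sym_deg_subset by blast

lemma Sym_one: "1 \<in> Sym"
  using Sym_deg_one Sym_deg_subset by blast

lemma Sym_scale: "p \<in> Sym \<Longrightarrow> (\<lambda>h. c * p h) \<in> Sym"
  using Sym_mult[OF Sym_const[of c]] by (simp add: times_fun_def)

lemma Sym_uminus: "p \<in> Sym \<Longrightarrow> - p \<in> Sym"
  using Sym_scale[of p "-1"] by (simp add: fun_Compl_def)

lemma Sym_diff: "p \<in> Sym \<Longrightarrow> q \<in> Sym \<Longrightarrow> p - q \<in> Sym"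
  using Sym_add[OF _ Sym_uminus, of p q] by simp

lemma Sym_wt_eval: "wt_eval \<gamma> \<in> Sym"
  using Sym_deg_wt_eval Sym_deg_subset by blast

lemma Sym_numeral: "numeral n \<in> Sym"
  using Sym_const[of "numeral n"] by (simp add: numeral_fun)

lemma Sym_power: "p \<in> Sym \<Longrightarrow> p ^ n \<in> Sym"
  by (induction n) (auto simp: Sym_one Sym_mult)

lemma Sym_fst: "fst \<in> Sym" and Sym_snd: "snd \<in> Sym"
proof -
  have "fst = wt_eval (1, 0)" "snd = wt_eval (0, 1)"
    by (auto simp: wt_eval_def)
  then show "fst \<in> Sym" "snd \<in> Sym"
    by (metis Sym_wt_eval)+
qed

text \<open>Polynomial functions arise from constants and the two coordinates by sums and products.
  Divisibility of p - p \<circ> L by a linear form, for instance, is thereby reduced to the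
  coordinates.\<close>

lemma Sym_induct [consumes 1, case_names const fst snd add mult]:
  assumes "p \<in> Sym" and const: "\<And>c. P (\<lambda>_. c)" and "P fst" "P snd"
    and add: "\<And>p q. p \<in> Sym \<Longrightarrow> q \<in> Sym \<Longrightarrow> P p \<Longrightarrow> P q \<Longrightarrow> P (p + q)"
    and mult: "\<And>p q. p \<in> Sym \<Longrightarrow> q \<in> Sym \<Longrightarrow> P p \<Longrightarrow> P q \<Longrightarrow> P (p * q)"
  shows "P p"
proof -
  obtain N a where p: "p = (\<lambda>(x, y). \<Sum>j\<le>(N::nat). \<Sum>k\<le>N. a j k * x ^ j * y ^ k)"
    using assms(1) by (auto simp: Sym_def)
  define Q where "Q p \<longleftrightarrow> p \<in> Sym \<and> P p" for p
  have Q_mult: "Q (p * q)" if "Q p" "Q q" for p q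
    using that mult by (auto simp: Q_def Sym_mult)
  have Q_pow: "Q (q ^ n)" if "Q q" for q n
  proof (induction n)
    case 0
    then show ?case unfolding power_0 Q_def using const[of 1] Sym_one by (simp add: one_fun_def)
  qed (use that Q_mult in \<open>unfold power_Suc, blast\<close>)
  have Q_sum: "Q (sum f {..n})" if "\<And>i. Q (f i)" for f :: "nat \<Rightarrow> symt" and n
  proof (induction n)
    case (Suc n)
    then show ?case
      unfolding sum.atMost_Suc using that add Sym_add unfolding Q_def by blast
  qed (use that in simp)
  have pow: "(q ^ n) h = q h ^ n" for q :: symt and n h
    by (induction n) auto
  have "p = (\<Sum>j\<le>N. \<Sum>k\<le>N. (\<lambda>_. a j k) * fst ^ j * snd ^ k)"
    by (simp add: p fun_eq_iff sum_fun_apply pow)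
  moreover have "Q \<dots>"
    by (intro Q_sum Q_mult Q_pow) (auto simp: Q_def assms Sym_const Sym_fst Sym_snd)
  ultimately show ?thesis
    by (simp add: Q_def)
qed

section \<open>Linear substitution, continuity and divisibility by a weight\<close>

lemma Sym_subst_linear:
  assumes "p \<in> Sym"
  shows "(\<lambda>(x, y). p (a * x + b * y, c * x + d * y)) \<in> Sym"
  using assms
proof (induction p rule: Sym_induct)
  case (const c)
  then show ?case by (simp add: case_prod_unfold Sym_const)
next
  case fst
  have "(\<lambda>(x, y). fst (a * x + b * y, c * x + d * y)) = (\<lambda>h. a * fst h) + (\<lambda>h. b * snd h)"
    by (auto simp: fun_eq_iff)
  then show ?case
    using Sym_add[OF Sym_scale[OF Sym_fst] Sym_scale[OF Sym_snd]] by metis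
next
  case snd
  have "(\<lambda>(x, y). snd (a * x + b * y, c * x + d * y)) = (\<lambda>h. c * fst h) + (\<lambda>h. d * snd h)"
    by (auto simp: fun_eq_iff)
  then show ?case
    using Sym_add[OF Sym_scale[OF Sym_fst] Sym_scale[OF Sym_snd]] by metis
next
  case (add p q)
  then show ?case
    using Sym_add[OF add.IH] by (simp add: plus_fun_def case_prod_unfold)
next
  case (mult p q)
  then show ?case
    using Sym_mult[OF mult.IH] by (simp add: times_fun_def case_prod_unfold)
qed

lemma Sym_continuous: "p \<in> Sym \<Longrightarrow> continuous_on UNIV p"
proof (induction p rule: Sym_induct)
  case (add p q)
  then show ?case by (auto simp: plus_fun_def intro!: continuous_intros)
next
  case (mult p q)
  then show ?case by (auto simp: times_fun_def intro!: continuous_intros)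
qed (auto intro!: continuous_intros)

text \<open>Continuity along the line through h. It allows the origin, where all roots vanish
  together, to be left out of the congruences.\<close>

lemma Sym_zero_off_origin:
  assumes "p \<in> Sym" and "h \<noteq> 0" and zero: "\<And>t. t \<noteq> 0 \<Longrightarrow> p (t * fst h, t * snd h) = 0"
  shows "p 0 = 0"
proof -
  have "continuous_on UNIV (\<lambda>t. p (t * fst h, t * snd h))"
    by (intro continuous_on_compose2[OF Sym_continuous[OF assms(1)]] continuous_intros) auto
  then have "((\<lambda>t. p (t * fst h, t * snd h)) \<longlongrightarrow> p (0 * fst h, 0 * snd h)) (at (0::complex))"
    using continuous_on_def by blast
  moreover have "((\<lambda>t. p (t * fst h, t * snd h)) \<longlongrightarrow> 0) (at (0::complex))"
    using zero by (intro tendsto_eventually) (auto simp: eventually_at intro!: exI[of _ 1])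
  ultimately show ?thesis
    using tendsto_unique[of "at (0::complex)"] by (fastforce simp: zero_prod_def)
qed

text \<open>The origin is excluded from the hypothesis so that the lemma can be applied repeatedly, with
  linear forms that are not proportional.\<close>

lemma wt_eval_dvd:
  assumes p: "p \<in> Sym" and \<gamma>: "\<gamma> \<noteq> 0"
    and zero: "\<And>h. wt_eval \<gamma> h = 0 \<Longrightarrow> h \<noteq> 0 \<Longrightarrow> p h = 0"
  shows "\<exists>q\<in>Sym. p = wt_eval \<gamma> * q"
proof -
  define m n :: complex where "m = of_int (fst \<gamma>)" and "n = of_int (snd \<gamma>)"
  have mn: "m \<noteq> 0 \<or> n \<noteq> 0"
    using \<gamma> by (auto simp: m_def n_def zero_prod_def prod_eq_iff)
  have ev: "wt_eval \<gamma> (x, y) = m * x + n * y" for x y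
    by (simp add: wt_eval_def m_def n_def)
  \<comment> \<open>The coefficients define a projection L onto the line \<gamma> = 0:
    \<open>pr\<close> says that \<gamma> vanishes on the image, \<open>x\<close> and
    \<open>y\<close> that L is the identity modulo \<gamma>. For n = 0 the line is the y-axis;
    otherwise it is parametrised by x.\<close>
  obtain a b c d where pr: "\<And>x y. m * (a * x + b * y) + n * (c * x + d * y) = 0"
    and x: "\<exists>k. \<forall>x y. x - (a * x + b * y) = (m * x + n * y) * k"
    and y: "\<exists>k. \<forall>x y. y - (c * x + d * y) = (m * x + n * y) * k"
  proof (cases "n = 0")
    case True
    with mn have m: "m \<noteq> 0" by simp
    have *: "\<exists>k. \<forall>x y. x - (0 * x + 0 * y) = (m * x + n * y) * k"
      using True m by (intro exI[of _ "1/m"]) simp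
    have **: "\<exists>k. \<forall>x y. y - (0 * x + 1 * y) = (m * x + n * y) * k"
      by (intro exI[of _ 0]) simp
    show ?thesis
      using that[of 0 0 0 1, OF _ * **] True by simp
  next
    case False
    have *: "\<exists>k. \<forall>x y. x - (1 * x + 0 * y) = (m * x + n * y) * k"
      by (intro exI[of _ 0]) simp
    have **: "\<exists>k. \<forall>x y. y - (- m / n * x + 0 * y) = (m * x + n * y) * k"
      using False by (intro exI[of _ "1/n"]) (simp add: field_simps)
    show ?thesis
      using that[of 1 0 "- m / n" 0, OF _ * **] False by simp
  qed
  define L :: "complex \<times> complex \<Rightarrow> complex \<times> complex"
    where "L = (\<lambda>(x, y). (a * x + b * y, c * x + d * y))"
  have L_Sym: "(\<lambda>h. q (L h)) \<in> Sym" if "q \<in> Sym" for q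
    using Sym_subst_linear[OF that, of a b c d] by (simp add: L_def case_prod_unfold)
  \<comment> \<open>Substituting L changes a polynomial only by a multiple of \<gamma>; for products
    this is pq - p'q' = (p - p')q + p'(q - q').\<close>
  have "\<exists>k\<in>Sym. p - (\<lambda>h. p (L h)) = wt_eval \<gamma> * k"
    using p
  proof (induction p rule: Sym_induct)
    case (const c)
    then show ?case using Sym_zero by (auto simp: fun_eq_iff intro!: bexI[of _ 0])
  next
    case fst
    from x obtain k where k: "\<And>x y. x - (a * x + b * y) = (m * x + n * y) * k" by blast
    show ?case
      using k by (intro bexI[of _ "\<lambda>_. k"] Sym_const) (auto simp: fun_eq_iff L_def ev)
  next
    case snd
    from y obtain k where k: "\<And>x y. y - (c * x + d * y) = (m * x + n * y) * k" by blast
    show ?case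
      using k by (intro bexI[of _ "\<lambda>_. k"] Sym_const) (auto simp: fun_eq_iff L_def ev)
  next
    case (add p q)
    then obtain k l where kl: "k \<in> Sym" "p - (\<lambda>h. p (L h)) = wt_eval \<gamma> * k"
      "l \<in> Sym" "q - (\<lambda>h. q (L h)) = wt_eval \<gamma> * l" by blast
    then have "(p + q) - (\<lambda>h. (p + q) (L h)) = wt_eval \<gamma> * (k + l)"
      by (auto simp: fun_eq_iff algebra_simps)
    then show ?case using kl Sym_add by blast
  next
    case (mult p q)
    then obtain k l where kl: "k \<in> Sym" "p - (\<lambda>h. p (L h)) = wt_eval \<gamma> * k"
      "l \<in> Sym" "q - (\<lambda>h. q (L h)) = wt_eval \<gamma> * l" by blast
    have "(p * q) - (\<lambda>h. (p * q) (L h)) =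
        (p - (\<lambda>h. p (L h))) * q + (\<lambda>h. p (L h)) * (q - (\<lambda>h. q (L h)))"
      by (auto simp: fun_eq_iff algebra_simps)
    also have "\<dots> = wt_eval \<gamma> * (k * q + (\<lambda>h. p (L h)) * l)"
      unfolding kl by (simp add: algebra_simps)
    finally show ?case
      using kl mult.hyps L_Sym by (blast intro: Sym_add Sym_mult)
  qed
  then obtain k where k: "k \<in> Sym" "p - (\<lambda>h. p (L h)) = wt_eval \<gamma> * k" by blast
  have off: "p (L h) = 0" if "L h \<noteq> 0" for h
    using that pr by (intro zero) (cases h, auto simp: L_def ev)
  have "p (L h) = 0" for h
  proof (cases "L h = 0")
    case True
    \<comment> \<open>v spans the line \<gamma> = 0, so p vanishes on this line off the origin and,
      by continuity, at the origin.\<close>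
    define v where "v = (n, - m)"
    have v: "v \<noteq> 0" using mn by (auto simp: v_def zero_prod_def)
    have "p (t * fst v, t * snd v) = 0" if "t \<noteq> 0" for t
      using that mn by (intro zero) (auto simp: ev v_def zero_prod_def)
    from Sym_zero_off_origin[OF p v this] show ?thesis using True by simp
  qed (use off in auto)
  then have "p = wt_eval \<gamma> * k"
    using k(2) by (simp add: fun_eq_iff)
  then show ?thesis using k(1) by blast
qed

text \<open>Off the zero line of \<gamma> the factor cancels; on it the values are limits along a
  direction v transverse to the line. The conjugated coefficients make \<gamma>(v) a sum of squared
  absolute values.\<close>

lemma wt_eval_cancel:
  assumes "p \<in> Sym" "q \<in> Sym" and \<gamma>: "\<gamma> \<noteq> 0" and eq: "\<And>h. wt_eval \<gamma> h * p h = wt_eval \<gamma> h * q h"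
  shows "p = q"
proof (rule ext)
  fix h
  define m n :: complex where "m = of_int (fst \<gamma>)" and "n = of_int (snd \<gamma>)"
  have ev: "wt_eval \<gamma> (x, y) = m * x + n * y" for x y
    by (simp add: wt_eval_def m_def n_def)
  have mn: "m \<noteq> 0 \<or> n \<noteq> 0"
    using \<gamma> by (auto simp: m_def n_def zero_prod_def prod_eq_iff)
  define v :: "complex \<times> complex" where "v = (cnj m, cnj n)"
  have v: "wt_eval \<gamma> v \<noteq> 0"
  proof -
    have "wt_eval \<gamma> v = of_real ((cmod m)\<^sup>2 + (cmod n)\<^sup>2)"
      by (simp only: v_def ev complex_norm_square of_real_add)
    moreover have "(cmod m)\<^sup>2 + (cmod n)\<^sup>2 \<noteq> 0"
      using mn by (simp add: sum_power2_eq_zero_iff)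
    ultimately show ?thesis by (metis of_real_eq_0_iff)
  qed
  show "p h = q h"
  proof (cases "wt_eval \<gamma> h = 0")
    case True
    have c: "continuous_on UNIV (\<lambda>t. (p - q) (fst h + t * fst v, snd h + t * snd v))"
      by (intro continuous_on_compose2[OF Sym_continuous[OF Sym_diff[OF assms(1,2)]]] continuous_intros) auto
    then have "((\<lambda>t. (p - q) (fst h + t * fst v, snd h + t * snd v)) \<longlongrightarrow>
        (p - q) (fst h + 0 * fst v, snd h + 0 * snd v)) (at (0::complex))"
      using continuous_on_def by blast
    moreover have "(p - q) (fst h + t * fst v, snd h + t * snd v) = 0" if "t \<noteq> 0" for t
    proof -
      have "wt_eval \<gamma> (fst h + t * fst v, snd h + t * snd v) = wt_eval \<gamma> h + t * wt_eval \<gamma> v"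
        by (simp add: wt_eval_def case_prod_unfold algebra_simps)
      then have "wt_eval \<gamma> (fst h + t * fst v, snd h + t * snd v) \<noteq> 0"
        using True v that by simp
      then show ?thesis using eq[of "(fst h + t * fst v, snd h + t * snd v)"] by simp
    qed
    then have "((\<lambda>t. (p - q) (fst h + t * fst v, snd h + t * snd v)) \<longlongrightarrow> 0) (at (0::complex))"
      by (intro tendsto_eventually) (auto simp: eventually_at intro!: exI[of _ 1])
    ultimately have "(p - q) (fst h + 0 * fst v, snd h + 0 * snd v) = 0"
      using tendsto_unique[of "at (0::complex)"] by fastforce
    then show ?thesis by simp
  next
    case False
    then show ?thesis using eq[of h] by simp
  qed
qed

text \<open>Along the line through h the component of degree i contributes c_i(h) t^i, and a
  polynomial in t that vanishes identically has zero coefficients.\<close>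

lemma Sym_deg_sum_unique:
  fixes c :: "nat \<Rightarrow> symt"
  assumes "\<And>i. i \<le> M \<Longrightarrow> c i \<in> Sym_deg i" and "(\<Sum>i\<le>(M::nat). c i) = 0" and "i \<le> M"
  shows "c i = 0"
proof (rule ext)
  fix h :: "complex \<times> complex"
  have "(\<Sum>i\<le>M. c i h * t ^ i) = 0" for t
  proof -
    have "(\<Sum>i\<le>M. c i h * t ^ i) = (\<Sum>i\<le>M. c i (t * fst h, t * snd h))"
      using Sym_deg_homogeneous[OF assms(1)] by (intro sum.cong) (auto simp: mult.commute)
    also have "\<dots> = (\<Sum>i\<le>M. c i) (t * fst h, t * snd h)"
      by (simp only: sum_fun_apply)
    finally show ?thesis using assms(2) by simp
  qed
  then show "c i h = 0 h"
    using polyfun_eq_0[where n = M and c = "\<lambda>i. c i h"] assms(3) by simp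
qed

section \<open>The Weyl group\<close>

text \<open>A quadruple \<open>(a, b, c, d)\<close> is the matrix with columns \<open>w \<alpha> = (a, c)\<close> and \<open>w \<beta> = (b, d)\<close>.\<close>

definition lin :: "int \<times> int \<times> int \<times> int \<Rightarrow> weyl" where
  "lin = (\<lambda>(a, b, c, d) (m, n). (a * m + b * n, c * m + d * n))"

definition W_mats :: "(int \<times> int \<times> int \<times> int) set" where
  "W_mats = {(1, 0, 0, 1), (-1, 3, 0, 1), (1, 0, 1, -1), (2, -3, 1, -1), (-1, 3, -1, 2), (-2, 3, -1, 1),
     (2, -3, 1, -2), (1, -3, 1, -2), (-2, 3, -1, 2), (-1, 0, -1, 1), (1, -3, 0, -1), (-1, 0, 0, -1)}"

lemma lin_apply [simp]: "lin (a, b, c, d) (m, n) = (a * m + b * n, c * m + d * n)"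
  by (simp add: lin_def)

lemma lin_eq_iff [simp]: "lin A = lin B \<longleftrightarrow> A = B"
proof
  assume *: "lin A = lin B"
  have "lin A (1, 0) = lin B (1, 0)" "lin A (0, 1) = lin B (0, 1)"
    by (simp_all add: *)
  then show "A = B"
    by (cases A, cases B) simp
qed simp

lemma lin_comp [simp]:
  "lin (a, b, c, d) \<circ> lin (a', b', c', d') =
    lin (a * a' + b * c', a * b' + b * d', c * a' + d * c', c * b' + d * d')"
  by (auto simp: fun_eq_iff algebra_simps)

lemma lin_id: "id = lin (1, 0, 0, 1)"
  by (auto simp: fun_eq_iff)

lemma minus_6_mult_div_6: "- (6 * b) div 6 = - b" for b :: int
  by presburger

lemma refl_simps:
  "refl (1, 0) = lin (-1, 3, 0, 1)" "refl (-1, 0) = lin (-1, 3, 0, 1)"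
  "refl (0, 1) = lin (1, 0, 1, -1)" "refl (0, -1) = lin (1, 0, 1, -1)"
  "refl (1, 1) = lin (2, -3, 1, -2)" "refl (-1, -1) = lin (2, -3, 1, -2)"
  "refl (2, 1) = lin (-1, 0, -1, 1)" "refl (-2, -1) = lin (-1, 0, -1, 1)"
  "refl (3, 1) = lin (-2, 3, -1, 2)" "refl (-3, -1) = lin (-2, 3, -1, 2)"
  "refl (3, 2) = lin (1, -3, 0, -1)" "refl (-3, -2) = lin (1, -3, 0, -1)"
  by (auto simp: minus_6_mult_div_6 fun_eq_iff refl_def form_def Let_def; presburger)+

lemma roots_eq: "roots = {(1,0), (0,1), (1,1), (2,1), (3,1), (3,2), (-1,0), (0,-1), (-1,-1), (-2,-1), (-3,-1), (-3,-2)}"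
  by (auto simp: roots_def pos_roots_def)

lemma refl_uminus: "\<gamma> \<in> pos_roots \<Longrightarrow> refl (- \<gamma>) = refl \<gamma>"
  by (auto simp: pos_roots_def refl_simps)

text \<open>The dihedral group of order 12 as an explicit list. Facts about \<open>W\<close>
  peculiar to this root system are settled later by running through the list.\<close>

lemma W_eq: "W = lin ` W_mats"
proof
  show "W \<subseteq> lin ` W_mats"
  proof
    fix w assume "w \<in> W"
    then show "w \<in> lin ` W_mats"
    proof induction
      case one
      then show ?case by (simp add: lin_id W_mats_def)
    next
      case (mult_s w)
      then show ?case by (auto simp: refl_simps W_mats_def image_iff simp del: o_apply)
    next
      case (mult_t w)
      then show ?case by (auto simp: refl_simps W_mats_def image_iff simp del: o_apply)
    qed
  qed
  have s: "lin (3 * c - a, 3 * d - b, c, d) \<in> W" if "lin (a, b, c, d) \<in> W" for a b c d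
    using W.mult_s[OF that] by (simp add: refl_simps)
  have t: "lin (a, b, a - c, b - d) \<in> W" if "lin (a, b, c, d) \<in> W" for a b c d
    using W.mult_t[OF that] by (simp add: refl_simps)
  have e: "lin (1, 0, 0, 1) \<in> W"
    using W.one by (simp add: lin_id)
  \<comment> \<open>With s and t the simple reflections, the odd labels are s, ts, sts, ..., (ts)^3
    and the even ones t, st, ..., tstst. Together with e these are the twelve elements.\<close>
  note 1 = s[OF e] and 2 = t[OF e]
  note 3 = t[OF 1] and 4 = s[OF 2]
  note 5 = s[OF 3] and 6 = t[OF 4]
  note 7 = t[OF 5] and 8 = s[OF 6]
  note 9 = s[OF 7] and 10 = t[OF 8]
  note 11 = t[OF 9]
  show "lin ` W_mats \<subseteq> W"
    using e 1 2 3 4 5 6 7 8 9 10 11 by (auto simp: W_mats_def)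
qed

lemma W_linE:
  assumes "w \<in> W"
  obtains a b c d where "w = lin (a, b, c, d)" "(a, b, c, d) \<in> W_mats"
  using assms by (auto simp: W_eq)

lemma W_comp: "u \<in> W \<Longrightarrow> w \<in> W \<Longrightarrow> u \<circ> w \<in> W"
  by (induction rule: W.induct) (auto intro: W.intros simp: comp_assoc)

lemma refl_in_W: "\<gamma> \<in> roots \<Longrightarrow> refl \<gamma> \<in> W"
  by (auto simp: roots_eq refl_simps W_eq W_mats_def)

lemma refl_refl: "\<gamma> \<in> roots \<Longrightarrow> refl \<gamma> \<circ> refl \<gamma> = id"
  by (auto simp: roots_eq refl_simps lin_id simp del: o_apply)

lemma refl_self: "\<gamma> \<in> roots \<Longrightarrow> refl \<gamma> \<gamma> = - \<gamma>"
  by (auto simp: roots_eq refl_simps)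

lemma W_inverse_exists: "w \<in> W \<Longrightarrow> \<exists>v\<in>W. v \<circ> w = id \<and> w \<circ> v = id"
proof (induction rule: W.induct)
  case one
  then show ?case using W.one by (intro bexI[of _ id]) auto
next
  case (mult_s w)
  then obtain v where v: "v \<in> W" "v \<circ> w = id" "w \<circ> v = id" by blast
  have s: "s\<^sub>\<alpha> \<circ> s\<^sub>\<alpha> = id" "s\<^sub>\<alpha> \<in> W" by (rule refl_refl refl_in_W, simp add: roots_eq)+
  have "(v \<circ> s\<^sub>\<alpha>) \<circ> (s\<^sub>\<alpha> \<circ> w) = id" "(s\<^sub>\<alpha> \<circ> w) \<circ> (v \<circ> s\<^sub>\<alpha>) = id"
    using v s by (metis comp_assoc comp_id)+
  then show ?case using W_comp[OF v(1) s(2)] by blast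
next
  case (mult_t w)
  then obtain v where v: "v \<in> W" "v \<circ> w = id" "w \<circ> v = id" by blast
  have s: "s\<^sub>\<beta> \<circ> s\<^sub>\<beta> = id" "s\<^sub>\<beta> \<in> W" by (rule refl_refl refl_in_W, simp add: roots_eq)+
  have "(v \<circ> s\<^sub>\<beta>) \<circ> (s\<^sub>\<beta> \<circ> w) = id" "(s\<^sub>\<beta> \<circ> w) \<circ> (v \<circ> s\<^sub>\<beta>) = id"
    using v s by (metis comp_assoc comp_id)+
  then show ?case using W_comp[OF v(1) s(2)] by blast
qed

abbreviation winv :: "weyl \<Rightarrow> weyl" where "winv w \<equiv> inv_into UNIV w"

lemma W_inv:
  assumes "w \<in> W"
  shows "winv w \<in> W" "winv w \<circ> w = id" "w \<circ> winv w = id"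
proof -
  obtain v where v: "v \<in> W" "v \<circ> w = id" "w \<circ> v = id"
    using W_inverse_exists[OF assms] by blast
  have "winv w = v" using v by (intro inv_unique_comp)
  then show "winv w \<in> W" "winv w \<circ> w = id" "w \<circ> winv w = id" using v by auto
qed

lemma W_inv_apply: "w \<in> W \<Longrightarrow> winv w (w x) = x" "w \<in> W \<Longrightarrow> w (winv w x) = x"
  using W_inv by (metis comp_apply id_apply)+

lemma W_add: "w \<in> W \<Longrightarrow> w (x + y) = w x + w y"
  by (cases x, cases y, erule W_linE) (auto simp: algebra_simps)

lemma W_uminus: "w \<in> W \<Longrightarrow> w (- x) = - w x"
  by (cases x, erule W_linE) auto

lemma W_diff: "w \<in> W \<Longrightarrow> w (x - y) = w x - w y"
  using W_add[of w x "- y"] by (simp add: W_uminus)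

lemma W_zero: "w \<in> W \<Longrightarrow> w 0 = 0"
  using W_diff[of w 0 0] by simp

lemma W_eq_zero_iff: "w \<in> W \<Longrightarrow> w x = 0 \<longleftrightarrow> x = 0"
  using W_zero W_inv_apply(1) by metis

lemma W_roots: "w \<in> W \<Longrightarrow> \<gamma> \<in> roots \<Longrightarrow> w \<gamma> \<in> roots"
proof (induction rule: W.induct)
  case (mult_s w)
  then have "w \<gamma> \<in> roots" by simp
  then show ?case by (auto simp: roots_eq refl_simps)
next
  case (mult_t w)
  then have "w \<gamma> \<in> roots" by simp
  then show ?case by (auto simp: roots_eq refl_simps)
qed simp

lemma zero_notin_roots: "0 \<notin> roots"
  by (simp add: roots_eq zero_prod_def)

lemma roots_uminus: "\<gamma> \<in> roots \<Longrightarrow> - \<gamma> \<in> roots"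
  by (auto simp: roots_eq)

lemma pos_roots_subset: "\<gamma> \<in> pos_roots \<Longrightarrow> \<gamma> \<in> roots"
  by (simp add: roots_def)

lemma wt_eval_add: "wt_eval (x + y) = wt_eval x + wt_eval y"
  by (auto simp: wt_eval_def fun_eq_iff algebra_simps)

lemma wt_eval_uminus: "wt_eval (- x) = - wt_eval x"
  by (auto simp: wt_eval_def fun_eq_iff algebra_simps)

lemma wt_eval_diff: "wt_eval (x - y) = wt_eval x - wt_eval y"
  by (auto simp: wt_eval_def fun_eq_iff algebra_simps)

lemma act_Sym_wt_eval: "w \<in> W \<Longrightarrow> act_Sym w (wt_eval x) = wt_eval (w x)"
  by (cases x, erule W_linE) (auto simp: act_Sym_def wt_eval_def fun_eq_iff algebra_simps)

lemma act_Sym_comp: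
  assumes "u \<in> W" "v \<in> W"
  shows "act_Sym u (act_Sym v p) = act_Sym (u \<circ> v) p"
proof
  fix h
  have "wt_eval (v x) (wt_eval (u (1,0)) h, wt_eval (u (0,1)) h) = wt_eval (u (v x)) h" for x
    using fun_cong[OF act_Sym_wt_eval[OF assms(1), of "v x"], of h] by (simp add: act_Sym_def)
  then show "act_Sym u (act_Sym v p) h = act_Sym (u \<circ> v) p h"
    by (simp add: act_Sym_def)
qed

lemma act_Sym_id: "act_Sym id p = p"
  by (auto simp: act_Sym_def wt_eval_def fun_eq_iff)

lemma act_Sym_mult: "act_Sym u (p * q) = act_Sym u p * act_Sym u q"
  by (simp add: act_Sym_def fun_eq_iff)

lemma act_Sym_one: "act_Sym u 1 = 1"
  by (simp add: act_Sym_def fun_eq_iff)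

lemma act_Sym_uminus: "act_Sym u (- p) = - act_Sym u p"
  by (simp add: act_Sym_def fun_eq_iff)

lemma act_Sym_power: "act_Sym u (p ^ n) = act_Sym u p ^ n"
  by (induction n) (simp_all only: power_0 power_Suc act_Sym_one act_Sym_mult)

lemma act_Sym_Sym: "p \<in> Sym \<Longrightarrow> act_Sym u p \<in> Sym"
  using Sym_subst_linear[of p "of_int (fst (u (1,0)))" "of_int (snd (u (1,0)))"
      "of_int (fst (u (0,1)))" "of_int (snd (u (0,1)))"]
  by (simp add: act_Sym_def wt_eval_def case_prod_unfold)

lemma act_Sym_deg:
  assumes "p \<in> Sym_deg d"
  shows "act_Sym u p \<in> Sym_deg d"
proof -
  obtain a where p: "p = (\<lambda>(x, y). \<Sum>j\<le>d. a j * x ^ j * y ^ (d - j))"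
    using assms by (auto simp: Sym_deg_def)
  define f where "f j = (\<lambda>h. a j * ((wt_eval (u (1,0)) ^ j) * (wt_eval (u (0,1)) ^ (d - j))) h)" for j
  have pow: "(q ^ n) h = q h ^ n" for q :: symt and n h
    by (induction n) auto
  have "act_Sym u p = (\<Sum>j\<le>d. f j)"
    by (simp add: act_Sym_def p fun_eq_iff sum_fun_apply f_def pow mult.assoc)
  also have "\<dots> \<in> Sym_deg d"
  proof (intro Sym_deg_sum)
    fix j assume "j \<in> {..d}"
    then have "j + (d - j) = d" by simp
    then show "f j \<in> Sym_deg d"
      unfolding f_def
      by (metis Sym_deg_scale Sym_deg_mult Sym_deg_wt_eval_power)
  qed
  finally show ?thesis .
qed

section \<open>The ring of the moment graph\<close>

text \<open>\<open>wt_eval_dvd\<close> turns membership in a principal ideal into agreement on the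
  zero set of a root. A root and its negative have the same zero set and the same reflection, so
  positive roots can be used. In this pointwise form closure under products and under the dot action
  is immediate.\<close>

lemma gkm_iff:
  "f \<in> gkm D \<longleftrightarrow> (\<forall>w. w \<notin> W \<longrightarrow> f w = 0) \<and> (\<forall>w\<in>W. f w \<in> Sym) \<and>
     (\<forall>w\<in>W. \<forall>\<delta>\<in>pos_roots. - \<delta> \<in> D \<longrightarrow> (\<forall>h. wt_eval (w \<delta>) h = 0 \<longrightarrow> f w h = f (w \<circ> refl \<delta>) h))"
proof -
  have "(\<exists>q\<in>Sym. f w - f (w \<circ> refl (- \<delta>)) = wt_eval (w (- \<delta>)) * q) \<longleftrightarrow>
      (\<forall>h. wt_eval (w \<delta>) h = 0 \<longrightarrow> f w h = f (w \<circ> refl \<delta>) h)"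
    if w: "w \<in> W" and \<delta>: "\<delta> \<in> pos_roots" and f: "\<forall>w\<in>W. f w \<in> Sym" for w \<delta>
  proof
    assume "\<exists>q\<in>Sym. f w - f (w \<circ> refl (- \<delta>)) = wt_eval (w (- \<delta>)) * q"
    then obtain q where q: "f w - f (w \<circ> refl \<delta>) = wt_eval (w (- \<delta>)) * q"
      using refl_uminus[OF \<delta>] by auto
    show "\<forall>h. wt_eval (w \<delta>) h = 0 \<longrightarrow> f w h = f (w \<circ> refl \<delta>) h"
    proof (intro allI impI)
      fix h assume "wt_eval (w \<delta>) h = 0"
      then show "f w h = f (w \<circ> refl \<delta>) h"
        using fun_cong[OF q, of h] w by (simp add: W_uminus wt_eval_uminus)
    qed
  next
    assume *: "\<forall>h. wt_eval (w \<delta>) h = 0 \<longrightarrow> f w h = f (w \<circ> refl \<delta>) h"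
    have d: "\<delta> \<in> roots" using \<delta> by (rule pos_roots_subset)
    have "f w - f (w \<circ> refl \<delta>) \<in> Sym"
      using f w W_comp[OF w refl_in_W[OF d]] Sym_diff by blast
    moreover have "w (- \<delta>) \<noteq> 0"
      using w d zero_notin_roots roots_uminus W_eq_zero_iff[of w "- \<delta>"] by metis
    ultimately have "\<exists>q\<in>Sym. f w - f (w \<circ> refl \<delta>) = wt_eval (w (- \<delta>)) * q"
      by (rule wt_eval_dvd) (use * w in \<open>auto simp: W_uminus wt_eval_uminus\<close>)
    then show "\<exists>q\<in>Sym. f w - f (w \<circ> refl (- \<delta>)) = wt_eval (w (- \<delta>)) * q"
      using refl_uminus[OF \<delta>] by simp
  qed
  note * = this
  have **: "(\<forall>\<delta>\<in>D \<inter> uminus ` pos_roots. E \<delta>) \<longleftrightarrow> (\<forall>\<delta>\<in>pos_roots. - \<delta> \<in> D \<longrightarrow> E (- \<delta>))" for E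
    by blast
  show ?thesis
    unfolding gkm_def mem_Collect_eq **
    by (rule conj_cong[OF refl], rule conj_cong[OF refl], intro ball_cong refl imp_cong) (rule *)
qed

lemma gkm_outside: "f \<in> gkm D \<Longrightarrow> w \<notin> W \<Longrightarrow> f w = 0"
  and gkm_Sym: "f \<in> gkm D \<Longrightarrow> w \<in> W \<Longrightarrow> f w \<in> Sym"
  and gkm_edge: "f \<in> gkm D \<Longrightarrow> w \<in> W \<Longrightarrow> \<delta> \<in> pos_roots \<Longrightarrow> - \<delta> \<in> D \<Longrightarrow> wt_eval (w \<delta>) h = 0 \<Longrightarrow>
    f w h = f (w \<circ> refl \<delta>) h"
  unfolding gkm_iff by blast+

lemma gkmI:
  assumes "\<And>w. w \<notin> W \<Longrightarrow> f w = 0" "\<And>w. w \<in> W \<Longrightarrow> f w \<in> Sym"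
    "\<And>w \<delta> h. w \<in> W \<Longrightarrow> \<delta> \<in> pos_roots \<Longrightarrow> - \<delta> \<in> D \<Longrightarrow> wt_eval (w \<delta>) h = 0 \<Longrightarrow>
      f w h = f (w \<circ> refl \<delta>) h"
  shows "f \<in> gkm D"
  unfolding gkm_iff using assms by blast

lemma gkm_zero: "0 \<in> gkm D"
  by (rule gkmI) (auto simp: Sym_zero)

lemma gkm_add:
  assumes "f \<in> gkm D" "g \<in> gkm D"
  shows "f + g \<in> gkm D"
proof (rule gkmI)
  fix w \<delta> h assume e: "w \<in> W" "\<delta> \<in> pos_roots" "- \<delta> \<in> D" "wt_eval (w \<delta>) h = 0"
  then show "(f + g) w h = (f + g) (w \<circ> refl \<delta>) h"
    using gkm_edge[OF assms(1) e] gkm_edge[OF assms(2) e] by simp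
qed (simp_all only: plus_fun_apply gkm_outside[OF assms(1)] gkm_outside[OF assms(2)] add_0 simp_thms
      Sym_add gkm_Sym[OF assms(1)] gkm_Sym[OF assms(2)])

lemma gkm_mult:
  assumes "f \<in> gkm D" "g \<in> gkm D"
  shows "f * g \<in> gkm D"
proof (rule gkmI)
  fix w \<delta> h assume e: "w \<in> W" "\<delta> \<in> pos_roots" "- \<delta> \<in> D" "wt_eval (w \<delta>) h = 0"
  then show "(f * g) w h = (f * g) (w \<circ> refl \<delta>) h"
    using gkm_edge[OF assms(1) e] gkm_edge[OF assms(2) e] by simp
qed (simp_all only: times_fun_apply gkm_outside[OF assms(1)] gkm_outside[OF assms(2)] mult_zero_left simp_thms
      Sym_mult gkm_Sym[OF assms(1)] gkm_Sym[OF assms(2)])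

lemma gkm_Sym_mult:
  assumes "p \<in> Sym" "f \<in> gkm D"
  shows "(\<lambda>w. p * f w) \<in> gkm D"
proof (rule gkmI)
  fix w \<delta> h assume e: "w \<in> W" "\<delta> \<in> pos_roots" "- \<delta> \<in> D" "wt_eval (w \<delta>) h = 0"
  then show "(p * f w) h = (p * f (w \<circ> refl \<delta>)) h"
    using gkm_edge[OF assms(2) e] by simp
next
  fix w assume "w \<notin> W"
  then show "p * f w = 0" by (simp only: gkm_outside[OF assms(2)] mult_zero_right simp_thms)
qed (simp_all only: Sym_mult assms gkm_Sym[OF assms(2)])

lemma gkm_scale_gkm: "f \<in> gkm D \<Longrightarrow> gkm_scale c f \<in> gkm D"
  using gkm_Sym_mult[OF Sym_const[of c], of f D] by (simp add: gkm_scale_def times_fun_def)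

lemma gkm_deg_iff: "f \<in> gkm_deg D i \<longleftrightarrow> f \<in> gkm D \<and> (\<forall>w\<in>W. f w \<in> Sym_deg i)"
  by (simp add: gkm_deg_def)

lemma gkm_deg_zero: "0 \<in> gkm_deg D i"
  by (simp add: gkm_deg_iff gkm_zero Sym_deg_zero)

lemma gkm_deg_add: "f \<in> gkm_deg D i \<Longrightarrow> g \<in> gkm_deg D i \<Longrightarrow> f + g \<in> gkm_deg D i"
  by (auto simp only: gkm_deg_iff plus_fun_apply intro: gkm_add Sym_deg_add)

lemma gkm_deg_scale: "f \<in> gkm_deg D i \<Longrightarrow> gkm_scale c f \<in> gkm_deg D i"
  unfolding gkm_deg_iff using gkm_scale_gkm Sym_deg_scale by (auto simp: gkm_scale_def)

lemma gkm_deg_sum: "(\<And>j. j \<in> I \<Longrightarrow> f j \<in> gkm_deg D i) \<Longrightarrow> sum f I \<in> gkm_deg D i"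
  by (induction I rule: infinite_finite_induct)
    (auto intro: gkm_deg_add simp: gkm_deg_zero simp del: zero_fun_apply plus_fun_apply)

section \<open>The dot action and the ideal\<close>

lemma dot_apply: "w \<in> W \<Longrightarrow> dot u f w = act_Sym u (f (winv u \<circ> w))"
  by (simp add: dot_def)

lemma dot_gkm:
  assumes u: "u \<in> W" and f: "f \<in> gkm D"
  shows "dot u f \<in> gkm D"
proof (rule gkmI)
  fix w assume w: "w \<in> W"
  have uw: "winv u \<circ> w \<in> W" using u w by (simp add: W_comp W_inv)
  show "dot u f w \<in> Sym"
    unfolding dot_apply[OF w] using gkm_Sym[OF f uw] by (rule act_Sym_Sym)
  fix \<delta> h assume \<delta>: "\<delta> \<in> pos_roots" "- \<delta> \<in> D" and h: "wt_eval (w \<delta>) h = 0"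
  \<comment> \<open>h' is the point at which \<open>act_Sym u\<close> evaluates: a weight takes at
    h' the value that its image under u takes at h.\<close>
  define h' where "h' = (wt_eval (u (1,0)) h, wt_eval (u (0,1)) h)"
  have "wt_eval ((winv u \<circ> w) \<delta>) h' = act_Sym u (wt_eval (winv u (w \<delta>))) h"
    by (simp add: act_Sym_def h'_def)
  also have "\<dots> = 0"
    using h u by (simp add: act_Sym_wt_eval W_inv_apply)
  finally have "f (winv u \<circ> w) h' = f (winv u \<circ> w \<circ> refl \<delta>) h'"
    using gkm_edge[OF f uw \<delta>] by simp
  then show "dot u f w h = dot u f (w \<circ> refl \<delta>) h"
    using w W_comp[OF w refl_in_W[OF pos_roots_subset[OF \<delta>(1)]]]
    by (simp add: dot_apply act_Sym_def h'_def comp_assoc)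
qed (simp add: dot_def)

lemma dot_gkm_deg: "u \<in> W \<Longrightarrow> f \<in> gkm_deg D i \<Longrightarrow> dot u f \<in> gkm_deg D i"
  unfolding gkm_deg_iff by (auto simp: dot_gkm dot_apply W_comp W_inv act_Sym_deg)

lemma dot_add: "dot u (f + g) = dot u f + dot u g"
  by (simp add: dot_def fun_eq_iff act_Sym_def)

lemma dot_Sym_mult: "dot u (\<lambda>w. p * f w) = (\<lambda>w. act_Sym u p * dot u f w)"
  by (simp add: dot_def fun_eq_iff act_Sym_def)

lemma dot_scale: "dot u (gkm_scale c f) = gkm_scale c (dot u f)"
  by (simp add: dot_def fun_eq_iff act_Sym_def gkm_scale_def)

lemma dot_zero: "dot u 0 = 0"
  by (simp add: dot_def fun_eq_iff act_Sym_def)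

lemma dot_comp:
  assumes "u \<in> W" "v \<in> W"
  shows "dot u (dot v f) = dot (u \<circ> v) f"
proof
  fix w
  show "dot u (dot v f) w = dot (u \<circ> v) f w"
  proof (cases "w \<in> W")
    case True
    have "bij u" "bij v"
      using W_inv[OF assms(1)] W_inv[OF assms(2)] o_bij by blast+
    then have "winv (u \<circ> v) = winv v \<circ> winv u"
      by (rule o_inv_distrib)
    then show ?thesis
      using assms True by (simp add: dot_apply W_comp W_inv act_Sym_comp comp_assoc)
  qed (simp add: dot_def)
qed

lemma dot_id: "f \<in> gkm D \<Longrightarrow> dot id f = f"
  by (auto simp: dot_def fun_eq_iff act_Sym_id gkm_outside inv_id)

interpretation gkm: Modules.module gkm_scale
  by unfold_locales (auto simp: gkm_scale_def fun_eq_iff algebra_simps)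

lemma gkm_ideal_dot:
  assumes u: "u \<in> W" and f: "f \<in> gkm_ideal D"
  shows "dot u f \<in> gkm_ideal D"
  using f unfolding gkm_ideal_def
proof (induction rule: gkm.span_induct_alt)
  case base
  then show ?case by (simp add: dot_zero gkm.span_zero del: zero_fun_apply)
next
  case (step c x y)
  then obtain p f d where x: "x = (\<lambda>w. p * f w)" "f \<in> gkm D" "d > 0" "p \<in> Sym_deg d"
    by auto
  have "dot u x = (\<lambda>w. act_Sym u p * dot u f w)"
    by (simp only: x dot_Sym_mult)
  moreover have "dot u f \<in> gkm D" "act_Sym u p \<in> Sym_deg d"
    using x u by (auto intro: dot_gkm act_Sym_deg)
  ultimately have "dot u x \<in> gkm.span {\<lambda>w. p * f w |p f. f \<in> gkm D \<and> (\<exists>d>0. p \<in> Sym_deg d)}"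
    using x(3) by (intro gkm.span_base) blast
  then show ?case
    unfolding dot_add dot_scale using step.IH by (intro gkm.span_add gkm.span_scale)
qed

section \<open>Traces of monomial actions on the quotient by the ideal\<close>

abbreviation dot_trace :: "weight set \<Rightarrow> nat \<Rightarrow> weyl \<Rightarrow> complex \<Rightarrow> bool" where
  "dot_trace D i u \<equiv> has_trace gkm_scale (gkm_deg D i) (gkm_ideal D \<inter> gkm_deg D i) (\<lambda>K. dot u ` K)"

text \<open>\<open>has_trace\<close> numbers its basis by an initial segment of the naturals and
  pads coefficients with 0. An enumeration e of I with inverse e' carries this over to the index
  sets that occur below, such as weights and disjoint sums.\<close>

lemma has_trace_finite_index:
  fixes v :: "'i \<Rightarrow> 'v::ab_group_add"
  assumes I: "finite I" and v: "\<And>i. i \<in> I \<Longrightarrow> v i \<in> Z"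
    and ex: "\<And>z. z \<in> Z \<Longrightarrow> \<exists>a. z - (\<Sum>i\<in>I. scl (a i) (v i)) \<in> N"
    and uniq: "\<And>z a b i. z \<in> Z \<Longrightarrow> z - (\<Sum>i\<in>I. scl (a i) (v i)) \<in> N \<Longrightarrow>
      z - (\<Sum>i\<in>I. scl (b i) (v i)) \<in> N \<Longrightarrow> i \<in> I \<Longrightarrow> a i = b i"
    and F: "\<And>j. j \<in> I \<Longrightarrow> F (v j +o N) = (\<Sum>i\<in>I. scl (A i j) (v i)) +o N"
  shows "has_trace scl Z N F (\<Sum>i\<in>I. A i i)"
proof -
  obtain e where e: "bij_betw e {..<card I} I"
    using ex_bij_betw_nat_finite[OF I] by (auto simp: atLeast0LessThan)
  define n where "n = card I"
  note e = e[folded n_def]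
  have e_mem: "i < n \<Longrightarrow> e i \<in> I" for i
    using e by (auto simp: bij_betw_def)
  note re = sum.reindex_bij_betw[OF e]
  define e' where "e' = the_inv_into {..<n} e"
  have e': "i \<in> I \<Longrightarrow> e' i < n \<and> e (e' i) = i" "k < n \<Longrightarrow> e' (e k) = k" for i k
  proof -
    show "i \<in> I \<Longrightarrow> e' i < n \<and> e (e' i) = i"
      using e the_inv_into_into[of e "{..<n}" i "{..<n}"] f_the_inv_into_f[of e "{..<n}" i]
      by (auto simp: e'_def bij_betw_def)
    show "k < n \<Longrightarrow> e' (e k) = k"
      using e by (auto simp: e'_def bij_betw_def the_inv_into_f_f)
  qed
  show ?thesis
    unfolding has_trace_def
  proof (intro exI conjI allI impI ballI)
    fix z assume z: "z \<in> Z"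
    show "\<exists>!a. (\<forall>i\<ge>n. a i = 0) \<and> z - (\<Sum>i<n. scl (a i) ((v \<circ> e) i)) \<in> N"
    proof (rule ex_ex1I)
      obtain a where a: "z - (\<Sum>i\<in>I. scl (a i) (v i)) \<in> N" using ex[OF z] by blast
      have "(\<Sum>i<n. scl (if i < n then a (e i) else 0) ((v \<circ> e) i)) = (\<Sum>i\<in>I. scl (a i) (v i))"
        by (simp flip: re)
      then show "\<exists>a. (\<forall>i\<ge>n. a i = 0) \<and> z - (\<Sum>i<n. scl (a i) ((v \<circ> e) i)) \<in> N"
        using a by (intro exI[of _ "\<lambda>i. if i < n then a (e i) else 0"]) auto
      fix a b
      assume ab: "(\<forall>i\<ge>n. a i = 0) \<and> z - (\<Sum>i<n. scl (a i) ((v \<circ> e) i)) \<in> N"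
        "(\<forall>i\<ge>n. b i = 0) \<and> z - (\<Sum>i<n. scl (b i) ((v \<circ> e) i)) \<in> N"
      have tr: "(\<Sum>i<n. scl (a i) (v (e i))) = (\<Sum>i\<in>I. scl (a (e' i)) (v i))" for a
        using e' by (simp flip: re)
      have "a i = b i" if "i < n" for i
        using uniq[OF z, of "a \<circ> e'" "b \<circ> e'" "e i"] ab that e' e_mem by (simp add: tr)
      then show "a = b"
        using ab by (metis ext linorder_not_less)
    qed
  next
    fix j assume "j < n"
    then show "F ((v \<circ> e) j +o N) = (\<Sum>i<n. scl (A (e i) (e j)) ((v \<circ> e) i)) +o N"
      using F[OF e_mem] re[of "\<lambda>i. scl (A i (e j)) (v i)"] by simp
  next
    show "(\<Sum>i\<in>I. A i i) = (\<Sum>i<n. A (e i) (e i))"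
      by (rule re[of "\<lambda>i. A i i", symmetric])
  qed (use v e_mem in auto)
qed

text \<open>The independence hypothesis at a single point \<open>h\<^sub>0\<close> suffices because the \<open>b j\<close> are homogeneous
  and a coefficient that vanishes on the punctured line through \<open>h\<^sub>0\<close> vanishes at the origin.\<close>

lemma has_trace_monomial:
  fixes b :: "'i \<Rightarrow> weyl \<Rightarrow> symt" and h0 :: "complex \<times> complex"
  assumes J: "finite J" and b: "\<And>j. j \<in> J \<Longrightarrow> b j \<in> gkm_deg D (d j)"
    and span: "\<And>f. f \<in> gkm D \<Longrightarrow>
      \<exists>r. (\<forall>j\<in>J. r j \<in> Sym) \<and> (\<forall>w\<in>W. f w = (\<Sum>j\<in>J. r j * b j w))"
    and h0: "h0 \<noteq> 0"
    and indep: "\<And>a j. (\<And>w. w \<in> W \<Longrightarrow> (\<Sum>j\<in>J. a j * b j w h0) = 0) \<Longrightarrow> j \<in> J \<Longrightarrow> a j = 0"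
    and act: "\<And>u j. u \<in> W \<Longrightarrow> j \<in> J \<Longrightarrow> \<pi> u j \<in> J \<and> d (\<pi> u j) = d j"
      "\<And>u j w. u \<in> W \<Longrightarrow> j \<in> J \<Longrightarrow> w \<in> W \<Longrightarrow> dot u (b j) w = (\<lambda>h. \<sigma> u j * b (\<pi> u j) w h)"
    and u: "u \<in> W"
  shows "dot_trace D i u
    (\<Sum>j | j \<in> J \<and> d j = i \<and> \<pi> u j = j. \<sigma> u j)"
proof -
  define N where "N = gkm_ideal D \<inter> gkm_deg D i"
  define I where "I = {j \<in> J. d j = i}"
  define A where "A k j = (if k = \<pi> u j then \<sigma> u j else 0)" for k j
  have I: "finite I" "I \<subseteq> J" using J by (auto simp: I_def)
  have b': "b j \<in> gkm D" "j \<in> J \<Longrightarrow> w \<in> W \<Longrightarrow> b j w \<in> Sym_deg (d j)" if "j \<in> J" for j w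
    using b[OF that] by (auto simp: gkm_deg_iff)
  have scale_sum_apply: "(\<Sum>k\<in>K. gkm_scale (c k) (b k)) w h = (\<Sum>k\<in>K. c k * b k w h)" for K c w h
    by (simp add: sum_fun_apply gkm_scale_def)
  \<comment> \<open>Elements of the ideal have coefficients that vanish at the origin, because each
    generator carries a factor homogeneous of positive degree.\<close>
  have ideal_expand: "\<exists>q. (\<forall>j\<in>J. q j \<in> Sym \<and> q j 0 = 0) \<and> (\<forall>w\<in>W. f w = (\<Sum>j\<in>J. q j * b j w))"
    if "f \<in> gkm_ideal D" for f
    using that unfolding gkm_ideal_def
  proof (induction rule: gkm.span_induct_alt)
    case base
    show ?case
      by (intro exI[of _ "\<lambda>_. 0"]) (simp add: Sym_zero del: zero_fun_apply, simp)
  next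
    case (step c x y)
    obtain q where q: "\<forall>j\<in>J. q j \<in> Sym \<and> q j 0 = 0" "\<forall>w\<in>W. y w = (\<Sum>j\<in>J. q j * b j w)"
      using step.IH by blast
    obtain p f e where x: "x = (\<lambda>w. p * f w)" "f \<in> gkm D" "e > 0" "p \<in> Sym_deg e"
      using step.hyps by auto
    obtain r where r: "\<forall>j\<in>J. r j \<in> Sym" "\<forall>w\<in>W. f w = (\<Sum>j\<in>J. r j * b j w)"
      using span[OF x(2)] by blast
    have p0: "p 0 = 0"
      using Sym_deg_homogeneous[OF x(4), of 0 0 0] x(3) by (simp add: zero_prod_def zero_power)
    define cp where "cp = (\<lambda>h. c * p h)"
    have cp: "cp \<in> Sym" "cp 0 = 0"
      using x(4) p0 by (auto simp: cp_def Sym_scale Sym_deg_subset)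
    have "(gkm_scale c x + y) w = (\<Sum>j\<in>J. (cp * r j + q j) * b j w)" if "w \<in> W" for w
    proof -
      have "(gkm_scale c x + y) w = cp * f w + y w"
        by (simp add: fun_eq_iff gkm_scale_def x(1) cp_def)
      also have "\<dots> = (\<Sum>j\<in>J. (cp * r j + q j) * b j w)"
        using r(2) q(2) that by (simp only: sum_distrib_left sum.distrib[symmetric] distrib_right mult.assoc)
      finally show ?thesis .
    qed
    moreover have "cp * r j + q j \<in> Sym" "(cp * r j + q j) 0 = 0" if "j \<in> J" for j
      using that cp r(1) q(1) by (blast intro: Sym_add Sym_mult) (simp add: cp q(1) that)
    ultimately show ?case by (intro exI[of _ "\<lambda>j. cp * r j + q j"]) blast
  qed
  \<comment> \<open>The coefficients of a relation vanish at the origin; this yields uniqueness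
    modulo the ideal. At t h0 the power t^(d j) is extracted from b j, which leaves a relation with
    complex coefficients as in \<open>indep\<close>.\<close>
  have zero_coeff: "q j 0 = 0"
    if q: "\<forall>j\<in>J. q j \<in> Sym" and eq: "\<forall>w\<in>W. (\<Sum>j\<in>J. q j * b j w) = 0" and j: "j \<in> J" for q j
  proof (rule Sym_zero_off_origin[OF _ h0])
    show "q j \<in> Sym" using q j by blast
    fix t :: complex assume t: "t \<noteq> 0"
    define ht where "ht = (t * fst h0, t * snd h0)"
    have "t ^ d j * q j ht = 0"
    proof (rule indep[where a = "\<lambda>j. t ^ d j * q j ht", OF _ j])
      fix w assume w: "w \<in> W"
      have "(\<Sum>j\<in>J. t ^ d j * q j ht * b j w h0) = (\<Sum>j\<in>J. q j ht * b j w ht)"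
      proof (rule sum.cong[OF refl])
        fix j assume j: "j \<in> J"
        have "b j w ht = t ^ d j * b j w h0"
          using Sym_deg_homogeneous[OF b'(2)[OF j j w], of t "fst h0" "snd h0"] by (simp add: ht_def)
        then show "t ^ d j * q j ht * b j w h0 = q j ht * b j w ht" by simp
      qed
      also have "\<dots> = (\<Sum>j\<in>J. q j * b j w) ht"
        by (simp add: sum_fun_apply)
      finally show "(\<Sum>j\<in>J. t ^ d j * q j ht * b j w h0) = 0"
        using eq w by simp
    qed
    then show "q j (t * fst h0, t * snd h0) = 0"
      using t by (simp add: ht_def)
  qed
  have N_dot: "dot u ` N = N"
  proof
    show "dot u ` N \<subseteq> N"
      using u by (auto simp: N_def gkm_ideal_dot dot_gkm_deg)
    show "N \<subseteq> dot u ` N"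
    proof
      fix f assume f: "f \<in> N"
      have "dot u (dot (winv u) f) = f"
        using f u dot_id by (auto simp: dot_comp W_inv N_def gkm_deg_iff)
      moreover have "dot (winv u) f \<in> N"
        using f u by (auto simp: N_def gkm_ideal_dot dot_gkm_deg W_inv)
      ultimately show "f \<in> dot u ` N" by (metis image_eqI)
    qed
  qed
  have "has_trace gkm_scale (gkm_deg D i) N (\<lambda>K. dot u ` K) (\<Sum>j\<in>I. A j j)"
  proof (rule has_trace_finite_index[OF I(1), where v = b and A = A])
    fix j assume "j \<in> I"
    then show "b j \<in> gkm_deg D i" using b[of j] by (auto simp: I_def)
  next
    fix f assume f: "f \<in> gkm_deg D i"
    then have f': "f \<in> gkm D" "\<And>w. w \<in> W \<Longrightarrow> f w \<in> Sym_deg i" by (auto simp: gkm_deg_iff)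
    obtain r where r: "\<forall>j\<in>J. r j \<in> Sym" "\<forall>w\<in>W. f w = (\<Sum>j\<in>J. r j * b j w)"
      using span[OF f'(1)] by blast
    have "\<exists>M c. (\<forall>k. c k \<in> Sym_deg k) \<and> r j = (\<Sum>k\<le>(M::nat). c k)" if "j \<in> J" for j
      using r(1) that Sym_degE by metis
    then obtain M c where c: "\<And>j k. j \<in> J \<Longrightarrow> c j k \<in> Sym_deg k"
      "\<And>j. j \<in> J \<Longrightarrow> r j = (\<Sum>k\<le>M j. c j k)"
      by metis
    define c' where "c' j k = (if k \<le> M j then c j k else 0)" for j k
    have c': "c' j k \<in> Sym_deg k" if "j \<in> J" for j k
      using c(1)[OF that] by (simp add: c'_def Sym_deg_zero del: zero_fun_apply)
    \<comment> \<open>For f homogeneous of degree i only the component of degree i - d j in the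
      coefficient of b j matters. If d j > i there is none, and the case distinction keeps truncated
      subtraction from suggesting one of degree 0.\<close>
    define s where "s j = (if d j \<le> i then c' j (i - d j) else 0)" for j
    have f_eq: "f w = (\<Sum>j\<in>J. s j * b j w)" if w: "w \<in> W" for w
    proof -
      \<comment> \<open>K bounds the degrees of all terms; the summand i puts degree i itself in
        range.\<close>
      define K where "K = i + (\<Sum>j\<in>J. M j + d j)"
      have K: "M j + d j \<le> K" if "j \<in> J" for j
        using member_le_sum[of j J "\<lambda>j. M j + d j"] J that by (simp add: K_def)
      define g where "g k = (\<Sum>j\<in>J. (if d j \<le> k then c' j (k - d j) else 0) * b j w)" for k
      have g: "g k \<in> Sym_deg k" for k
        unfolding g_def
      proof (rule Sym_deg_sum)
        fix j assume j: "j \<in> J"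
        show "(if d j \<le> k then c' j (k - d j) else 0) * b j w \<in> Sym_deg k"
        proof (cases "d j \<le> k")
          case True
          then show ?thesis
            using Sym_deg_mult[OF c'[OF j, of "k - d j"] b'(2)[OF j j w]] by simp
        qed (simp add: Sym_deg_zero del: zero_fun_apply)
      qed
      have "(\<Sum>k\<le>K. g k) = (\<Sum>j\<in>J. (\<Sum>k\<le>K. (if d j \<le> k then c' j (k - d j) else 0)) * b j w)"
        unfolding g_def by (subst sum.swap) (simp add: sum_distrib_right)
      also have "\<dots> = (\<Sum>j\<in>J. r j * b j w)"
      proof (rule sum.cong[OF refl])
        fix j assume j: "j \<in> J"
        have "(\<Sum>k\<le>K. (if d j \<le> k then c' j (k - d j) else 0)) = (\<Sum>k\<in>{d j..K}. c' j (k - d j))"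
          by (intro sum.mono_neutral_cong_right) auto
        also have "\<dots> = (\<Sum>k\<le>K - d j. c' j k)"
          using K[OF j] by (intro sum.reindex_bij_witness[of _ "\<lambda>k. k + d j" "\<lambda>k. k - d j"]) auto
        also have "\<dots> = (\<Sum>k\<le>M j. c j k)"
          using K[OF j] by (intro sum.mono_neutral_cong_right) (auto simp: c'_def)
        finally show "(\<Sum>k\<le>K. (if d j \<le> k then c' j (k - d j) else 0)) * b j w = r j * b j w"
          using c(2)[OF j] by simp
      qed
      also have "\<dots> = f w" using r(2) w by simp
      finally have sum_g: "(\<Sum>k\<le>K. g k) = f w" .
      have i: "i \<le> K" by (simp add: K_def)
      have "(if k = i then g k - f w else g k) = 0" if "k \<le> K" for k
      proof (rule Sym_deg_sum_unique[OF _ _ that])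
        fix k
        have "g k - f w \<in> Sym_deg k" if "k = i"
          using Sym_deg_add[OF g Sym_deg_scale[OF f'(2)[OF w], of "-1"]] that
          by (simp add: fun_diff_def plus_fun_def)
        then show "(if k = i then g k - f w else g k) \<in> Sym_deg k"
          using g by simp
        have "(\<Sum>k\<le>K. if k = i then g k - f w else g k) = (\<Sum>k\<le>K. g k - (if k = i then f w else 0))"
          by (intro sum.cong) auto
        also have "\<dots> = 0"
          using i sum_g by (simp add: sum_subtractf del: zero_fun_apply)
        finally show "(\<Sum>k\<le>K. if k = i then g k - f w else g k) = 0" .
      qed
      from this[OF i] have "g i = f w" by simp
      then show ?thesis by (simp add: g_def s_def)
    qed
    \<comment> \<open>For d j = i the coefficient has degree 0 and is the constant a j. Every other
      term is 0 or has a coefficient of positive degree, and so lies in the ideal.\<close>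
    define a where "a j = s j 0" for j
    have sI: "s j = (\<lambda>_. a j)" if "j \<in> I" for j
    proof -
      have "s j \<in> Sym_deg 0"
        using that c'[of j 0] by (auto simp: s_def I_def)
      then obtain k where "s j = (\<lambda>(x, y). \<Sum>j\<le>0. k j * x ^ j * y ^ (0 - j))"
        by (auto simp: Sym_deg_def)
      then have "s j = (\<lambda>_. k 0)" by (auto simp: fun_eq_iff)
      then show ?thesis by (simp add: a_def)
    qed
    have "f - (\<Sum>j\<in>I. gkm_scale (a j) (b j)) = (\<Sum>j\<in>J - I. (\<lambda>w. s j * b j w))"
    proof
      fix w
      show "(f - (\<Sum>j\<in>I. gkm_scale (a j) (b j))) w = (\<Sum>j\<in>J - I. (\<lambda>w. s j * b j w)) w"
      proof (cases "w \<in> W")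
        case True
        have "(\<Sum>j\<in>I. gkm_scale (a j) (b j)) w = (\<Sum>j\<in>I. s j * b j w)"
          by (simp add: sum_fun_apply gkm_scale_def sI fun_eq_iff)
        then show ?thesis
          using f_eq[OF True] sum.subset_diff[OF I(2) J, of "\<lambda>j. s j * b j w"]
          by (simp add: sum_fun_apply)
      next
        case False
        have "b j w = 0" if "j \<in> J" for j
          using gkm_outside[OF b'(1)[OF that] False] .
        then show ?thesis
          using gkm_outside[OF f'(1) False] I(2)
          by (simp add: fun_eq_iff sum_fun_apply gkm_scale_def subset_eq)
      qed
    qed
    also have "\<dots> \<in> N"
      unfolding N_def
    proof
      show "(\<Sum>j\<in>J - I. (\<lambda>w. s j * b j w)) \<in> gkm_ideal D"
        unfolding gkm_ideal_def
      proof (rule gkm.span_sum)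
        fix j assume j: "j \<in> J - I"
        show "(\<lambda>w. s j * b j w) \<in> gkm.span {\<lambda>w. p * f w |p f. f \<in> gkm D \<and> (\<exists>d>0. p \<in> Sym_deg d)}"
        proof (cases "d j \<le> i")
          case True
          then have "s j \<in> Sym_deg (i - d j)" "i - d j > 0"
            using j c'[of j] by (auto simp: s_def I_def)
          then show ?thesis using b'(1)[of j] j by (intro gkm.span_base) blast
        next
          case False
          then have "s j \<in> Sym_deg 1"
            by (simp add: s_def Sym_deg_zero del: zero_fun_apply)
          then show ?thesis using b'(1)[of j] j by (intro gkm.span_base) (blast intro: zero_less_one)
        qed
      qed
      show "(\<Sum>j\<in>J - I. (\<lambda>w. s j * b j w)) \<in> gkm_deg D i"
      proof (rule gkm_deg_sum)
        fix j assume j: "j \<in> J - I"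
        show "(\<lambda>w. s j * b j w) \<in> gkm_deg D i"
        proof (cases "d j \<le> i")
          case True
          then have s: "s j \<in> Sym_deg (i - d j)" "i - d j + d j = i"
            using j c'[of j] by (auto simp: s_def)
          then have "s j * b j w \<in> Sym_deg i" if "w \<in> W" for w
            using Sym_deg_mult[OF s(1) b'(2)[of j w]] j that by auto
          then show ?thesis
            using gkm_Sym_mult[OF Sym_deg_subset[OF s(1)] b'(1)[of j]] j by (auto simp: gkm_deg_iff)
        next
          case False
          then have "(\<lambda>w. s j * b j w) = 0" by (simp add: s_def fun_eq_iff)
          then show ?thesis using gkm_deg_zero by metis
        qed
      qed
    qed
    finally show "\<exists>a. f - (\<Sum>j\<in>I. gkm_scale (a j) (b j)) \<in> N" by blast
  next
    fix f a a' k
    assume f: "f \<in> gkm_deg D i" and k: "k \<in> I"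
      and a: "f - (\<Sum>j\<in>I. gkm_scale (a j) (b j)) \<in> N" "f - (\<Sum>j\<in>I. gkm_scale (a' j) (b j)) \<in> N"
    obtain q where q: "\<forall>j\<in>J. q j \<in> Sym \<and> q j 0 = 0"
      "\<forall>w\<in>W. (f - (\<Sum>j\<in>I. gkm_scale (a j) (b j))) w = (\<Sum>j\<in>J. q j * b j w)"
      using ideal_expand a(1) unfolding N_def by blast
    obtain q' where q': "\<forall>j\<in>J. q' j \<in> Sym \<and> q' j 0 = 0"
      "\<forall>w\<in>W. (f - (\<Sum>j\<in>I. gkm_scale (a' j) (b j))) w = (\<Sum>j\<in>J. q' j * b j w)"
      using ideal_expand a(2) unfolding N_def by blast
    \<comment> \<open>The difference of the two expansions is a relation with coefficients e. At the
      origin q and q' vanish, so \<open>zero_coeff\<close> leaves a = a'.\<close>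
    define e where "e j = (\<lambda>_::complex \<times> complex. if j \<in> I then a j - a' j else 0) + (q j - q' j)" for j
    have e_Sym: "\<forall>j\<in>J. e j \<in> Sym"
      unfolding e_def using q q' by (intro ballI Sym_add Sym_const Sym_diff) auto
    have e_sum: "\<forall>w\<in>W. (\<Sum>j\<in>J. e j * b j w) = 0"
    proof (intro ballI ext)
      fix w h assume w: "w \<in> W"
      have "(\<Sum>j\<in>I. (a j - a' j) * b j w h) = (\<Sum>j\<in>J. (if j \<in> I then a j - a' j else 0) * b j w h)"
        using I J by (intro sum.mono_neutral_cong_left) auto
      moreover have "(\<Sum>j\<in>I. (a j - a' j) * b j w h) =
          (f - (\<Sum>j\<in>I. gkm_scale (a' j) (b j))) w h - (f - (\<Sum>j\<in>I. gkm_scale (a j) (b j))) w h"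
        by (simp add: sum_fun_apply gkm_scale_def sum_subtractf left_diff_distrib)
      moreover have "\<dots> = (\<Sum>j\<in>J. (q' j h - q j h) * b j w h)"
        using q(2) q'(2) w by (simp add: sum_fun_apply sum_subtractf left_diff_distrib)
      ultimately show "(\<Sum>j\<in>J. e j * b j w) h = 0 h"
        by (simp add: sum_fun_apply e_def distrib_right left_diff_distrib sum.distrib sum_subtractf)
    qed
    have "e k 0 = 0"
      using zero_coeff[OF e_Sym e_sum] k I(2) by blast
    then show "a k = a' k"
      using k I(2) q q' by (auto simp: e_def)
  next
    fix j assume j: "j \<in> I"
    then have jJ: "j \<in> J" and pj: "\<pi> u j \<in> I" using act(1)[OF u] by (auto simp: I_def)
    have "dot u (b j) = gkm_scale (\<sigma> u j) (b (\<pi> u j))"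
    proof
      fix w
      show "dot u (b j) w = gkm_scale (\<sigma> u j) (b (\<pi> u j)) w"
      proof (cases "w \<in> W")
        case False
        then show ?thesis
          using gkm_outside[OF b'(1) False, of "\<pi> u j"] pj I(2)
          by (auto simp: dot_def gkm_scale_def fun_eq_iff)
      qed (use act(2)[OF u jJ] in \<open>simp add: gkm_scale_def\<close>)
    qed
    also have "\<dots> = (\<Sum>k\<in>I. gkm_scale (A k j) (b k))"
    proof -
      have "(\<Sum>k\<in>I. gkm_scale (A k j) (b k)) = (\<Sum>k\<in>I. if k = \<pi> u j then gkm_scale (\<sigma> u j) (b k) else 0)"
        by (intro sum.cong) (auto simp: A_def gkm_scale_def fun_eq_iff)
      then show ?thesis using pj I(1) by (simp add: sum.delta del: zero_fun_apply)
    qed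
    finally have *: "dot u (b j) = (\<Sum>k\<in>I. gkm_scale (A k j) (b k))" .
    have "dot u ` (b j +o N) = dot u (b j) +o dot u ` N"
    proof -
      have "x +o K = (+) x ` K" for x :: "weyl \<Rightarrow> symt" and K
        by (auto simp: elt_set_plus_def)
      then show ?thesis by (simp add: image_image dot_add)
    qed
    then show "dot u ` (b j +o N) = (\<Sum>k\<in>I. gkm_scale (A k j) (b k)) +o N"
      using * N_dot by simp
  qed
  moreover have "(\<Sum>j\<in>I. A j j) = (\<Sum>j | j \<in> J \<and> d j = i \<and> \<pi> u j = j. \<sigma> u j)"
  proof -
    have "(\<Sum>j\<in>I. A j j) = (\<Sum>j\<in>{j \<in> I. \<pi> u j = j}. \<sigma> u j)"
      unfolding sum.inter_filter[OF I(1)] A_def by (intro sum.cong) auto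
    also have "{j \<in> I. \<pi> u j = j} = {j. j \<in> J \<and> d j = i \<and> \<pi> u j = j}"
      by (auto simp: I_def)
    finally show ?thesis .
  qed
  ultimately show ?thesis
    by (simp add: N_def)
qed

section \<open>Transfer from the ring of the moment graph to cohomology\<close>

lemma subspace_gkm_deg: "gkm.subspace (gkm_deg D i)"
  by (rule gkm.subspaceI) (auto intro: gkm_deg_zero gkm_deg_add gkm_deg_scale)

interpretation cochain: Modules.module cochain_scale
  by unfold_locales (auto simp: cochain_scale_def fun_eq_iff algebra_simps)

lemma cochain_scale_apply: "cochain_scale a \<phi> c = a * \<phi> c"
  by (simp add: cochain_scale_def)

lemma subspace_cochains: "cochain.subspace (cochains k X)"
  by (auto simp: cochain.subspace_def cochains_def cochain_scale_def algebra_simps)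

lemma subspace_cocycles: "cochain.subspace (cocycles k X)"
  using subspace_cochains[of k X] by (auto simp: cochain.subspace_def cocycles_def cochain_scale_def)

lemma subspace_coboundaries: "cochain.subspace (coboundaries k X)"
proof (rule cochain.subspaceI)
  show "0 \<in> coboundaries k X"
    unfolding coboundaries_def mem_Collect_eq
    using cochain.subspace_0[OF subspace_cochains, of k X] cochain.subspace_0[OF subspace_cochains, of "k - 1" X]
    by (intro conjI bexI[of _ 0]) simp_all
next
  fix \<phi> \<psi> assume "\<phi> \<in> coboundaries k X" "\<psi> \<in> coboundaries k X"
  then obtain \<phi>' \<psi>' where *: "\<phi> \<in> cochains k X" "\<psi> \<in> cochains k X"
    "\<phi>' \<in> cochains (k - 1) X" "\<psi>' \<in> cochains (k - 1) X"
    "\<forall>c. singular_chain k X c \<longrightarrow> \<phi> c = \<phi>' (chain_boundary k c)"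
    "\<forall>c. singular_chain k X c \<longrightarrow> \<psi> c = \<psi>' (chain_boundary k c)"
    unfolding coboundaries_def by blast
  show "\<phi> + \<psi> \<in> coboundaries k X"
    unfolding coboundaries_def mem_Collect_eq
    using * cochain.subspace_add[OF subspace_cochains *(1,2)] cochain.subspace_add[OF subspace_cochains *(3,4)]
    by (intro conjI bexI[of _ "\<phi>' + \<psi>'"]) simp_all
next
  fix a \<phi> assume "\<phi> \<in> coboundaries k X"
  then obtain \<phi>' where *: "\<phi> \<in> cochains k X" "\<phi>' \<in> cochains (k - 1) X"
    "\<forall>c. singular_chain k X c \<longrightarrow> \<phi> c = \<phi>' (chain_boundary k c)"
    unfolding coboundaries_def by blast
  show "cochain_scale a \<phi> \<in> coboundaries k X"
    unfolding coboundaries_def mem_Collect_eq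
    using * cochain.subspace_scale[OF subspace_cochains *(1)] cochain.subspace_scale[OF subspace_cochains *(2)]
    by (intro conjI bexI[of _ "cochain_scale a \<phi>'"]) (simp_all add: cochain_scale_apply)
qed

lemma coset_mem_iff: "x \<in> y +o S \<longleftrightarrow> x - y \<in> S" for x y :: "'a::ab_group_add"
  by (auto simp: elt_set_plus_def intro!: bexI[of _ "x - y"])

lemma coset_eq_iff:
  assumes "cochain.subspace S"
  shows "x +o S = y +o S \<longleftrightarrow> x - y \<in> S"
proof
  assume "x +o S = y +o S"
  moreover have "x \<in> x +o S"
    using cochain.subspace_0[OF assms] by (simp add: coset_mem_iff del: zero_fun_apply)
  ultimately show "x - y \<in> S"
    by (simp add: coset_mem_iff)
next
  assume *: "x - y \<in> S"
  show "x +o S = y +o S"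
  proof (intro Set.set_eqI)
    fix z
    have "z - x \<in> S \<longleftrightarrow> z - y \<in> S"
      using cochain.subspace_add[OF assms _ *, of "z - x"] cochain.subspace_diff[OF assms _ *, of "z - y"]
      by (auto simp: algebra_simps)
    then show "z \<in> x +o S \<longleftrightarrow> z \<in> y +o S" by (simp add: coset_mem_iff)
  qed
qed

text \<open>A subspace is recovered from a coset by translating back by one of the elements of the
  coset. In this way coboundaries are read off from equations between classes.\<close>

lemma coset_eq_imp_subspace_eq:
  assumes S: "cochain.subspace S" and T: "cochain.subspace T" and eq: "x +o S = y +o T"
  shows "S = T"
proof -
  have "x \<in> x +o S"
    using cochain.subspace_0[OF S] by (simp add: coset_mem_iff del: zero_fun_apply)
  then have "x - y \<in> T"
    using eq by (simp add: coset_mem_iff)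
  then have "y +o T = x +o T"
    using coset_eq_iff[OF T] by blast
  then have "x + z \<in> x +o S \<longleftrightarrow> x + z \<in> x +o T" for z
    using eq by simp
  then show ?thesis
    by (intro Set.set_eqI) (simp add: coset_mem_iff)
qed

lemma coset_add:
  assumes "cochain.subspace S"
  shows "(x +o S) + (y +o S) = (x + y) +o S"
proof (intro Set.set_eqI iffI)
  fix z assume "z \<in> (x +o S) + (y +o S)"
  then obtain a b where "a \<in> S" "b \<in> S" "z = (x + a) + (y + b)"
    by (auto simp: elt_set_plus_def set_plus_def)
  then show "z \<in> (x + y) +o S"
    using cochain.subspace_add[OF assms, of a b] by (simp add: coset_mem_iff algebra_simps)
next
  fix z assume "z \<in> (x + y) +o S"
  then have "z = (x + (z - (x + y))) + (y + 0)" "x + (z - (x + y)) \<in> x +o S" "y + 0 \<in> y +o S"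
    using cochain.subspace_0[OF assms] by (simp_all add: coset_mem_iff algebra_simps del: zero_fun_apply)
  then show "z \<in> (x +o S) + (y +o S)"
    by (metis set_plus_intro)
qed

lemma cohomologyE:
  assumes "\<xi> \<in> cohomology k X"
  obtains \<phi> where "\<phi> \<in> cocycles k X" "\<xi> = \<phi> +o coboundaries k X"
  using assms by (auto simp: cohomology_def)

lemma cohomologyI: "\<phi> \<in> cocycles k X \<Longrightarrow> \<phi> +o coboundaries k X \<in> cohomology k X"
  by (auto simp: cohomology_def)

definition pull :: "nat \<Rightarrow> 'a topology \<Rightarrow> ('a \<Rightarrow> 'b) \<Rightarrow> ('b chain \<Rightarrow> complex) \<Rightarrow> 'a chain \<Rightarrow> complex" where
  "pull k X h \<phi> = (\<lambda>c. if singular_chain k X c then \<phi> (chain_map k h c) else 0)"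

lemma pull_add: "pull k X h (\<phi> + \<psi>) = pull k X h \<phi> + pull k X h \<psi>"
  and pull_diff: "pull k X h (\<phi> - \<psi>) = pull k X h \<phi> - pull k X h \<psi>"
  and pull_scale: "pull k X h (cochain_scale a \<phi>) = cochain_scale a (pull k X h \<phi>)"
  and pull_zero: "pull k X h 0 = 0"
  by (auto simp: pull_def fun_eq_iff cochain_scale_apply)

lemma pull_sum: "pull k X h (sum f I) = (\<Sum>i\<in>I. pull k X h (f i))"
  by (induction I rule: infinite_finite_induct) (simp_all add: pull_zero pull_add del: zero_fun_apply plus_fun_apply)

text \<open>No continuity of \<open>h\<close> is used: that the pullback of a class is again a single class will come
  from the hypotheses in \<^const>\<open>dot_action\<close>.\<close>

lemma pullback_coset:
  "pullback k X h (\<phi> +o C) = pull k X h \<phi> +o (pull k X h ` C + coboundaries k X)"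
proof -
  have "pull k X h ` (\<phi> +o C) = pull k X h \<phi> +o pull k X h ` C"
    by (auto simp: elt_set_plus_def pull_add image_iff) (metis pull_add)
  moreover have "pullback k X h K = pull k X h ` K + coboundaries k X" for K
    by (simp add: pullback_def pull_def[abs_def])
  ultimately show ?thesis
    by (simp add: set_plus_rearrange3)
qed

lemma subspace_pull_plus:
  assumes C: "cochain.subspace C" and B: "cochain.subspace B"
  shows "cochain.subspace (pull k X h ` C + B)"
proof (rule cochain.subspaceI)
  have "0 = pull k X h 0 + 0" by (simp add: pull_zero del: zero_fun_apply)
  then show "0 \<in> pull k X h ` C + B"
    using cochain.subspace_0[OF C] cochain.subspace_0[OF B] by (metis imageI set_plus_intro)
next
  fix x y assume "x \<in> pull k X h ` C + B" "y \<in> pull k X h ` C + B"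
  then obtain a b a' b' where *: "a \<in> C" "b \<in> B" "a' \<in> C" "b' \<in> B"
    "x = pull k X h a + b" "y = pull k X h a' + b'"
    by (auto elim!: set_plus_elim)
  have "x + y = pull k X h (a + a') + (b + b')"
    using * by (simp add: pull_add algebra_simps del: plus_fun_apply)
  then show "x + y \<in> pull k X h ` C + B"
    using cochain.subspace_add[OF C *(1,3)] cochain.subspace_add[OF B *(2,4)] by (metis imageI set_plus_intro)
next
  fix c x assume "x \<in> pull k X h ` C + B"
  then obtain a b where *: "a \<in> C" "b \<in> B" "x = pull k X h a + b"
    by (auto elim!: set_plus_elim)
  have "cochain_scale c x = pull k X h (cochain_scale c a) + cochain_scale c b"
    using * by (simp add: pull_scale cochain.scale_right_distrib del: plus_fun_apply)
  then show "cochain_scale c x \<in> pull k X h ` C + B"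
    using cochain.subspace_scale[OF C *(1)] cochain.subspace_scale[OF B *(2)] by (metis imageI set_plus_intro)
qed

text \<open>A single class whose pullback is again a class forces coboundaries to pull back to
  coboundaries; then the pullback of any class is one coset of coboundaries.\<close>

lemma pullback_eq_coset:
  assumes "pullback k X h (\<phi> +o coboundaries k Y) = \<psi> +o coboundaries k X"
  shows "pull k X h ` coboundaries k Y + coboundaries k X = coboundaries k X"
  using assms unfolding pullback_coset
  by (rule coset_eq_imp_subspace_eq[OF subspace_pull_plus[OF subspace_coboundaries subspace_coboundaries]
        subspace_coboundaries])

text \<open>The values of c are cohomology classes, so one known restriction supplies the equation
  to which \<open>pullback_eq_coset\<close> applies.\<close>

lemma restricts_to_eq:
  assumes c: "point_identification \<G> c" and f: "f \<in> gkm_deg D i" and w: "w \<in> W"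
    and eq: "pullback (2 * i) (BT \<G>) h (\<phi> +o coboundaries (2 * i) Y) = c i (f w)"
  shows "pull (2 * i) (BT \<G>) h ` coboundaries (2 * i) Y + coboundaries (2 * i) (BT \<G>) = coboundaries (2 * i) (BT \<G>)"
    and "c i (f w) = pull (2 * i) (BT \<G>) h \<phi> +o coboundaries (2 * i) (BT \<G>)"
proof -
  have "f w \<in> Sym_deg i" using f w by (simp add: gkm_deg_iff)
  then have "c i (f w) \<in> cohomology (2 * i) (BT \<G>)"
    using c unfolding point_identification_def bij_betw_def by blast
  then obtain \<zeta> where \<zeta>: "c i (f w) = \<zeta> +o coboundaries (2 * i) (BT \<G>)"
    by (rule cohomologyE)
  show 1: "pull (2 * i) (BT \<G>) h ` coboundaries (2 * i) Y + coboundaries (2 * i) (BT \<G>) = coboundaries (2 * i) (BT \<G>)"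
    using eq \<zeta> by (intro pullback_eq_coset) simp
  show "c i (f w) = pull (2 * i) (BT \<G>) h \<phi> +o coboundaries (2 * i) (BT \<G>)"
    using eq unfolding pullback_coset 1 by simp
qed

lemma restricts_to_add:
  assumes c: "point_identification \<G> c" and f: "f \<in> gkm_deg D i" and g: "g \<in> gkm_deg D i"
    and r: "restricts_to \<G> c i (\<phi> +o coboundaries (2 * i) Y) f"
      "restricts_to \<G> c i (\<psi> +o coboundaries (2 * i) Y) g"
  shows "restricts_to \<G> c i ((\<phi> + \<psi>) +o coboundaries (2 * i) Y) (f + g)"
  unfolding restricts_to_def
proof (intro ballI allI impI)
  fix w n assume w: "w \<in> W" and n: "represents \<G> n w"
  let ?h = "\<lambda>K. K \<times> {lcoset n (bor \<G>)}"
  have 1: "pullback (2 * i) (BT \<G>) ?h (\<phi> +o coboundaries (2 * i) Y) = c i (f w)"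
    and 2: "pullback (2 * i) (BT \<G>) ?h (\<psi> +o coboundaries (2 * i) Y) = c i (g w)"
    using r w n by (auto simp: restricts_to_def)
  have "f w \<in> Sym_deg i" "g w \<in> Sym_deg i" using f g w by (auto simp: gkm_deg_iff)
  then have "c i ((f + g) w) = c i (f w) + c i (g w)"
    using c by (simp only: point_identification_def plus_fun_apply)
  also have "\<dots> = (pull (2 * i) (BT \<G>) ?h \<phi> + pull (2 * i) (BT \<G>) ?h \<psi>) +o coboundaries (2 * i) (BT \<G>)"
    unfolding restricts_to_eq(2)[OF c f w 1] restricts_to_eq(2)[OF c g w 2]
    by (rule coset_add[OF subspace_coboundaries])
  finally show "pullback (2 * i) (BT \<G>) ?h ((\<phi> + \<psi>) +o coboundaries (2 * i) Y) = c i ((f + g) w)"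
    unfolding pullback_coset restricts_to_eq(1)[OF c f w 1] pull_add by simp
qed

lemma restricts_to_scale:
  assumes c: "point_identification \<G> c" and f: "f \<in> gkm_deg D i"
    and r: "restricts_to \<G> c i (\<phi> +o coboundaries (2 * i) Y) f"
  shows "restricts_to \<G> c i (cochain_scale a \<phi> +o coboundaries (2 * i) Y) (gkm_scale a f)"
  unfolding restricts_to_def
proof (intro ballI allI impI)
  fix w n assume w: "w \<in> W" and n: "represents \<G> n w"
  let ?h = "\<lambda>K. K \<times> {lcoset n (bor \<G>)}" and ?B = "coboundaries (2 * i) (BT \<G>)"
  have 1: "pullback (2 * i) (BT \<G>) ?h (\<phi> +o coboundaries (2 * i) Y) = c i (f w)"
    using r w n by (auto simp: restricts_to_def)
  have fw: "f w \<in> Sym_deg i" using f w by (auto simp: gkm_deg_iff)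
  have "pull (2 * i) (BT \<G>) ?h \<phi> \<in> c i (f w)"
    unfolding restricts_to_eq(2)[OF c f w 1] using cochain.subspace_0[OF subspace_coboundaries, of "2 * i" "BT \<G>"]
    by (simp add: coset_mem_iff del: zero_fun_apply)
  \<comment> \<open>\<open>point_identification\<close> describes scaling through members of a
    class; one common member then identifies the two cosets.\<close>
  then have mem: "cochain_scale a (pull (2 * i) (BT \<G>) ?h \<phi>) \<in> c i (gkm_scale a f w)"
    using c fw unfolding point_identification_def gkm_scale_def by blast
  have "gkm_scale a f w \<in> Sym_deg i"
    using gkm_deg_scale[OF f] w by (auto simp: gkm_deg_iff)
  then have "c i (gkm_scale a f w) \<in> cohomology (2 * i) (BT \<G>)"
    using c unfolding point_identification_def bij_betw_def by blast
  then obtain \<zeta> where \<zeta>: "c i (gkm_scale a f w) = \<zeta> +o ?B"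
    by (rule cohomologyE)
  have "\<zeta> +o ?B = cochain_scale a (pull (2 * i) (BT \<G>) ?h \<phi>) +o ?B"
    using mem \<zeta> coset_eq_iff[OF subspace_coboundaries] by (metis coset_mem_iff)
  then show "pullback (2 * i) (BT \<G>) ?h (cochain_scale a \<phi> +o coboundaries (2 * i) Y) = c i (gkm_scale a f w)"
    unfolding pullback_coset restricts_to_eq(1)[OF c f w 1] pull_scale \<zeta> by simp
qed

lemma restricts_to_sum:
  fixes n :: nat
  assumes c: "point_identification \<G> c" and f: "\<And>j. j < n \<Longrightarrow> f j \<in> gkm_deg D i"
    and r: "\<And>j. j < n \<Longrightarrow> restricts_to \<G> c i (\<phi> j +o coboundaries (2 * i) Y) (f j)"
    and g: "g \<in> gkm_deg D i" "restricts_to \<G> c i (\<psi> +o coboundaries (2 * i) Y) g"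
  shows "restricts_to \<G> c i ((\<psi> - (\<Sum>j<n. cochain_scale (a j) (\<phi> j))) +o coboundaries (2 * i) Y)
    (g - (\<Sum>j<n. gkm_scale (a j) (f j)))"
proof -
  have "(g - (\<Sum>j<n. gkm_scale (a j) (f j))) \<in> gkm_deg D i \<and> restricts_to \<G> c i ((\<psi> - (\<Sum>j<n. cochain_scale (a j) (\<phi> j))) +o coboundaries (2 * i) Y)
    (g - (\<Sum>j<n. gkm_scale (a j) (f j)))"
    using f r
  proof (induction n)
    case 0
    then show ?case using g by simp
  next
    case (Suc n)
    let ?g = "g - (\<Sum>j<n. gkm_scale (a j) (f j))" and ?\<psi> = "\<psi> - (\<Sum>j<n. cochain_scale (a j) (\<phi> j))"
    have IH: "?g \<in> gkm_deg D i" "restricts_to \<G> c i (?\<psi> +o coboundaries (2 * i) Y) ?g"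
      using Suc.IH Suc.prems less_SucI by blast+
    have n: "f n \<in> gkm_deg D i" "restricts_to \<G> c i (\<phi> n +o coboundaries (2 * i) Y) (f n)"
      using Suc.prems by auto
    have eqs: "?g + gkm_scale (- a n) (f n) = g - (\<Sum>j<Suc n. gkm_scale (a j) (f j))"
      "?\<psi> + cochain_scale (- a n) (\<phi> n) = \<psi> - (\<Sum>j<Suc n. cochain_scale (a j) (\<phi> j))"
      by (simp_all add: algebra_simps del: plus_fun_apply minus_apply)
    then show ?case
      using gkm_deg_add[OF IH(1) gkm_deg_scale[OF n(1), of "- a n"]]
        restricts_to_add[OF c IH(1) gkm_deg_scale[OF n(1)] IH(2) restricts_to_scale[OF c n, of "- a n"]]
      unfolding eqs by blast
  qed
  then show ?thesis ..
qed

text \<open>A basis v of the ring modulo its ideal is lifted to equivariant classes \<phi> and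
  pulled back to ordinary classes \<psi>. Restriction to fixed points is linear and the kernel
  condition matches the ideal with the coboundaries, so \<psi> is a basis in which \<rho> has the
  same matrix A.\<close>

lemma cohomology_character_transfer:
  assumes dot: "dot_action \<G> M y \<rho>" and char: "gkm_character (root_set \<G> M) P"
  shows "cohomology_character (Hess \<G> M y) \<rho> P"
  unfolding cohomology_character_def
proof (intro allI ballI)
  fix i u assume u: "u \<in> W"
  define D where "D = root_set \<G> M"
  define X where "X = Hess \<G> M y"
  define B where "B = coboundaries (2 * i) X"
  obtain g A0 c where c: "point_identification \<G> c"
    and *: "let D = root_set \<G> M;
          X\<^sub>0 = Hess \<G> M (Ad (matrix_inv g) y);
          \<iota> = (\<lambda>x. orbit \<G> (A0, lcoset (matrix_inv g) x))
      in \<forall>i.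
        ((\<forall>\<xi>\<in>cohomology (2 * i) (borel_space \<G> X\<^sub>0). \<exists>!f. f \<in> gkm_deg D i \<and> restricts_to \<G> c i \<xi> f) \<and>
         (\<forall>f\<in>gkm_deg D i. \<exists>!\<xi>. \<xi> \<in> cohomology (2 * i) (borel_space \<G> X\<^sub>0) \<and> restricts_to \<G> c i \<xi> f)) \<and>
        pullback (2 * i) (Hess \<G> M y) \<iota> ` cohomology (2 * i) (borel_space \<G> X\<^sub>0)
          = cohomology (2 * i) (Hess \<G> M y) \<and>
        (\<forall>\<xi>\<in>cohomology (2 * i) (borel_space \<G> X\<^sub>0). \<forall>f\<in>gkm_deg D i. restricts_to \<G> c i \<xi> f \<longrightarrow>
           (pullback (2 * i) (Hess \<G> M y) \<iota> \<xi> = coboundaries (2 * i) (Hess \<G> M y)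
            \<longleftrightarrow> f \<in> gkm_ideal D)) \<and>
        (\<forall>u\<in>W. \<forall>\<xi>\<in>cohomology (2 * i) (borel_space \<G> X\<^sub>0). \<forall>\<eta>\<in>cohomology (2 * i) (borel_space \<G> X\<^sub>0).
           \<forall>f\<in>gkm_deg D i. restricts_to \<G> c i \<xi> f \<and> restricts_to \<G> c i \<eta> (dot u f) \<longrightarrow>
             \<rho> i u (pullback (2 * i) (Hess \<G> M y) \<iota> \<xi>) = pullback (2 * i) (Hess \<G> M y) \<iota> \<eta>)"
    using dot unfolding dot_action_def by blast
  define Y where "Y = borel_space \<G> (Hess \<G> M (Ad (matrix_inv g) y))"
  define \<iota> where "\<iota> = (\<lambda>x. orbit \<G> (A0, lcoset (matrix_inv g) x))"
  define C where "C = coboundaries (2 * i) Y"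
  have B: "cochain.subspace B" and C: "cochain.subspace C"
    by (simp_all add: B_def C_def subspace_coboundaries)
  note conds = spec[OF *[unfolded Let_def, folded \<iota>_def Y_def X_def D_def], of i, folded B_def]
  note ex = conjunct1[OF conds] and surj = conjunct1[OF conjunct2[OF conds]]
    and ker = conjunct1[OF conjunct2[OF conjunct2[OF conds]]]
    and rho = conjunct2[OF conjunct2[OF conjunct2[OF conds]]]
  have to_gkm: "\<exists>f\<in>gkm_deg D i. restricts_to \<G> c i (\<phi> +o C) f" if "\<phi> \<in> cocycles (2 * i) Y" for \<phi>
    using conjunct1[OF ex] cohomologyI[OF that] unfolding C_def by blast
  have from_gkm: "\<exists>\<phi>\<in>cocycles (2 * i) Y. restricts_to \<G> c i (\<phi> +o C) f" if "f \<in> gkm_deg D i" for f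
    using conjunct2[OF ex] that
    unfolding C_def by (blast elim: cohomologyE)
  have zero_cocycle: "0 \<in> cocycles (2 * i) Y"
    by (rule cochain.subspace_0[OF subspace_cocycles])
  have coset_mem: "\<phi> +o C \<in> cohomology (2 * i) Y" if "\<phi> \<in> cocycles (2 * i) Y" for \<phi>
    unfolding C_def using that by (rule cohomologyI)
  have pb_mem: "\<exists>\<psi>. \<psi> \<in> cocycles (2 * i) X \<and> pullback (2 * i) X \<iota> (\<phi> +o C) = \<psi> +o B"
    if "\<phi> \<in> cocycles (2 * i) Y" for \<phi>
  proof -
    have "pullback (2 * i) X \<iota> (\<phi> +o C) \<in> cohomology (2 * i) X"
      unfolding surj[symmetric] using coset_mem[OF that] by (rule imageI)
    then show ?thesis
      unfolding B_def by (rule cohomologyE) blast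
  qed
  obtain \<zeta> where "pullback (2 * i) X \<iota> (0 +o C) = \<zeta> +o B"
    using pb_mem[OF zero_cocycle] by blast
  \<comment> \<open>The zero class serves as the one class whose pullback is known to be a
    class.\<close>
  then have CB: "pull (2 * i) X \<iota> ` C + B = B"
    unfolding C_def B_def by (rule pullback_eq_coset)
  have pb: "pullback (2 * i) X \<iota> (\<phi> +o C) = pull (2 * i) X \<iota> \<phi> +o B" for \<phi>
    unfolding pullback_coset using CB by (simp add: B_def)
  have ker': "pull (2 * i) X \<iota> \<phi> \<in> B \<longleftrightarrow> f \<in> gkm_ideal D"
    if "\<phi> \<in> cocycles (2 * i) Y" "f \<in> gkm_deg D i" "restricts_to \<G> c i (\<phi> +o C) f" for \<phi> f
  proof -
    have "pull (2 * i) X \<iota> \<phi> +o B = 0 +o B \<longleftrightarrow> f \<in> gkm_ideal D"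
      using ker[rule_format, OF coset_mem[OF that(1)] that(2,3)] unfolding pb by simp
    then show ?thesis
      unfolding coset_eq_iff[OF B] by simp
  qed
  define N where "N = gkm_ideal D \<inter> gkm_deg D i"
  have "has_trace gkm_scale (gkm_deg D i) N (\<lambda>K. dot u ` K) (poly.coeff P i u)"
    using char u unfolding gkm_character_def N_def D_def by blast
  then obtain n :: nat and v A where v: "\<forall>i'<n. v i' \<in> gkm_deg D i"
    and uniq: "\<forall>z\<in>gkm_deg D i. \<exists>!a. (\<forall>i\<ge>n. a i = 0) \<and> z - (\<Sum>i<n. gkm_scale (a i) (v i)) \<in> N"
    and act: "\<forall>j<n. dot u ` (v j +o N) = (\<Sum>i<n. gkm_scale (A i j) (v i)) +o N"
    and \<tau>: "poly.coeff P i u = (\<Sum>i<n. A i i)"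
    unfolding has_trace_def by (elim exE conjE) (rule that)
  have "\<exists>\<phi>. \<phi> \<in> cocycles (2 * i) Y \<and> restricts_to \<G> c i (\<phi> +o C) (v j)" if "j < n" for j
    using from_gkm v that by blast
  then obtain \<phi> where \<phi>: "\<And>j. j < n \<Longrightarrow> \<phi> j \<in> cocycles (2 * i) Y"
    "\<And>j. j < n \<Longrightarrow> restricts_to \<G> c i (\<phi> j +o C) (v j)"
    by metis
  have "\<exists>\<psi>. \<psi> \<in> cocycles (2 * i) X \<and> pull (2 * i) X \<iota> (\<phi> j) +o B = \<psi> +o B" if "j < n" for j
    using pb_mem[OF \<phi>(1)[OF that]] unfolding pb .
  then obtain \<psi> where \<psi>: "\<And>j. j < n \<Longrightarrow> \<psi> j \<in> cocycles (2 * i) X"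
    "\<And>j. j < n \<Longrightarrow> pull (2 * i) X \<iota> (\<phi> j) +o B = \<psi> j +o B"
    by metis
  have \<psi>_diff: "pull (2 * i) X \<iota> (\<phi> j) - \<psi> j \<in> B" if "j < n" for j
    using \<psi>(2)[OF that] coset_eq_iff[OF B] by blast
  \<comment> \<open>The dictionary between the two quotients: a combination of the \<psi> represents
    z modulo coboundaries exactly when the same combination of the v represents f modulo the ideal.
    Existence, uniqueness and the matrix entries all pass through it.\<close>
  have comb: "z - (\<Sum>j<n. cochain_scale (a j) (\<psi> j)) \<in> B \<longleftrightarrow> f - (\<Sum>j<n. gkm_scale (a j) (v j)) \<in> N"
    if z: "z - pull (2 * i) X \<iota> \<phi>' \<in> B" and \<phi>': "\<phi>' \<in> cocycles (2 * i) Y"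
      and f: "f \<in> gkm_deg D i" "restricts_to \<G> c i (\<phi>' +o C) f" for z \<phi>' f a
  proof -
    let ?\<phi> = "\<phi>' - (\<Sum>j<n. cochain_scale (a j) (\<phi> j))" and ?f = "f - (\<Sum>j<n. gkm_scale (a j) (v j))"
    have f': "?f \<in> gkm_deg D i"
      using f v by (intro gkm.subspace_diff gkm.subspace_sum gkm.subspace_scale subspace_gkm_deg) auto
    have r: "restricts_to \<G> c i (?\<phi> +o C) ?f"
      unfolding C_def by (rule restricts_to_sum[OF c]) (use v \<phi>(2) f in \<open>auto simp: C_def\<close>)
    have "?\<phi> \<in> cocycles (2 * i) Y"
      using \<phi>' \<phi>(1) by (intro cochain.subspace_diff cochain.subspace_sum cochain.subspace_scale subspace_cocycles) auto
    from ker'[OF this f' r] have "pull (2 * i) X \<iota> ?\<phi> \<in> B \<longleftrightarrow> ?f \<in> N"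
      using f' by (simp add: N_def)
    moreover have "(z - (\<Sum>j<n. cochain_scale (a j) (\<psi> j))) - pull (2 * i) X \<iota> ?\<phi> \<in> B"
    proof -
      have "(z - (\<Sum>j<n. cochain_scale (a j) (\<psi> j))) - pull (2 * i) X \<iota> ?\<phi> =
        (z - pull (2 * i) X \<iota> \<phi>') + (\<Sum>j<n. cochain_scale (a j) (pull (2 * i) X \<iota> (\<phi> j) - \<psi> j))"
        by (simp add: pull_diff pull_sum pull_scale cochain.scale_right_diff_distrib sum_subtractf
            del: plus_fun_apply minus_apply)
      also have "\<dots> \<in> B"
        using z \<psi>_diff by (intro cochain.subspace_add cochain.subspace_sum cochain.subspace_scale B) auto
      finally show ?thesis .
    qed
    ultimately show ?thesis
      using cochain.subspace_add[OF B] cochain.subspace_diff[OF B]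
      by (metis (no_types, lifting) diff_add_cancel diff_diff_eq2 add_diff_cancel_left')
  qed
  show "has_trace cochain_scale (cocycles (2 * i) (Hess \<G> M y)) (coboundaries (2 * i) (Hess \<G> M y)) (\<rho> i u) (poly.coeff P i u)"
    unfolding has_trace_def X_def[symmetric] B_def[symmetric]
  proof (intro exI conjI)
    show "\<forall>j<n. \<psi> j \<in> cocycles (2 * i) X" using \<psi>(1) by blast
    show "\<forall>z\<in>cocycles (2 * i) X. \<exists>!a. (\<forall>i\<ge>n. a i = 0) \<and> z - (\<Sum>i<n. cochain_scale (a i) (\<psi> i)) \<in> B"
    proof
      fix z assume z: "z \<in> cocycles (2 * i) X"
      obtain \<xi> where \<xi>: "\<xi> \<in> cohomology (2 * i) Y" "z +o B = pullback (2 * i) X \<iota> \<xi>"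
        using cohomologyI[OF z] unfolding surj[symmetric] B_def by (rule imageE) blast
      obtain \<phi>' where \<phi>': "\<phi>' \<in> cocycles (2 * i) Y" "\<xi> = \<phi>' +o C"
        using \<xi>(1) unfolding C_def by (rule cohomologyE)
      have z': "z - pull (2 * i) X \<iota> \<phi>' \<in> B"
        using \<xi>(2) \<phi>'(2) pb coset_eq_iff[OF B] by blast
      obtain f where f: "f \<in> gkm_deg D i" "restricts_to \<G> c i (\<phi>' +o C) f"
        using to_gkm[OF \<phi>'(1)] by blast
      show "\<exists>!a. (\<forall>i\<ge>n. a i = 0) \<and> z - (\<Sum>i<n. cochain_scale (a i) (\<psi> i)) \<in> B"
        unfolding comb[OF z' \<phi>'(1) f] using uniq f(1) by blast
    qed
    show "\<forall>j<n. \<rho> i u (\<psi> j +o B) = (\<Sum>i<n. cochain_scale (A i j) (\<psi> i)) +o B"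
    proof (intro allI impI)
      fix j assume j: "j < n"
      have vj: "v j \<in> gkm_deg D i" using v j by blast
      have d: "dot u (v j) \<in> gkm_deg D i" using dot_gkm_deg[OF u vj] .
      obtain \<phi>' where \<phi>': "\<phi>' \<in> cocycles (2 * i) Y" "restricts_to \<G> c i (\<phi>' +o C) (dot u (v j))"
        using from_gkm[OF d] by blast
      have "\<rho> i u (pullback (2 * i) X \<iota> (\<phi> j +o C)) = pullback (2 * i) X \<iota> (\<phi>' +o C)"
        by (rule rho[rule_format, OF u coset_mem[OF \<phi>(1)[OF j]] coset_mem[OF \<phi>'(1)] vj conjI[OF \<phi>(2)[OF j] \<phi>'(2)]])
      then have 1: "\<rho> i u (\<psi> j +o B) = pull (2 * i) X \<iota> \<phi>' +o B"
        unfolding pb \<psi>(2)[OF j] .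
      \<comment> \<open>The trace condition concerns images of cosets. Since N contains 0, it tells
        in particular where v j itself is sent.\<close>
      have "0 \<in> N"
        unfolding N_def gkm_ideal_def by (blast intro: gkm.span_zero gkm_deg_zero)
      then have "v j \<in> v j +o N" by (simp add: coset_mem_iff del: zero_fun_apply)
      then have "dot u (v j) \<in> (\<Sum>i<n. gkm_scale (A i j) (v i)) +o N"
        using act j by blast
      then have "dot u (v j) - (\<Sum>k<n. gkm_scale (A k j) (v k)) \<in> N"
        by (simp add: coset_mem_iff)
      moreover have "pull (2 * i) X \<iota> \<phi>' - pull (2 * i) X \<iota> \<phi>' \<in> B"
        using cochain.subspace_0[OF B] by (simp del: zero_fun_apply)
      ultimately have "pull (2 * i) X \<iota> \<phi>' - (\<Sum>k<n. cochain_scale (A k j) (\<psi> k)) \<in> B"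
        using comb[OF _ \<phi>'(1) d \<phi>'(2), of _ "\<lambda>k. A k j"] by blast
      then show "\<rho> i u (\<psi> j +o B) = (\<Sum>i<n. cochain_scale (A i j) (\<psi> i)) +o B"
        unfolding 1 coset_eq_iff[OF B] .
    qed
    show "poly.coeff P i u = (\<Sum>i<n. A i i)" by (rule \<tau>)
  qed
qed

section \<open>Functions on an orbit of weights\<close>

text \<open>Agreement off the origin gives divisibility by the root, hence agreement at the origin.
  The rings on the hexagons impose their congruences only off the origin.\<close>

lemma gkmI_nonzero:
  assumes "\<And>w. w \<notin> W \<Longrightarrow> f w = 0" and Sym: "\<And>w. w \<in> W \<Longrightarrow> f w \<in> Sym"
    and edge: "\<And>w \<delta> h. w \<in> W \<Longrightarrow> \<delta> \<in> pos_roots \<Longrightarrow> - \<delta> \<in> D \<Longrightarrow> h \<noteq> 0 \<Longrightarrow> wt_eval (w \<delta>) h = 0 \<Longrightarrow>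
      f w h = f (w \<circ> refl \<delta>) h"
  shows "f \<in> gkm D"
proof (rule gkmI)
  fix w \<delta> h assume w: "w \<in> W" and \<delta>: "\<delta> \<in> pos_roots" "- \<delta> \<in> D" and h: "wt_eval (w \<delta>) h = 0"
  have "\<exists>q\<in>Sym. f w - f (w \<circ> refl \<delta>) = wt_eval (w \<delta>) * q"
  proof (rule wt_eval_dvd)
    show "f w - f (w \<circ> refl \<delta>) \<in> Sym"
      using Sym w W_comp[OF w refl_in_W[OF pos_roots_subset[OF \<delta>(1)]]] by (intro Sym_diff)
    show "w \<delta> \<noteq> 0"
      using W_eq_zero_iff[OF w] pos_roots_subset[OF \<delta>(1)] zero_notin_roots by metis
  qed (use edge[OF w \<delta>] in simp)
  then obtain q where "f w - f (w \<circ> refl \<delta>) = wt_eval (w \<delta>) * q" by blast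
  from fun_cong[OF this, of h] show "f w h = f (w \<circ> refl \<delta>) h" using h by simp
qed (use assms in auto)

lemma power_fun_apply: "(f ^ n) x = f x ^ n" for f :: "'a \<Rightarrow> 'b::monoid_mult"
  by (induction n) auto

lemma form_W: "w \<in> W \<Longrightarrow> form (w x) (w y) = form x y"
  by (cases x, cases y, auto simp: W_eq W_mats_def form_def algebra_simps)

text \<open>Elements of \<open>W\<close> have determinant \<plusminus>1, so they keep
  non-proportional weights non-proportional.\<close>

lemma W_det:
  assumes "w \<in> W"
  shows "\<bar>fst (w x) * snd (w y) - snd (w x) * fst (w y)\<bar> = \<bar>fst x * snd y - snd x * fst y\<bar>"
proof -
  have "fst (w x) * snd (w y) - snd (w x) * fst (w y) = fst x * snd y - snd x * fst y \<or>
    fst (w x) * snd (w y) - snd (w x) * fst (w y) = - (fst x * snd y - snd x * fst y)"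
    using assms by (cases x, cases y, auto simp: W_eq W_mats_def algebra_simps)
  then show ?thesis by linarith
qed

lemma wt_eval_both_zero:
  assumes "fst x * snd y - snd x * fst y \<noteq> 0" "wt_eval x h = 0" "wt_eval y h = 0"
  shows "h = 0"
proof -
  obtain p q where h: "h = (p, q)" by force
  obtain a b c d where xy: "x = (a, b)" "y = (c, d)" by (cases x, cases y)
  have 1: "of_int a * p + of_int b * q = 0" "of_int c * p + of_int d * q = 0"
    using assms(2,3) by (simp_all add: h xy wt_eval_def)
  have det: "(of_int (a * d - b * c) :: complex) \<noteq> 0"
    using assms(1) by (simp only: of_int_eq_0_iff) (simp add: xy)
  have "of_int (a * d - b * c) * p = of_int d * (of_int a * p + of_int b * q) - of_int b * (of_int c * p + of_int d * q)"
    "of_int (a * d - b * c) * q = of_int a * (of_int c * p + of_int d * q) - of_int c * (of_int a * p + of_int b * q)"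
    by (simp_all add: algebra_simps)
  then have "of_int (a * d - b * c) * p = 0" "of_int (a * d - b * c) * q = 0"
    unfolding 1 by simp_all
  then show ?thesis using det by (simp add: h zero_prod_def)
qed

lemma refl_conj: "\<gamma> \<in> pos_roots \<Longrightarrow> \<delta> \<in> pos_roots \<Longrightarrow> refl (refl \<gamma> \<delta>) = refl \<gamma> \<circ> refl \<delta> \<circ> refl \<gamma>"
  by (auto simp: pos_roots_def refl_simps simp del: o_apply)

text \<open>k is the Cartan integer. The weights w \<mu> and w (s_\<delta> \<mu>) differ by a
  multiple of the edge label w \<delta>, with a factor independent of w, so they agree where the
  label vanishes.\<close>

lemma refl_eq_diff: "\<exists>k. \<forall>w\<in>W. \<forall>h. wt_eval (w \<mu>) h - wt_eval (w (refl \<delta> \<mu>)) h = of_int k * wt_eval (w \<delta>) h"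
proof -
  define k where "k = (2 * form \<mu> \<delta>) div form \<delta> \<delta>"
  have "wt_eval (w \<mu>) h - wt_eval (w (refl \<delta> \<mu>)) h = of_int k * wt_eval (w \<delta>) h" if "w \<in> W" for w h
  proof -
    have "refl \<delta> \<mu> = (fst \<mu> - k * fst \<delta>, snd \<mu> - k * snd \<delta>)"
      by (simp add: refl_def k_def Let_def)
    then show ?thesis
      using that by (auto elim!: W_linE simp: wt_eval_def case_prod_unfold lin_def algebra_simps)
  qed
  then show ?thesis by blast
qed

text \<open>The label of an edge between distinct vertices v and v' is proportional to v - v', so
  the congruence means equality where v and v' take the same value. The invariant form, constant on
  \<open>W\<close>-orbits of pairs, selects the types of edges.\<close>

definition edge_cond :: "weight set \<Rightarrow> int set \<Rightarrow> (weight \<Rightarrow> symt) \<Rightarrow> bool" where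
  "edge_cond V S \<phi> \<longleftrightarrow> (\<forall>v\<in>V. \<forall>v'\<in>V. form v v' \<in> S \<longrightarrow>
     (\<forall>h. h \<noteq> 0 \<longrightarrow> wt_eval v h = wt_eval v' h \<longrightarrow> \<phi> v h = \<phi> v' h))"

definition orbit_ring :: "weight set \<Rightarrow> int set \<Rightarrow> (weight \<Rightarrow> symt) set" where
  "orbit_ring V S = {\<phi>. (\<forall>v\<in>V. \<phi> v \<in> Sym) \<and> edge_cond V S \<phi>}"

lemma orbit_ring_edge:
  "\<phi> \<in> orbit_ring V S \<Longrightarrow> v \<in> V \<Longrightarrow> v' \<in> V \<Longrightarrow> form v v' \<in> S \<Longrightarrow> h \<noteq> 0 \<Longrightarrow>
    wt_eval v h = wt_eval v' h \<Longrightarrow> \<phi> v h = \<phi> v' h"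
  unfolding orbit_ring_def edge_cond_def by blast

lemma orbit_ring_Sym: "\<phi> \<in> orbit_ring V S \<Longrightarrow> v \<in> V \<Longrightarrow> \<phi> v \<in> Sym"
  unfolding orbit_ring_def by blast

definition in_span :: "weight set \<Rightarrow> 'i set \<Rightarrow> ('i \<Rightarrow> weight \<Rightarrow> symt) \<Rightarrow> (weight \<Rightarrow> symt) \<Rightarrow> bool" where
  "in_span V J b \<phi> \<longleftrightarrow> (\<exists>r. (\<forall>j\<in>J. r j \<in> Sym) \<and> (\<forall>v\<in>V. \<phi> v = (\<Sum>j\<in>J. r j * b j v)))"

lemma in_span_base:
  assumes "finite J" "j \<in> J" "p \<in> Sym"
  shows "in_span V J b (\<lambda>v. p * b j v)"
  unfolding in_span_def
proof (intro exI conjI ballI)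
  fix v
  have "(\<Sum>i\<in>J. (if i = j then p else 0) * b i v) = (\<Sum>i\<in>J. if i = j then p * b i v else 0)"
    by (intro sum.cong) auto
  then show "p * b j v = (\<Sum>i\<in>J. (if i = j then p else 0) * b i v)"
    using assms by (simp add: sum.delta del: zero_fun_apply times_fun_apply)
qed (use assms in \<open>auto simp: Sym_zero simp del: zero_fun_apply\<close>)

lemma in_span_add:
  assumes "in_span V J b \<phi>" "in_span V J b \<psi>"
  shows "in_span V J b (\<lambda>v. \<phi> v + \<psi> v)"
proof -
  obtain r r' where "\<forall>j\<in>J. r j \<in> Sym" "\<forall>v\<in>V. \<phi> v = (\<Sum>j\<in>J. r j * b j v)"
    "\<forall>j\<in>J. r' j \<in> Sym" "\<forall>v\<in>V. \<psi> v = (\<Sum>j\<in>J. r' j * b j v)"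
    using assms unfolding in_span_def by blast
  then show ?thesis
    unfolding in_span_def
    by (intro exI[of _ "\<lambda>j. r j + r' j"]) (simp add: Sym_add distrib_right sum.distrib del: plus_fun_apply)
qed

lemma in_span_mult:
  assumes "in_span V J b \<phi>" "p \<in> Sym"
  shows "in_span V J b (\<lambda>v. p * \<phi> v)"
proof -
  obtain r where "\<forall>j\<in>J. r j \<in> Sym" "\<forall>v\<in>V. \<phi> v = (\<Sum>j\<in>J. r j * b j v)"
    using assms unfolding in_span_def by blast
  then show ?thesis
    unfolding in_span_def using assms(2)
    by (intro exI[of _ "\<lambda>j. p * r j"]) (simp add: Sym_mult sum_distrib_left mult.assoc del: times_fun_apply)
qed

lemma in_span_zero: "in_span V J b (\<lambda>v. 0)"
  unfolding in_span_def by (intro exI[of _ "\<lambda>j. 0"]) (simp add: Sym_zero del: zero_fun_apply)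

lemma in_span_orbit_ring:
  assumes "in_span V J b \<phi>" and b: "\<And>j. j \<in> J \<Longrightarrow> b j \<in> orbit_ring V S"
  shows "\<phi> \<in> orbit_ring V S"
proof -
  obtain r where r: "\<forall>j\<in>J. r j \<in> Sym" "\<forall>v\<in>V. \<phi> v = (\<Sum>j\<in>J. r j * b j v)"
    using assms unfolding in_span_def by blast
  have "\<phi> v \<in> Sym" if "v \<in> V" for v
    using r b that by (auto simp: orbit_ring_def intro!: Sym_sum Sym_mult)
  moreover have "edge_cond V S \<phi>"
    unfolding edge_cond_def
  proof (intro ballI allI impI)
    fix v v' h assume *: "v \<in> V" "v' \<in> V" "form v v' \<in> S" "h \<noteq> 0" "wt_eval v h = wt_eval v' h"
    have "b j v h = b j v' h" if "j \<in> J" for j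
      using orbit_ring_edge[OF b[OF that] *] .
    then show "\<phi> v h = \<phi> v' h"
      using r(2) *(1,2) by (simp add: sum_fun_apply)
  qed
  ultimately show ?thesis by (simp add: orbit_ring_def)
qed

text \<open>Linear factors are split off one at a time. At a nonzero zero of another factor the one
  already removed does not vanish, as non-proportional forms have only the origin in common, so the
  quotient inherits the hypothesis.\<close>

lemma wt_eval_prod_dvd:
  assumes "finite E" and "p \<in> Sym"
    and zero: "\<And>j h. j \<in> E \<Longrightarrow> h \<noteq> 0 \<Longrightarrow> wt_eval (l j) h = 0 \<Longrightarrow> p h = 0"
    and nz: "\<And>j. j \<in> E \<Longrightarrow> l j \<noteq> 0"
    and det: "\<And>i j. i \<in> E \<Longrightarrow> j \<in> E \<Longrightarrow> i \<noteq> j \<Longrightarrow> fst (l i) * snd (l j) - snd (l i) * fst (l j) \<noteq> 0"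
  shows "\<exists>q\<in>Sym. p = (\<Prod>j\<in>E. wt_eval (l j)) * q"
  using assms
proof (induction E arbitrary: p rule: finite_induct)
  case empty
  then show ?case by auto
next
  case (insert e E)
  obtain q where q: "q \<in> Sym" "p = wt_eval (l e) * q"
    using wt_eval_dvd[OF insert.prems(1), of "l e"] insert.prems by blast
  have "\<exists>r\<in>Sym. q = (\<Prod>j\<in>E. wt_eval (l j)) * r"
  proof (rule insert.IH[OF q(1)])
    fix j h assume j: "j \<in> E" and h: "h \<noteq> 0" "wt_eval (l j) h = 0"
    have "wt_eval (l e) h \<noteq> 0"
      using wt_eval_both_zero[of "l e" "l j" h] insert.prems(4)[of e j] insert.hyps j h by auto
    moreover have "p h = 0" using insert.prems(2)[of j h] j h by simp
    ultimately show "q h = 0" using q(2) by simp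
  qed (use insert.prems in auto)
  then obtain r where "r \<in> Sym" "q = (\<Prod>j\<in>E. wt_eval (l j)) * r" by blast
  then show ?case
    using q insert.hyps by (intro bexI[of _ r]) (simp_all add: mult.assoc del: times_fun_apply)
qed

text \<open>The members \<open>e\<close> of the span are flow-up classes for the order of the vertices in \<open>vs\<close>: up to a constant,
  the first nonzero value of \<open>e\<close> is the product over the earlier neighbours by which the first
  nonzero value of every element of the ring is divisible.\<close>

lemma triangular_span:
  fixes vs :: "nat \<Rightarrow> weight"
  assumes V: "V = vs ` {..<n}" and J: "\<And>j. j \<in> J \<Longrightarrow> b j \<in> orbit_ring V S"
    and E: "\<And>k j. k < n \<Longrightarrow> j \<in> E k \<Longrightarrow> j < k \<and> vs k \<noteq> vs j \<and> form (vs k) (vs j) \<in> S"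
    and det: "\<And>k i j. k < n \<Longrightarrow> i \<in> E k \<Longrightarrow> j \<in> E k \<Longrightarrow> i \<noteq> j \<Longrightarrow>
      fst (vs k - vs i) * snd (vs k - vs j) - snd (vs k - vs i) * fst (vs k - vs j) \<noteq> 0"
    and flow: "\<And>k. k < n \<Longrightarrow> \<exists>e c. in_span V J b e \<and> c \<noteq> 0 \<and> (\<forall>j<k. \<forall>h. e (vs j) h = 0) \<and>
      (\<forall>h. e (vs k) h = c * (\<Prod>j\<in>E k. wt_eval (vs k - vs j) h))"
    and \<phi>: "\<phi> \<in> orbit_ring V S"
  shows "in_span V J b \<phi>"
proof -
  have "\<exists>\<chi>'. in_span V J b \<chi>' \<and> (\<forall>j<m. \<chi>' (vs j) = \<phi> (vs j))" if "m \<le> n" for m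
    using that
  proof (induction m)
    case 0
    then show ?case using in_span_zero by blast
  next
    case (Suc m)
    then obtain \<chi>' where \<chi>': "in_span V J b \<chi>'" "\<forall>j<m. \<chi>' (vs j) = \<phi> (vs j)" by auto
    have m: "m < n" using Suc.prems by simp
    then obtain e c where e: "in_span V J b e" "c \<noteq> 0" "\<And>j h. j < m \<Longrightarrow> e (vs j) h = 0"
      "\<And>h. e (vs m) h = c * (\<Prod>j\<in>E m. wt_eval (vs m - vs j) h)"
      using flow by blast
    have in_V: "vs j \<in> V" if "j \<le> m" for j using V m that by auto
    have \<chi>'_ring: "\<chi>' \<in> orbit_ring V S" using in_span_orbit_ring[OF \<chi>'(1)] J by blast
    define p where "p = \<phi> (vs m) - \<chi>' (vs m)"
    have "\<exists>q\<in>Sym. p = (\<Prod>j\<in>E m. wt_eval (vs m - vs j)) * q"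
    proof (rule wt_eval_prod_dvd)
      show "finite (E m)" using E[OF m] by (meson finite_nat_iff_bounded lessThan_iff subsetI)
      show "p \<in> Sym" unfolding p_def using \<phi> \<chi>'_ring in_V by (auto simp: orbit_ring_def intro: Sym_diff)
      show "vs m - vs j \<noteq> 0" if "j \<in> E m" for j using E[OF m that] by simp
      fix j h assume j: "j \<in> E m" and h: "h \<noteq> 0" "wt_eval (vs m - vs j) h = 0"
      have jm: "j < m" "form (vs m) (vs j) \<in> S" using E[OF m j] by auto
      have "wt_eval (vs m) h = wt_eval (vs j) h" using h(2) by (simp add: wt_eval_diff)
      then have "\<phi> (vs m) h = \<phi> (vs j) h" "\<chi>' (vs m) h = \<chi>' (vs j) h"
        using orbit_ring_edge[OF _ in_V in_V jm(2) h(1)] \<phi> \<chi>'_ring jm(1) by simp_all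
      then show "p h = 0" using \<chi>'(2) jm(1) by (simp add: p_def)
    qed (use det[OF m] in auto)
    then obtain q where q: "q \<in> Sym" "p = (\<Prod>j\<in>E m. wt_eval (vs m - vs j)) * q" by blast
    \<comment> \<open>Since e vanishes at the earlier vertices, agreement there is kept; q repairs
      the value at vertex m, and 1 / c undoes the normalisation of e.\<close>
    define \<psi> where "\<psi> v = \<chi>' v + (\<lambda>h. (1 / c) * q h) * e v" for v
    have prod: "(\<Prod>j\<in>A. g j) h = (\<Prod>j\<in>A. g j h)" for g :: "nat \<Rightarrow> symt" and A h
      by (induction A rule: infinite_finite_induct) auto
    have "in_span V J b \<psi>"
      unfolding \<psi>_def by (intro in_span_add in_span_mult \<chi>'(1) e(1) Sym_scale q(1))
    moreover have "\<psi> (vs j) = \<phi> (vs j)" if "j < Suc m" for j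
    proof (cases "j = m")
      case True
      have "\<psi> (vs m) h = \<phi> (vs m) h" for h
        using fun_cong[OF q(2), of h] e(2) by (simp add: \<psi>_def e(4) p_def prod field_simps)
      then show ?thesis using True by blast
    next
      case False
      then show ?thesis using that e(3) \<chi>'(2) by (auto simp: \<psi>_def fun_eq_iff)
    qed
    ultimately show ?case by blast
  qed
  from this[of n] obtain \<chi>' where \<chi>': "in_span V J b \<chi>'" "\<forall>v\<in>V. \<chi>' v = \<phi> v"
    using V by auto
  then show ?thesis unfolding in_span_def by simp
qed

text \<open>Generators of the ring over Sym which \<open>W\<close> permutes by \<pi> up to the
  scalars \<sigma>. Independence is asked of their values at (1, 1), the point of t where both
  simple roots are 1 and hence no root vanishes.\<close>

locale equivariant_basis =
  fixes V :: "weight set" and S :: "int set" and J :: "'i set" and b :: "'i \<Rightarrow> weight \<Rightarrow> symt"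
    and d :: "'i \<Rightarrow> nat" and \<pi> :: "weyl \<Rightarrow> 'i \<Rightarrow> 'i" and \<sigma> :: "weyl \<Rightarrow> 'i \<Rightarrow> complex"
  assumes fin: "finite J"
    and deg: "\<And>j v. j \<in> J \<Longrightarrow> v \<in> V \<Longrightarrow> b j v \<in> Sym_deg (d j)"
    and ring: "\<And>j. j \<in> J \<Longrightarrow> b j \<in> orbit_ring V S"
    and span: "\<And>\<phi>. \<phi> \<in> orbit_ring V S \<Longrightarrow> in_span V J b \<phi>"
    and indep: "\<And>a j. (\<And>v. v \<in> V \<Longrightarrow> (\<Sum>j\<in>J. a j * b j v (1, 1)) = 0) \<Longrightarrow> j \<in> J \<Longrightarrow> a j = 0"
    and perm: "\<And>u j. u \<in> W \<Longrightarrow> j \<in> J \<Longrightarrow> \<pi> u j \<in> J"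
    and perm_deg: "\<And>u j. u \<in> W \<Longrightarrow> j \<in> J \<Longrightarrow> d (\<pi> u j) = d j"
    and act: "\<And>u j v h. u \<in> W \<Longrightarrow> j \<in> J \<Longrightarrow> v \<in> V \<Longrightarrow>
      act_Sym u (b j v) h = \<sigma> u j * b (\<pi> u j) (u v) h"
begin

definition trace :: "weyl \<Rightarrow> nat \<Rightarrow> complex" where
  "trace u i = (\<Sum>j | j \<in> J \<and> d j = i \<and> \<pi> u j = j. \<sigma> u j)"

end

definition pull_back_W :: "weight \<Rightarrow> (weight \<Rightarrow> symt) \<Rightarrow> weyl \<Rightarrow> symt" where
  "pull_back_W \<omega> \<phi> = (\<lambda>w. if w \<in> W then \<phi> (w \<omega>) else 0)"

text \<open>The second summand is multiplied by a function G of degree e on which \<open>W\<close>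
  acts through \<chi>'. The elements w and w s_\<gamma> lie over the same vertex, where pulled-back
  functions agree but the two values of G differ; this keeps the summands independent.\<close>

lemma has_trace_direct_sum:
  assumes B1: "equivariant_basis V S1 J1 b1 d1 \<pi>1 \<sigma>1" and B2: "equivariant_basis V S2 J2 b2 d2 \<pi>2 \<sigma>2"
    and V: "V = (\<lambda>w. w \<omega>) ` W" and \<gamma>: "\<gamma> \<in> roots" "refl \<gamma> \<omega> = \<omega>"
    and G_deg: "\<And>w. w \<in> W \<Longrightarrow> G w \<in> Sym_deg e"
    and G_act: "\<And>u w h. u \<in> W \<Longrightarrow> w \<in> W \<Longrightarrow> act_Sym u (G w) h = \<chi>' u * G (u \<circ> w) h"
    and G_sep: "\<And>w. w \<in> W \<Longrightarrow> G w (1, 1) \<noteq> G (w \<circ> refl \<gamma>) (1, 1)"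
    and sub1: "\<And>\<phi>. \<phi> \<in> orbit_ring V S1 \<Longrightarrow> pull_back_W \<omega> \<phi> \<in> gkm D"
    and sub2: "\<And>\<phi>. \<phi> \<in> orbit_ring V S2 \<Longrightarrow> (\<lambda>w. G w * pull_back_W \<omega> \<phi> w) \<in> gkm D"
    and dec: "\<And>f. f \<in> gkm D \<Longrightarrow> \<exists>\<phi>\<in>orbit_ring V S1. \<exists>\<psi>\<in>orbit_ring V S2.
      \<forall>w\<in>W. f w = \<phi> (w \<omega>) + G w * \<psi> (w \<omega>)"
    and u: "u \<in> W"
  shows "dot_trace D i u
    (equivariant_basis.trace J1 d1 \<pi>1 \<sigma>1 u i +
     (if e \<le> i then \<chi>' u * equivariant_basis.trace J2 d2 \<pi>2 \<sigma>2 u (i - e) else 0))"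
proof -
  interpret B1: equivariant_basis V S1 J1 b1 d1 \<pi>1 \<sigma>1 by (rule B1)
  interpret B2: equivariant_basis V S2 J2 b2 d2 \<pi>2 \<sigma>2 by (rule B2)
  define J where "J = J1 <+> J2"
  define b where "b = case_sum (\<lambda>j. pull_back_W \<omega> (b1 j)) (\<lambda>j w. G w * pull_back_W \<omega> (b2 j) w)"
  define d where "d = case_sum d1 (\<lambda>j. e + d2 j)"
  define \<pi> where "\<pi> u = map_sum (\<pi>1 u) (\<pi>2 u)" for u
  define \<sigma> where "\<sigma> u = case_sum (\<sigma>1 u) (\<lambda>j. \<chi>' u * \<sigma>2 u j)" for u
  have fin: "finite J1" "finite J2" by (rule B1.fin B2.fin)+
  have sum_J: "(\<Sum>j\<in>J. g j) = (\<Sum>j\<in>J1. g (Inl j)) + (\<Sum>j\<in>J2. g (Inr j))" for g :: "_ \<Rightarrow> 'c::comm_monoid_add"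
    unfolding J_def using fin by (simp add: sum.Plus)
  have wV: "w \<omega> \<in> V" if "w \<in> W" for w using V that by auto
  have sg: "refl \<gamma> \<in> W" by (rule refl_in_W[OF \<gamma>(1)])
  have "dot_trace D i u
    (\<Sum>j | j \<in> J \<and> d j = i \<and> \<pi> u j = j. \<sigma> u j)"
  proof (rule has_trace_monomial[where b = b and ?h0.0 = "(1, 1)"])
    show "finite J" using fin by (simp add: J_def)
    show "(1, 1) \<noteq> (0 :: complex \<times> complex)" by (simp add: zero_prod_def)
    show "u \<in> W" by (rule u)
    fix j assume "j \<in> J"
    then show "b j \<in> gkm_deg D (d j)"
    proof (cases j)
      case (Inl k)
      then have k: "k \<in> J1" using \<open>j \<in> J\<close> by (auto simp: J_def)
      show ?thesis
        using sub1[OF B1.ring[OF k]] B1.deg[OF k wV] Inl by (auto simp: gkm_deg_iff b_def d_def pull_back_W_def)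
    next
      case (Inr k)
      then have k: "k \<in> J2" using \<open>j \<in> J\<close> by (auto simp: J_def)
      have "G w * pull_back_W \<omega> (b2 k) w \<in> Sym_deg (e + d2 k)" if "w \<in> W" for w
        using Sym_deg_mult[OF G_deg[OF that] B2.deg[OF k wV[OF that]]] that by (simp add: pull_back_W_def)
      then show ?thesis
        using sub2[OF B2.ring[OF k]] Inr by (auto simp: gkm_deg_iff b_def d_def)
    qed
  next
    fix f assume "f \<in> gkm D"
    then obtain \<phi> \<psi> where \<phi>: "\<phi> \<in> orbit_ring V S1" "\<psi> \<in> orbit_ring V S2"
      "\<forall>w\<in>W. f w = \<phi> (w \<omega>) + G w * \<psi> (w \<omega>)"
      using dec by blast
    obtain r1 where r1: "\<forall>j\<in>J1. r1 j \<in> Sym" "\<forall>v\<in>V. \<phi> v = (\<Sum>j\<in>J1. r1 j * b1 j v)"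
      using B1.span[OF \<phi>(1)] unfolding in_span_def by blast
    obtain r2 where r2: "\<forall>j\<in>J2. r2 j \<in> Sym" "\<forall>v\<in>V. \<psi> v = (\<Sum>j\<in>J2. r2 j * b2 j v)"
      using B2.span[OF \<phi>(2)] unfolding in_span_def by blast
    show "\<exists>r. (\<forall>j\<in>J. r j \<in> Sym) \<and> (\<forall>w\<in>W. f w = (\<Sum>j\<in>J. r j * b j w))"
    proof (intro exI[of _ "case_sum r1 r2"] conjI ballI)
      show "case_sum r1 r2 j \<in> Sym" if "j \<in> J" for j
        using that r1 r2 by (auto simp: J_def)
      fix w assume w: "w \<in> W"
      have "f w = (\<Sum>j\<in>J1. r1 j * b1 j (w \<omega>)) + G w * (\<Sum>j\<in>J2. r2 j * b2 j (w \<omega>))"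
        using \<phi>(3) r1(2) r2(2) w wV by simp
      also have "\<dots> = (\<Sum>j\<in>J. case_sum r1 r2 j * b j w)"
        unfolding sum_J using w
        by (simp add: b_def pull_back_W_def sum_distrib_left mult.left_commute del: times_fun_apply plus_fun_apply)
      finally show "f w = (\<Sum>j\<in>J. case_sum r1 r2 j * b j w)" .
    qed
  next
    fix a j assume eq: "\<And>w. w \<in> W \<Longrightarrow> (\<Sum>j\<in>J. a j * b j w (1, 1)) = 0" and j: "j \<in> J"
    define A where "A v = (\<Sum>j\<in>J1. a (Inl j) * b1 j v (1, 1))" for v
    define C where "C v = (\<Sum>j\<in>J2. a (Inr j) * b2 j v (1, 1))" for v
    have AC: "A (w \<omega>) + G w (1, 1) * C (w \<omega>) = 0" if "w \<in> W" for w
      using eq[OF that] that unfolding sum_J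
      by (simp add: A_def C_def b_def pull_back_W_def sum_distrib_left mult.left_commute)
    have "A v = 0 \<and> C v = 0" if "v \<in> V" for v
    proof -
      obtain w where w: "w \<in> W" "v = w \<omega>" using \<open>v \<in> V\<close> V by auto
      have "A v + G w (1, 1) * C v = 0" "A v + G (w \<circ> refl \<gamma>) (1, 1) * C v = 0"
        using AC[OF w(1)] AC[OF W_comp[OF w(1) sg]] w(2) \<gamma>(2) by simp_all
      moreover have "(G w (1, 1) - G (w \<circ> refl \<gamma>) (1, 1)) * C v =
          (A v + G w (1, 1) * C v) - (A v + G (w \<circ> refl \<gamma>) (1, 1) * C v)"
        by (simp add: algebra_simps)
      ultimately have "(G w (1, 1) - G (w \<circ> refl \<gamma>) (1, 1)) * C v = 0"
        by simp
      then show ?thesis using G_sep[OF w(1)] \<open>A v + G w (1, 1) * C v = 0\<close> by simp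
    qed
    then have "\<And>j. j \<in> J1 \<Longrightarrow> a (Inl j) = 0" "\<And>j. j \<in> J2 \<Longrightarrow> a (Inr j) = 0"
      using B1.indep[of "\<lambda>j. a (Inl j)"] B2.indep[of "\<lambda>j. a (Inr j)"] by (auto simp: A_def C_def)
    then show "a j = 0" using j by (auto simp: J_def)
  next
    fix u j assume "u \<in> W" "j \<in> J"
    then show "\<pi> u j \<in> J \<and> d (\<pi> u j) = d j"
      by (auto simp: J_def \<pi>_def d_def B1.perm B1.perm_deg B2.perm B2.perm_deg)
  next
    fix u j w assume u: "u \<in> W" and j: "j \<in> J" and w: "w \<in> W"
    have w': "winv u \<circ> w \<in> W" "u \<circ> (winv u \<circ> w) = w"
      using u w by (simp_all add: W_comp W_inv flip: comp_assoc)
    have w\<omega>: "u ((winv u \<circ> w) \<omega>) = w \<omega>"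
      using w'(2) by (metis comp_apply)
    have *: "act_Sym u (b j (winv u \<circ> w)) h = \<sigma> u j * b (\<pi> u j) w h" for h
    proof (cases j)
      case (Inl k)
      then have k: "k \<in> J1" using j by (auto simp: J_def)
      show ?thesis
        using B1.act[OF u k wV[OF w'(1)], of h] w' w Inl w\<omega>
        by (simp add: b_def \<sigma>_def \<pi>_def pull_back_W_def)
    next
      case (Inr k)
      then have k: "k \<in> J2" using j by (auto simp: J_def)
      show ?thesis
        using B2.act[OF u k wV[OF w'(1)], of h] G_act[OF u w'(1), of h] w' w Inr w\<omega>
        by (simp add: b_def \<sigma>_def \<pi>_def pull_back_W_def act_Sym_mult)
    qed
    show "dot u (b j) w = (\<lambda>h. \<sigma> u j * b (\<pi> u j) w h)"
      using * by (auto simp: dot_apply[OF w])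
  qed
  also have "(\<Sum>j | j \<in> J \<and> d j = i \<and> \<pi> u j = j. \<sigma> u j) = B1.trace u i +
     (if e \<le> i then \<chi>' u * B2.trace u (i - e) else 0)"
  proof -
    have "{j. j \<in> J \<and> d j = i \<and> \<pi> u j = j} =
      {j. j \<in> J1 \<and> d1 j = i \<and> \<pi>1 u j = j} <+> {j. j \<in> J2 \<and> e + d2 j = i \<and> \<pi>2 u j = j}"
      by (auto simp: J_def d_def \<pi>_def)
    then have "(\<Sum>j | j \<in> J \<and> d j = i \<and> \<pi> u j = j. \<sigma> u j) =
      B1.trace u i + (\<Sum>j | j \<in> J2 \<and> e + d2 j = i \<and> \<pi>2 u j = j. \<chi>' u * \<sigma>2 u j)"
      using fin by (simp add: sum.Plus \<sigma>_def B1.trace_def)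
    also have "(\<Sum>j | j \<in> J2 \<and> e + d2 j = i \<and> \<pi>2 u j = j. \<chi>' u * \<sigma>2 u j) =
      (if e \<le> i then \<chi>' u * B2.trace u (i - e) else 0)"
    proof (cases "e \<le> i")
      case True
      then have "e + k = i \<longleftrightarrow> k = i - e" for k by auto
      then show ?thesis using True by (simp add: B2.trace_def sum_distrib_left)
    qed auto
    finally show ?thesis .
  qed
  finally show ?thesis .
qed

section \<open>Splitting along a simple reflection\<close>

definition short_roots :: "weight set" where
  "short_roots = {(1,0), (2,1), (1,1), (-1,0), (-2,-1), (-1,-1)}"

definition long_roots :: "weight set" where
  "long_roots = {(3,1), (3,2), (0,1), (-3,-1), (-3,-2), (0,-1)}"

text \<open>Here \<open>V\<close> is a hexagon, identified with \<open>W/\<langle>s\<^sub>\<gamma>\<rangle>\<close>. By \<open>pairs\<close> the type of an edge of the moment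
  graph, seen as a pair of vertices, is determined by the invariant form.\<close>

locale weight_orbit =
  fixes V :: "weight set" and \<gamma> \<omega> :: weight
  assumes pos: "\<gamma> \<in> pos_roots" and fixed: "refl \<gamma> \<omega> = \<omega>"
    and orbit: "V = (\<lambda>w. w \<omega>) ` W"
    and stabilizer: "\<And>w. w \<in> W \<Longrightarrow> w \<omega> = \<omega> \<Longrightarrow> w = id \<or> w = refl \<gamma>"
    and pairs: "\<And>v x. v \<in> V \<Longrightarrow> x \<in> V \<Longrightarrow> form \<omega> v = form \<omega> x \<Longrightarrow> v = x \<or> v = refl \<gamma> x"
begin

lemma refl_W: "refl \<gamma> \<in> W"
  by (rule refl_in_W[OF pos_roots_subset[OF pos]])

lemma refl_W2: "refl \<gamma> \<circ> refl \<gamma> = id"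
  by (rule refl_refl[OF pos_roots_subset[OF pos]])

lemma omega_V: "\<omega> \<in> V"
  unfolding orbit by (rule image_eqI[OF _ W.one]) simp

lemma V_W:
  assumes "w \<in> W" "v \<in> V"
  shows "w v \<in> V"
proof -
  obtain x where x: "x \<in> W" "v = x \<omega>" using assms(2) unfolding orbit by blast
  show ?thesis
    unfolding orbit by (rule image_eqI[OF _ W_comp[OF assms(1) x(1)]]) (simp add: x)
qed

lemma same_vertex:
  assumes "w \<in> W" "w' \<in> W" "w \<omega> = w' \<omega>"
  shows "w' = w \<or> w' = w \<circ> refl \<gamma>"
proof -
  have "(winv w \<circ> w') \<omega> = \<omega>"
    using assms(3)[symmetric] W_inv_apply(1)[OF assms(1)] by simp
  then have "winv w \<circ> w' = id \<or> winv w \<circ> w' = refl \<gamma>"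
    by (rule stabilizer[OF W_comp[OF W_inv(1)[OF assms(1)] assms(2)]])
  moreover have "w' = w \<circ> (winv w \<circ> w')"
    using W_inv(3)[OF assms(1)] by (simp flip: comp_assoc)
  ultimately show ?thesis
    by (metis comp_id)
qed

text \<open>Once v is moved to \<omega>, the form leaves two candidates for the other vertex, and
  s_\<gamma>, which fixes \<omega>, exchanges them.\<close>

lemma pair_transitive:
  assumes "v \<in> V" "v' \<in> V" "x \<in> V" "form v v' = form \<omega> x"
  shows "\<exists>w\<in>W. v = w \<omega> \<and> v' = w x"
proof -
  obtain w where w: "w \<in> W" "v = w \<omega>" using assms(1) unfolding orbit by blast
  have "form \<omega> (winv w v') = form v v'"
    using form_W[OF w(1), of \<omega> "winv w v'"] w by (simp add: W_inv_apply)
  then have "winv w v' = x \<or> winv w v' = refl \<gamma> x"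
    using pairs[of "winv w v'" x] assms V_W[OF W_inv(1)[OF w(1)]] by simp
  then consider "v' = w x" | "v' = (w \<circ> refl \<gamma>) x"
    using W_inv_apply(2)[OF w(1), of v'] by auto
  then show ?thesis
  proof cases
    case 2
    moreover have "v = (w \<circ> refl \<gamma>) \<omega>" using w fixed by simp
    ultimately show ?thesis using W_comp[OF w(1) refl_W] by blast
  qed (use w in blast)
qed

text \<open>An edge of type \<gamma> collapses to a vertex. Any other edge becomes a pair of
  vertices whose difference is a multiple of the label, so the pair agrees where the label
  vanishes.\<close>

lemma pull_back_gkm:
  assumes \<phi>: "\<phi> \<in> orbit_ring V S"
    and S: "\<And>\<delta>. \<delta> \<in> pos_roots \<Longrightarrow> - \<delta> \<in> D \<Longrightarrow> \<delta> \<noteq> \<gamma> \<Longrightarrow> form \<omega> (refl \<delta> \<omega>) \<in> S"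
  shows "pull_back_W \<omega> \<phi> \<in> gkm D"
proof (rule gkmI_nonzero)
  fix w \<delta> h assume w: "w \<in> W" and \<delta>: "\<delta> \<in> pos_roots" "- \<delta> \<in> D" and h: "h \<noteq> 0" "wt_eval (w \<delta>) h = 0"
  have r: "refl \<delta> \<in> W" using \<delta>(1) by (intro refl_in_W pos_roots_subset)
  have "\<phi> (w \<omega>) h = \<phi> (w (refl \<delta> \<omega>)) h"
  proof (cases "\<delta> = \<gamma>")
    case False
    obtain k where "wt_eval (w \<omega>) h - wt_eval (w (refl \<delta> \<omega>)) h = of_int k * wt_eval (w \<delta>) h"
      using refl_eq_diff[of \<omega> \<delta>] w by blast
    then have "wt_eval (w \<omega>) h = wt_eval (w (refl \<delta> \<omega>)) h"
      using h(2) by simp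
    moreover have "form (w \<omega>) (w (refl \<delta> \<omega>)) \<in> S"
      using S[OF \<delta> False] form_W[OF w] by simp
    ultimately show ?thesis
      by (intro orbit_ring_edge[OF \<phi> V_W[OF w omega_V] V_W[OF w V_W[OF r omega_V]] _ h(1)])
  qed (simp add: fixed)
  then show "pull_back_W \<omega> \<phi> w h = pull_back_W \<omega> \<phi> (w \<circ> refl \<delta>) h"
    using w W_comp[OF w r] by (simp add: pull_back_W_def)
next
  fix w assume "w \<in> W"
  then show "pull_back_W \<omega> \<phi> w \<in> Sym"
    using orbit_ring_Sym[OF \<phi> V_W[OF _ omega_V]] by (simp add: pull_back_W_def)
qed (simp add: pull_back_W_def)

lemma factor_through_orbit:
  assumes "\<And>w. w \<in> W \<Longrightarrow> f (w \<circ> refl \<gamma>) = f w"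
  shows "\<exists>\<phi>. \<forall>w\<in>W. f w = \<phi> (w \<omega>)"
proof -
  define s where "s v = (SOME w. w \<in> W \<and> w \<omega> = v)" for v
  have "f w = f (s (w \<omega>))" if w: "w \<in> W" for w
  proof -
    have s: "s (w \<omega>) \<in> W \<and> s (w \<omega>) \<omega> = w \<omega>"
      unfolding s_def by (rule someI[of _ w]) (use w in simp)
    then show ?thesis
      using same_vertex[OF w, of "s (w \<omega>)"] assms[OF w] by auto
  qed
  then show ?thesis by (intro exI[of _ "\<lambda>v. f (s v)"]) simp
qed

text \<open>By \<open>stable\<close>, the edge of type \<delta> at w is accompanied by the edge of
  type s_\<gamma> \<delta> at w s_\<gamma>, with the same label w \<delta>. The sum and the
  difference of the two congruences concern the symmetric and the antisymmetric part separately.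
  \<open>S\<close> ensures that each congruence required of \<phi> and \<psi> comes from such an
  edge.\<close>

lemma gkm_split:
  assumes f: "f \<in> gkm D" and \<gamma>D: "- \<gamma> \<in> D"
    and stable: "\<And>\<delta>. \<delta> \<in> pos_roots \<Longrightarrow> - \<delta> \<in> D \<Longrightarrow> \<delta> \<noteq> \<gamma> \<Longrightarrow>
      refl \<gamma> \<delta> \<in> pos_roots \<and> - refl \<gamma> \<delta> \<in> D"
    and S: "\<And>s v. s \<in> S \<Longrightarrow> v \<in> V \<Longrightarrow> form \<omega> v = s \<Longrightarrow>
      \<exists>\<delta>\<in>pos_roots. - \<delta> \<in> D \<and> \<delta> \<noteq> \<gamma> \<and> form \<omega> (refl \<delta> \<omega>) = s"
  shows "\<exists>\<phi>\<in>orbit_ring V S. \<exists>\<psi>\<in>orbit_ring V S. \<forall>w\<in>W. f w = \<phi> (w \<omega>) + wt_eval (w \<gamma>) * \<psi> (w \<omega>)"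
proof -
  let ?s = "refl \<gamma>"
  have ws: "w \<circ> ?s \<in> W" "w \<circ> ?s \<circ> ?s = w" "wt_eval ((w \<circ> ?s) \<gamma>) = - wt_eval (w \<gamma>)" "(w \<circ> ?s) \<omega> = w \<omega>"
    if "w \<in> W" for w
  proof -
    show "w \<circ> ?s \<in> W" by (rule W_comp[OF that refl_W])
    show "w \<circ> ?s \<circ> ?s = w" by (simp only: comp_assoc refl_W2 comp_id)
    show "wt_eval ((w \<circ> ?s) \<gamma>) = - wt_eval (w \<gamma>)"
      using that by (simp only: comp_apply refl_self[OF pos_roots_subset[OF pos]] W_uminus wt_eval_uminus)
    show "(w \<circ> ?s) \<omega> = w \<omega>" by (simp add: fixed)
  qed
  have "\<exists>q\<in>Sym. f w - f (w \<circ> ?s) = wt_eval (w \<gamma>) * q" if w: "w \<in> W" for w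
  proof (rule wt_eval_dvd)
    show "f w - f (w \<circ> ?s) \<in> Sym" using gkm_Sym[OF f] w ws by (intro Sym_diff) auto
    show "w \<gamma> \<noteq> 0" using w pos pos_roots_subset zero_notin_roots W_eq_zero_iff by metis
    show "(f w - f (w \<circ> ?s)) h = 0" if "wt_eval (w \<gamma>) h = 0" for h
      using gkm_edge[OF f w pos \<gamma>D that] by simp
  qed
  then obtain q where q: "\<And>w. w \<in> W \<Longrightarrow> q w \<in> Sym"
    "\<And>w. w \<in> W \<Longrightarrow> f w - f (w \<circ> ?s) = wt_eval (w \<gamma>) * q w" by metis
  \<comment> \<open>Passing from w to w s_\<gamma> changes the sign of both f w - f (w s_\<gamma>)
    and w \<gamma>, so their quotient stays the same.\<close>
  have q_s: "q (w \<circ> ?s) = q w" if w: "w \<in> W" for w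
  proof (rule wt_eval_cancel[of _ _ "w \<gamma>"])
    show "w \<gamma> \<noteq> 0" using w pos pos_roots_subset zero_notin_roots W_eq_zero_iff by metis
    fix h
    have "f (w \<circ> ?s) h - f w h = - wt_eval (w \<gamma>) h * q (w \<circ> ?s) h"
      using fun_cong[OF q(2)[OF ws(1)[OF w]], of h] unfolding ws(2)[OF w] ws(3)[OF w] by simp
    moreover have "f w h - f (w \<circ> ?s) h = wt_eval (w \<gamma>) h * q w h"
      using fun_cong[OF q(2)[OF w], of h] by simp
    ultimately show "wt_eval (w \<gamma>) h * q (w \<circ> ?s) h = wt_eval (w \<gamma>) h * q w h"
      by (simp add: algebra_simps)
  qed (use q w ws in auto)
  obtain \<psi>0 where \<psi>0: "\<And>w. w \<in> W \<Longrightarrow> q w = \<psi>0 (w \<omega>)"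
    using factor_through_orbit[of q] q_s by blast
  define \<psi> where "\<psi> v = (\<lambda>h. (1/2) * \<psi>0 v h)" for v
  have \<psi>: "2 * \<psi> (w \<omega>) h = q w h" if "w \<in> W" for w h
    using \<psi>0[OF that] by (simp add: \<psi>_def)
  define g where "g w = f w + f (w \<circ> ?s)" for w
  have "g (w \<circ> ?s) = g w" if "w \<in> W" for w
    unfolding g_def ws(2)[OF that] by (simp only: add.commute)
  then obtain \<phi>0 where \<phi>0: "\<And>w. w \<in> W \<Longrightarrow> g w = \<phi>0 (w \<omega>)"
    using factor_through_orbit[of g] by blast
  define \<phi> where "\<phi> v = (\<lambda>h. (1/2) * \<phi>0 v h)" for v
  have \<phi>: "2 * \<phi> (w \<omega>) h = f w h + f (w \<circ> ?s) h" if "w \<in> W" for w h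
    using fun_cong[OF \<phi>0[OF that], of h] by (simp add: \<phi>_def g_def)
  have \<psi>': "2 * wt_eval (w \<gamma>) h * \<psi> (w \<omega>) h = f w h - f (w \<circ> ?s) h" if "w \<in> W" for w h
    using fun_cong[OF q(2)[OF that], of h] \<psi>[OF that, of h] by (simp add: mult.commute mult.left_commute)
  have edge: "\<phi> v h = \<phi> v' h \<and> \<psi> v h = \<psi> v' h"
    if v: "v \<in> V" "v' \<in> V" "form v v' \<in> S" and h: "h \<noteq> 0" "wt_eval v h = wt_eval v' h" for v v' h
  proof -
    obtain w0 where w0: "w0 \<in> W" "v = w0 \<omega>" using v(1) unfolding orbit by blast
    have "form \<omega> (winv w0 v') = form v v'"
      using form_W[OF w0(1), of \<omega> "winv w0 v'"] w0 by (simp add: W_inv_apply)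
    then obtain \<delta> where \<delta>: "\<delta> \<in> pos_roots" "- \<delta> \<in> D" "\<delta> \<noteq> \<gamma>" "form \<omega> (refl \<delta> \<omega>) = form v v'"
      using S[OF v(3), of "winv w0 v'"] V_W[OF W_inv(1)[OF w0(1)] v(2)] by auto
    have r: "refl \<delta> \<in> W" using \<delta>(1) by (intro refl_in_W pos_roots_subset)
    obtain w where w: "w \<in> W" "v = w \<omega>" "v' = w (refl \<delta> \<omega>)"
      using pair_transitive[OF v(1,2) V_W[OF r omega_V] \<delta>(4)[symmetric]] by blast
    have wr: "w \<circ> refl \<delta> \<in> W" by (rule W_comp[OF w(1) r])
    obtain k where k: "\<And>w h. w \<in> W \<Longrightarrow> wt_eval (w \<omega>) h - wt_eval (w (refl \<delta> \<omega>)) h = of_int k * wt_eval (w \<delta>) h"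
      using refl_eq_diff[of \<omega> \<delta>] by blast
    show ?thesis
    proof (cases "k = 0")
      \<comment> \<open>Here s_\<delta> fixes \<omega>, so v and v' coincide.\<close>
      case True
      have "wt_eval \<omega> h = wt_eval (refl \<delta> \<omega>) h" for h using k[OF W.one, of h] True by simp
      from this[of "(1, 0)"] this[of "(0, 1)"] have "refl \<delta> \<omega> = \<omega>"
        by (simp add: wt_eval_def case_prod_unfold prod_eq_iff)
      then show ?thesis using w by simp
    next
      case False
      have \<delta>h: "wt_eval (w \<delta>) h = 0"
        using k[OF w(1), of h] h(2) False w by simp
      have "\<gamma> \<noteq> \<delta>" "\<gamma> \<in> pos_roots" using \<delta>(3) pos by auto
      then have "fst \<gamma> * snd \<delta> - snd \<gamma> * fst \<delta> \<noteq> 0" using \<delta>(1) by (auto simp: pos_roots_def)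
      then have "fst (w \<gamma>) * snd (w \<delta>) - snd (w \<gamma>) * fst (w \<delta>) \<noteq> 0"
        using W_det[OF w(1), of \<gamma> \<delta>] by simp
      \<comment> \<open>w \<gamma> and w \<delta> are not proportional, so at a nonzero h on the
        zero line of w \<delta> the factor w \<gamma> can be cancelled from the antisymmetric
        part.\<close>
      then have \<gamma>h: "wt_eval (w \<gamma>) h \<noteq> 0"
        using wt_eval_both_zero \<delta>h h(1) by blast
      obtain l where "wt_eval (w \<gamma>) h - wt_eval (w (refl \<delta> \<gamma>)) h = of_int l * wt_eval (w \<delta>) h"
        using refl_eq_diff[of \<gamma> \<delta>] w(1) by blast
      then have \<gamma>h': "wt_eval ((w \<circ> refl \<delta>) \<gamma>) h = wt_eval (w \<gamma>) h" using \<delta>h by simp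
      have 1: "f w h = f (w \<circ> refl \<delta>) h"
        by (rule gkm_edge[OF f w(1) \<delta>(1,2) \<delta>h])
      have st: "refl \<gamma> \<delta> \<in> pos_roots" "- refl \<gamma> \<delta> \<in> D" using stable[OF \<delta>(1-3)] by auto
      have "(w \<circ> ?s) (refl \<gamma> \<delta>) = w \<delta>"
        using refl_W2 by (metis comp_apply id_apply)
      then have "f (w \<circ> ?s) h = f (w \<circ> ?s \<circ> refl (refl \<gamma> \<delta>)) h"
        using \<delta>h by (intro gkm_edge[OF f ws(1)[OF w(1)] st]) simp
      also have "w \<circ> ?s \<circ> refl (refl \<gamma> \<delta>) = w \<circ> refl \<delta> \<circ> ?s"
        unfolding refl_conj[OF pos \<delta>(1)] using refl_W2 by (metis comp_assoc comp_id)
      finally have 2: "f (w \<circ> ?s) h = f (w \<circ> refl \<delta> \<circ> ?s) h" .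
      have v': "(w \<circ> refl \<delta>) \<omega> = v'" using w by simp
      have "2 * \<phi> v h = 2 * \<phi> v' h"
        using \<phi>[OF w(1), of h] \<phi>[OF wr, of h] 1 2 w(2) v' by simp
      moreover have "2 * wt_eval (w \<gamma>) h * \<psi> v h = 2 * wt_eval (w \<gamma>) h * \<psi> v' h"
        using \<psi>'[OF w(1), of h] \<psi>'[OF wr, of h] 1 2 w(2) v' \<gamma>h' by simp
      ultimately show ?thesis using \<gamma>h by simp
    qed
  qed
  have "\<phi> v \<in> Sym \<and> \<psi> v \<in> Sym" if v: "v \<in> V" for v
  proof -
    obtain w where w: "w \<in> W" "v = w \<omega>" using v unfolding orbit by blast
    have "\<phi>0 v \<in> Sym" "\<psi>0 v \<in> Sym"
      using \<phi>0[OF w(1)] \<psi>0[OF w(1)] q(1)[OF w(1)] Sym_add[OF gkm_Sym[OF f w(1)] gkm_Sym[OF f ws(1)[OF w(1)]]] w(2)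
      by (simp_all add: g_def)
    then show ?thesis unfolding \<phi>_def \<psi>_def by (blast intro: Sym_scale)
  qed
  then have "\<phi> \<in> orbit_ring V S" "\<psi> \<in> orbit_ring V S"
    using edge unfolding orbit_ring_def edge_cond_def by blast+
  moreover have "f w = \<phi> (w \<omega>) + wt_eval (w \<gamma>) * \<psi> (w \<omega>)" if w: "w \<in> W" for w
  proof
    fix h
    have "2 * f w h = 2 * (\<phi> (w \<omega>) h + wt_eval (w \<gamma>) h * \<psi> (w \<omega>) h)"
      using \<phi>[OF w, of h] \<psi>'[OF w, of h] by (simp add: algebra_simps)
    then have "f w h = \<phi> (w \<omega>) h + wt_eval (w \<gamma>) h * \<psi> (w \<omega>) h"
      by (rule mult_left_cancel[THEN iffD1, rotated]) simp
    then show "f w h = (\<phi> (w \<omega>) + wt_eval (w \<gamma>) * \<psi> (w \<omega>)) h" by simp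
  qed
  ultimately show ?thesis by blast
qed

end

text \<open>A weight and its mirror image differ by a multiple of the root, so w \<mapsto> w \<mu>
  satisfies every congruence.\<close>

lemma wt_eval_gkm: "(\<lambda>w. if w \<in> W then wt_eval (w \<mu>) else 0) \<in> gkm D"
proof (rule gkmI)
  fix w \<delta> h assume w: "w \<in> W" and \<delta>: "\<delta> \<in> pos_roots" and h: "wt_eval (w \<delta>) h = 0"
  obtain k where "wt_eval (w \<mu>) h - wt_eval (w (refl \<delta> \<mu>)) h = of_int k * wt_eval (w \<delta>) h"
    using refl_eq_diff[of \<mu> \<delta>] w by blast
  then show "(if w \<in> W then wt_eval (w \<mu>) else 0) h = (if w \<circ> refl \<delta> \<in> W then wt_eval ((w \<circ> refl \<delta>) \<mu>) else 0) h"
    using w h W_comp[OF w refl_in_W[OF pos_roots_subset[OF \<delta>]]] by simp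
qed (auto simp: Sym_wt_eval)

lemma wt_eval_root_nonzero: "\<gamma> \<in> roots \<Longrightarrow> wt_eval \<gamma> (1, 1) \<noteq> 0"
  by (auto simp: roots_eq wt_eval_def)

text \<open>\<open>S1\<close> and \<open>S2\<close> say that, among the values of the form taken on
  V, S holds exactly those coming from edges of types other than \<gamma>.\<close>

lemma (in weight_orbit) has_trace_split:
  assumes B: "equivariant_basis V S J b d \<pi> \<sigma>" and \<gamma>D: "- \<gamma> \<in> D"
    and stable: "\<And>\<delta>. \<delta> \<in> pos_roots \<Longrightarrow> - \<delta> \<in> D \<Longrightarrow> \<delta> \<noteq> \<gamma> \<Longrightarrow>
      refl \<gamma> \<delta> \<in> pos_roots \<and> - refl \<gamma> \<delta> \<in> D"
    and S1: "\<And>\<delta>. \<delta> \<in> pos_roots \<Longrightarrow> - \<delta> \<in> D \<Longrightarrow> \<delta> \<noteq> \<gamma> \<Longrightarrow> form \<omega> (refl \<delta> \<omega>) \<in> S"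
    and S2: "\<And>s v. s \<in> S \<Longrightarrow> v \<in> V \<Longrightarrow> form \<omega> v = s \<Longrightarrow>
      \<exists>\<delta>\<in>pos_roots. - \<delta> \<in> D \<and> \<delta> \<noteq> \<gamma> \<and> form \<omega> (refl \<delta> \<omega>) = s"
    and u: "u \<in> W"
  shows "dot_trace D i u
    (equivariant_basis.trace J d \<pi> \<sigma> u i +
     (if 1 \<le> i then equivariant_basis.trace J d \<pi> \<sigma> u (i - 1) else 0))"
proof -
  have "dot_trace D i u
    (equivariant_basis.trace J d \<pi> \<sigma> u i +
     (if 1 \<le> i then 1 * equivariant_basis.trace J d \<pi> \<sigma> u (i - 1) else 0))"
  proof (rule has_trace_direct_sum[OF B B orbit pos_roots_subset[OF pos] fixed, where G = "\<lambda>w. wt_eval (w \<gamma>)" and \<chi>' = "\<lambda>_. 1"])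
    show "wt_eval (w \<gamma>) \<in> Sym_deg 1" for w by (rule Sym_deg_wt_eval)
    show "act_Sym u (wt_eval (w \<gamma>)) h = 1 * wt_eval ((u \<circ> w) \<gamma>) h" if "u \<in> W" for u w h
      using act_Sym_wt_eval[OF that] by simp
    show "wt_eval (w \<gamma>) (1, 1) \<noteq> wt_eval ((w \<circ> refl \<gamma>) \<gamma>) (1, 1)" if "w \<in> W" for w
      using wt_eval_root_nonzero[OF W_roots[OF that pos_roots_subset[OF pos]]] that
      by (simp add: refl_self[OF pos_roots_subset[OF pos]] W_uminus wt_eval_uminus)
    fix \<phi> assume \<phi>: "\<phi> \<in> orbit_ring V S"
    show p: "pull_back_W \<omega> \<phi> \<in> gkm D" by (rule pull_back_gkm[OF \<phi> S1])
    have "(\<lambda>w. if w \<in> W then wt_eval (w \<gamma>) else 0) * pull_back_W \<omega> \<phi> = (\<lambda>w. wt_eval (w \<gamma>) * pull_back_W \<omega> \<phi> w)"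
      by (auto simp: fun_eq_iff pull_back_W_def)
    then show "(\<lambda>w. wt_eval (w \<gamma>) * pull_back_W \<omega> \<phi> w) \<in> gkm D"
      using gkm_mult[OF wt_eval_gkm p, of \<gamma>] by simp
  next
    fix f assume "f \<in> gkm D"
    from gkm_split[OF this \<gamma>D stable S2]
    show "\<exists>\<phi>\<in>orbit_ring V S. \<exists>\<psi>\<in>orbit_ring V S. \<forall>w\<in>W. f w = \<phi> (w \<omega>) + wt_eval (w \<gamma>) * \<psi> (w \<omega>)" .
  qed (rule u)
  then show ?thesis by (simp only: mult_1)
qed

text \<open>2\<alpha> + \<beta> is the fundamental weight orthogonal to \<beta>; it is the highest
  short root.\<close>

interpretation short: weight_orbit short_roots "(0, 1)" "(2, 1)"
proof
  show "(0, 1) \<in> pos_roots" by (simp add: pos_roots_def)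
  show "s\<^sub>\<beta> (2, 1) = (2, 1)" by (simp add: refl_simps)
  show "short_roots = (\<lambda>w. w (2, 1)) ` W"
    by (auto simp: W_eq W_mats_def short_roots_def image_image)
  show "w = id \<or> w = s\<^sub>\<beta>" if "w \<in> W" "w (2, 1) = (2, 1)" for w
    using that by (auto simp: W_eq W_mats_def refl_simps lin_id)
  show "v = x \<or> v = s\<^sub>\<beta> x" if "v \<in> short_roots" "x \<in> short_roots" "form (2, 1) v = form (2, 1) x" for v x
    using that by (auto simp: short_roots_def form_def refl_simps)
qed

text \<open>3\<alpha> + 2\<beta> is the fundamental weight orthogonal to \<alpha>; it is the highest
  root.\<close>

interpretation long: weight_orbit long_roots "(1, 0)" "(3, 2)"
proof
  show "(1, 0) \<in> pos_roots" by (simp add: pos_roots_def)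
  show "s\<^sub>\<alpha> (3, 2) = (3, 2)" by (simp add: refl_simps)
  show "long_roots = (\<lambda>w. w (3, 2)) ` W"
    by (auto simp: W_eq W_mats_def long_roots_def image_image)
  show "w = id \<or> w = s\<^sub>\<alpha>" if "w \<in> W" "w (3, 2) = (3, 2)" for w
    using that by (auto simp: W_eq W_mats_def refl_simps lin_id)
  show "v = x \<or> v = s\<^sub>\<alpha> x" if "v \<in> long_roots" "x \<in> long_roots" "form (3, 2) v = form (3, 2) x" for v x
    using that by (auto simp: long_roots_def form_def refl_simps)
qed

section \<open>Monomial bases\<close>

lemma wt_eval_pair: "wt_eval (m, n) (x, y) = of_int m * x + of_int n * y"
  by (simp add: wt_eval_def)

text \<open>Cyclic order around the hexagon: the form takes the value 1 on neighbours, -1 on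
  vertices two steps apart and -2 on opposite vertices k and k + 3. The sets E in the flow-up
  arguments below are the earlier neighbours in this order.\<close>

definition short_vertex :: "nat \<Rightarrow> weight" where
  "short_vertex k = [(1,0), (2,1), (1,1), (-1,0), (-2,-1), (-1,-1)] ! k"

lemma lessThan_6: "{..<6} = {0, 1, 2, 3, 4, 5::nat}"
  by auto

lemma short_vertices: "short_roots = short_vertex ` {..<6}"
  unfolding lessThan_6 by (auto simp: short_roots_def short_vertex_def)

text \<open>Again in cyclic order; the values 3, -3 and -6 of the form stand for one, two and three
  steps.\<close>

definition long_vertex :: "nat \<Rightarrow> weight" where
  "long_vertex k = [(3,1), (3,2), (0,1), (-3,-1), (-3,-2), (0,-1)] ! k"

lemma long_vertices: "long_roots = long_vertex ` {..<6}"
  unfolding lessThan_6 by (auto simp: long_roots_def long_vertex_def)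

lemmas vertex_eval = numeral_eq_Suc less_Suc_eq all_conj_distrib wt_eval_pair power_fun_apply algebra_simps

lemmas Sym_intros = Sym_add Sym_mult Sym_diff Sym_uminus Sym_one Sym_numeral Sym_wt_eval

lemma orbit_ring_power: "(\<lambda>v. wt_eval v ^ m) \<in> orbit_ring V S"
  by (auto simp: orbit_ring_def edge_cond_def power_fun_apply intro: Sym_power Sym_wt_eval)

lemma act_power: "u \<in> W \<Longrightarrow> act_Sym u (wt_eval v ^ m) h = (wt_eval (u v) ^ m) h"
  by (simp add: act_Sym_power act_Sym_wt_eval)

lemma finite_W: "finite W"
  by (simp add: W_eq W_mats_def)

lemma class_function_eq:
  "class_function a0 a1 a2 a3 a4 a5 w =
  (if w = lin (1, 0, 0, 1) then a0 else if conj_W w (lin (-1, 3, 0, 1)) then a1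
   else if conj_W w (lin (1, 0, 1, -1)) then a2 else if conj_W w (lin (2, -3, 1, -1)) then a3
   else if conj_W w (lin (1, -3, 1, -2)) then a4 else if conj_W w (lin (-1, 0, 0, -1)) then a5 else 0)"
proof -
  have 1: "s\<^sub>\<alpha> \<circ> s\<^sub>\<beta> = lin (2, -3, 1, -1)"
    by (simp add: refl_simps del: o_apply)
  have 2: "(s\<^sub>\<alpha> \<circ> s\<^sub>\<beta>) ^^ 2 = lin (1, -3, 1, -2)" "(s\<^sub>\<alpha> \<circ> s\<^sub>\<beta>) ^^ 3 = lin (-1, 0, 0, -1)"
    unfolding 1 by (simp_all add: numeral_eq_Suc lin_id del: o_apply)
  show ?thesis
    unfolding class_function_def 2 unfolding 1 unfolding refl_simps lin_id by (rule HOL.refl)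
qed

lemma class_function_values:
  "class_function a0 a1 a2 a3 a4 a5 (lin (1, 0, 0, 1)) = a0"
  "class_function a0 a1 a2 a3 a4 a5 (lin (-1, 3, 0, 1)) = a1"
  "class_function a0 a1 a2 a3 a4 a5 (lin (2, -3, 1, -2)) = a1"
  "class_function a0 a1 a2 a3 a4 a5 (lin (-1, 0, -1, 1)) = a1"
  "class_function a0 a1 a2 a3 a4 a5 (lin (1, 0, 1, -1)) = a2"
  "class_function a0 a1 a2 a3 a4 a5 (lin (-2, 3, -1, 2)) = a2"
  "class_function a0 a1 a2 a3 a4 a5 (lin (1, -3, 0, -1)) = a2"
  "class_function a0 a1 a2 a3 a4 a5 (lin (2, -3, 1, -1)) = a3"
  "class_function a0 a1 a2 a3 a4 a5 (lin (-1, 3, -1, 2)) = a3"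
  "class_function a0 a1 a2 a3 a4 a5 (lin (1, -3, 1, -2)) = a4"
  "class_function a0 a1 a2 a3 a4 a5 (lin (-2, 3, -1, 1)) = a4"
  "class_function a0 a1 a2 a3 a4 a5 (lin (-1, 0, 0, -1)) = a5"
  by (simp_all add: class_function_eq conj_W_def W_eq W_mats_def del: o_apply)

definition b123 :: "nat \<Rightarrow> weight \<Rightarrow> symt" where
  "b123 j v = wt_eval v ^ j"

lemmas b123_eval = vertex_eval short_vertex_def b123_def lessThan_Suc

text \<open>Every two vertices are joined, so each element of the ring is a polynomial in v, which
  interpolates its six values. The flow-up classes are the Newton polynomials, the products of v -
  v_j over j < k, expanded in powers of v.\<close>

interpretation b123: equivariant_basis short_roots "{1, -1, -2}" "{..<6}" b123 id "\<lambda>_. id" "\<lambda>_ _. 1"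
proof
  show "b123 j v \<in> Sym_deg (id j)" for j v
    by (simp add: b123_def Sym_deg_wt_eval_power)
  show ring: "b123 j \<in> orbit_ring short_roots {1, -1, -2}" for j
    unfolding b123_def by (rule orbit_ring_power)
  fix \<phi> assume \<phi>: "\<phi> \<in> orbit_ring short_roots {1, -1, -2}"
  show "in_span short_roots {..<6} b123 \<phi>"
  proof (rule triangular_span[OF short_vertices ring _ _ _ \<phi>, where E = "\<lambda>k. {..<k}"])
    \<comment> \<open>In cyclic order the vertices are A, A + B, B, -A, -(A + B), -B.\<close>
    let ?A = "wt_eval (1, 0)" and ?B = "wt_eval (1, 1)"
    fix k :: nat assume "k < 6"
    then consider "k = 0" | "k = 1" | "k = 2" | "k = 3" | "k = 4" | "k = 5" by linarith
    then show "\<exists>e c. in_span short_roots {..<6} b123 e \<and> c \<noteq> 0 \<and> (\<forall>j<k. \<forall>h. e (short_vertex j) h = 0) \<and>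
      (\<forall>h. e (short_vertex k) h = c * (\<Prod>j<k. wt_eval (short_vertex k - short_vertex j) h))"
    proof cases
      case 1
      show ?thesis
        unfolding 1
        by (intro exI[of _ "\<lambda>v. 1 * b123 0 v"]
            exI[of _ 1] conjI in_span_add in_span_base Sym_intros)
          (simp_all add: b123_eval)
    next
      case 2
      show ?thesis
        unfolding 2
        by (intro exI[of _ "\<lambda>v. (- ?A) * b123 0 v + 1 * b123 1 v"]
            exI[of _ 1] conjI in_span_add in_span_base Sym_intros)
          (simp_all add: b123_eval)
    next
      case 3
      show ?thesis
        unfolding 3
        by (intro exI[of _ "\<lambda>v. (?A * ?B + ?A * ?A) * b123 0 v + (- ?B - 2 * ?A) * b123 1 v + 1 * b123 2 v"]
            exI[of _ 1] conjI in_span_add in_span_base Sym_intros)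
          (simp_all add: b123_eval)
    next
      case 4
      show ?thesis
        unfolding 4
        by (intro exI[of _ "\<lambda>v. (- ?A * ?B * ?B - ?A * ?A * ?B) * b123 0 v + (?B * ?B + 3 * ?A * ?B + ?A * ?A) * b123 1 v + (- 2 * ?B - 2 * ?A) * b123 2 v + 1 * b123 3 v"]
            exI[of _ 1] conjI in_span_add in_span_base Sym_intros)
          (simp_all add: b123_eval)
    next
      case 5
      show ?thesis
        unfolding 5
        by (intro exI[of _ "\<lambda>v. (- ?A * ?A * ?B * ?B - ?A * ?A * ?A * ?B) * b123 0 v + (2 * ?A * ?A * ?B + ?A * ?A * ?A) * b123 1 v + (?B * ?B + ?A * ?B - ?A * ?A) * b123 2 v + (- 2 * ?B - ?A) * b123 3 v + 1 * b123 4 v"]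
            exI[of _ 1] conjI in_span_add in_span_base Sym_intros)
          (simp_all add: b123_eval)
    next
      case 6
      show ?thesis
        unfolding 6
        by (intro exI[of _ "\<lambda>v. (- ?A * ?A * ?B * ?B * ?B - 2 * ?A * ?A * ?A * ?B * ?B - ?A * ?A * ?A * ?A * ?B) * b123 0 v + (?A * ?A * ?B * ?B + 2 * ?A * ?A * ?A * ?B + ?A * ?A * ?A * ?A) * b123 1 v + (?B * ?B * ?B + 2 * ?A * ?B * ?B + 2 * ?A * ?A * ?B) * b123 2 v + (- ?B * ?B - 2 * ?A * ?B - 2 * ?A * ?A) * b123 3 v + (- ?B) * b123 4 v + 1 * b123 5 v"]
            exI[of _ 1] conjI in_span_add in_span_base Sym_intros)
          (simp_all add: b123_eval)
    qed

  qed (auto simp: lessThan_6 short_vertex_def form_def less_Suc_eq numeral_eq_Suc)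
next
  fix a :: "nat \<Rightarrow> complex" and j :: nat
  assume eq: "\<And>v. v \<in> short_roots \<Longrightarrow> (\<Sum>j<6. a j * b123 j v (1, 1)) = 0" and j: "j \<in> {..<6}"
  \<comment> \<open>At (1, 1) the vertices take the distinct values 1, 3, 2, -1, -3, -2, so this is
    a Vandermonde system.\<close>
  show "a j = 0"
    using j eq[of "(1,0)"] eq[of "(2,1)"] eq[of "(1,1)"] eq[of "(-1,0)"] eq[of "(-2,-1)"] eq[of "(-1,-1)"]
    by (auto simp: lessThan_6 b123_def short_roots_def wt_eval_pair power_fun_apply complex_eq_iff)
next
  fix u j v h assume "u \<in> W"
  then show "act_Sym u (b123 j v) h = 1 * b123 (id j) (u v) h"
    by (simp add: b123_def act_power)
qed auto

text \<open>Up to sign, \<open>long_cofactor v\<close> is the product of the two positive long roots that are not proportional to \<open>v\<close>;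
  the signs make it transform by \<open>\<epsilon>\<^sub>1\<close>.\<close>

definition long_cofactor :: "weight \<Rightarrow> symt" where
  "long_cofactor v =
    (if v = (3,1) then wt_eval (0,-1) * wt_eval (3,2) else if v = (-3,-1) then wt_eval (0,1) * wt_eval (3,2)
     else if v = (3,2) then wt_eval (0,-1) * wt_eval (3,1) else if v = (-3,-2) then wt_eval (0,1) * wt_eval (3,1)
     else if v = (0,1) then wt_eval (-3,-1) * wt_eval (3,2) else wt_eval (3,1) * wt_eval (3,2))"

lemma long_cofactor_deg: "long_cofactor v \<in> Sym_deg 2"
  using Sym_deg_mult[OF Sym_deg_wt_eval Sym_deg_wt_eval] by (simp add: long_cofactor_def numeral_2_eq_2)

lemma long_cofactor_mult:
  assumes "v \<in> long_roots"
  shows "wt_eval v * long_cofactor v = - (wt_eval (3,1) * wt_eval (3,2) * wt_eval (0,1))"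
  using assms by (auto simp: long_roots_def long_cofactor_def fun_eq_iff wt_eval_pair algebra_simps)

text \<open>The product of v and \<open>long_cofactor v\<close> does not depend on v. Where v and v'
  agree off the origin they are nonzero, being non-proportional, and can be cancelled. Opposite
  vertices are proportional, and their cofactors differ by a sign.\<close>

lemma long_cofactor_ring: "long_cofactor \<in> orbit_ring long_roots {3, -3}"
  unfolding orbit_ring_def edge_cond_def
proof (intro CollectI conjI ballI allI impI)
  show "long_cofactor v \<in> Sym" for v
    using long_cofactor_deg Sym_deg_subset by blast
  fix v v' h assume v: "v \<in> long_roots" "v' \<in> long_roots" "form v v' \<in> {3, -3}"
    and h: "h \<noteq> 0" and eq: "wt_eval v h = wt_eval v' h"
  have "fst v * snd v' - snd v * fst v' \<noteq> 0"
    using v by (auto simp: long_roots_def form_def)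
  then have nz: "wt_eval v h \<noteq> 0"
    using wt_eval_both_zero h eq by metis
  have "wt_eval v h * long_cofactor v h = wt_eval v' h * long_cofactor v' h"
    using fun_cong[OF long_cofactor_mult[OF v(1)], of h] fun_cong[OF long_cofactor_mult[OF v(2)], of h] by simp
  then show "long_cofactor v h = long_cofactor v' h"
    using nz eq by simp
qed

text \<open>The product of the positive long roots changes sign under reflections in long roots and
  is fixed by those in short roots, which is the character \<open>\<epsilon>\<^sub>1\<close>. The
  factor v is then cancelled.\<close>

lemma long_cofactor_act:
  assumes u: "u \<in> W" and v: "v \<in> long_roots"
  shows "act_Sym u (long_cofactor v) h = \<epsilon>\<^sub>1 u * long_cofactor (u v) h"
proof -
  let ?P = "wt_eval (3,1) * wt_eval (3,2) * wt_eval (0,1)"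
  have uv: "u v \<in> long_roots" by (rule long.V_W[OF u v])
  have P: "act_Sym u ?P h = \<epsilon>\<^sub>1 u * ?P h" for h
    unfolding act_Sym_mult act_Sym_wt_eval[OF u] using u
    by (cases h) (auto simp: W_eq W_mats_def \<epsilon>\<^sub>1_def class_function_values wt_eval_pair algebra_simps)
  have "act_Sym u (long_cofactor v) = (\<lambda>h. \<epsilon>\<^sub>1 u * long_cofactor (u v) h)"
  proof (rule wt_eval_cancel)
    show "act_Sym u (long_cofactor v) \<in> Sym" "(\<lambda>h. \<epsilon>\<^sub>1 u * long_cofactor (u v) h) \<in> Sym"
      using long_cofactor_deg Sym_deg_subset by (blast intro: act_Sym_Sym Sym_scale)+
    show "u v \<noteq> 0" using uv by (auto simp: long_roots_def zero_prod_def)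
    fix h
    have "wt_eval (u v) h * act_Sym u (long_cofactor v) h = act_Sym u (wt_eval v * long_cofactor v) h"
      by (simp add: act_Sym_mult act_Sym_wt_eval[OF u])
    also have "\<dots> = - (\<epsilon>\<^sub>1 u * ?P h)"
      unfolding long_cofactor_mult[OF v] act_Sym_uminus using P by simp
    also have "\<dots> = \<epsilon>\<^sub>1 u * (wt_eval (u v) * long_cofactor (u v)) h"
      unfolding long_cofactor_mult[OF uv] by simp
    finally show "wt_eval (u v) h * act_Sym u (long_cofactor v) h = wt_eval (u v) h * (\<epsilon>\<^sub>1 u * long_cofactor (u v) h)"
      by simp
  qed
  then show ?thesis by simp
qed

definition b12 :: "nat \<Rightarrow> weight \<Rightarrow> symt" where
  "b12 j v = (if j = 5 then long_cofactor v else wt_eval v ^ j)"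

lemmas b12_eval = vertex_eval long_vertex_def b12_def long_cofactor_def

text \<open>All vertices are joined except opposite ones. For k \<ge> 3 the flow-up class is the
  product of v - v_j over all j < k, divided by v: its constant term is a multiple of v times
  \<open>long_cofactor v\<close>. The factor v_k - (-v_k) = 2 v_k of the opposite vertex, which is
  no neighbour, thereby becomes the constant 2.\<close>

interpretation b12: equivariant_basis long_roots "{3, -3}" "{..<6}" b12 "\<lambda>j. if j = 5 then 2 else j" "\<lambda>_ j. j" "\<lambda>u j. if j = 5 then \<epsilon>\<^sub>1 u else 1"
proof
  show "b12 j v \<in> Sym_deg ((\<lambda>j. if j = 5 then 2 else j) j)" if "j \<in> {..<6}" "v \<in> long_roots" for j :: "nat" and v
    by (simp add: b12_def long_cofactor_deg Sym_deg_wt_eval_power)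
  show ring: "b12 j \<in> orbit_ring long_roots {3, -3}" if "j \<in> {..<6}" for j :: "nat"
    unfolding b12_def by (cases "j = 5") (simp_all add: long_cofactor_ring orbit_ring_power)
  fix \<phi> assume \<phi>: "\<phi> \<in> orbit_ring long_roots {3, -3}"
  show "in_span long_roots {..<6} b12 \<phi>"
  proof (rule triangular_span[OF long_vertices ring _ _ _ \<phi>, where E = "(!) [{}, {0}, {0, 1}, {1, 2}, {0, 2, 3}, {0, 1, 3, 4}]"])
    \<comment> \<open>As on the short hexagon, the vertices are A, A + B, B, -A, -(A + B),
      -B.\<close>
    let ?A = "wt_eval (3, 1)" and ?B = "wt_eval (0, 1)"
    fix k :: nat assume "k < 6"
    then consider "k = 0" | "k = 1" | "k = 2" | "k = 3" | "k = 4" | "k = 5" by linarith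
    then show "\<exists>e c. in_span long_roots {..<6} b12 e \<and> c \<noteq> 0 \<and> (\<forall>j<k. \<forall>h. e (long_vertex j) h = 0) \<and>
      (\<forall>h. e (long_vertex k) h = c * (\<Prod>j\<in>[{}, {0}, {0, 1}, {1, 2}, {0, 2, 3}, {0, 1, 3, 4}] ! k. wt_eval (long_vertex k - long_vertex j) h))"
    proof cases
      case 1
      show ?thesis
        unfolding 1
        by (intro exI[of _ "\<lambda>v. 1 * b12 0 v"]
            exI[of _ 1] conjI in_span_add in_span_base Sym_intros)
          (simp_all add: b12_eval)
    next
      case 2
      show ?thesis
        unfolding 2
        by (intro exI[of _ "\<lambda>v. (- ?A) * b12 0 v + 1 * b12 1 v"]
            exI[of _ 1] conjI in_span_add in_span_base Sym_intros)
          (simp_all add: b12_eval)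
    next
      case 3
      show ?thesis
        unfolding 3
        by (intro exI[of _ "\<lambda>v. (?A * ?B + ?A * ?A) * b12 0 v + (- ?B - 2 * ?A) * b12 1 v + 1 * b12 2 v"]
            exI[of _ 1] conjI in_span_add in_span_base Sym_intros)
          (simp_all add: b12_eval)
    next
      case 4
      show ?thesis
        unfolding 4
        by (intro exI[of _ "\<lambda>v. (?B * ?B + 3 * ?A * ?B + ?A * ?A) * b12 0 v + (- 2 * ?B - 2 * ?A) * b12 1 v + 1 * b12 2 v + 1 * b12 5 v"]
            exI[of _ 2] conjI in_span_add in_span_base Sym_intros)
          (simp_all add: b12_eval)
    next
      case 5
      show ?thesis
        unfolding 5
        by (intro exI[of _ "\<lambda>v. (2 * ?A * ?A * ?B + ?A * ?A * ?A) * b12 0 v + (?B * ?B + ?A * ?B - ?A * ?A) * b12 1 v + (- 2 * ?B - ?A) * b12 2 v + (?A) * b12 5 v + 1 * b12 3 v"]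
            exI[of _ 2] conjI in_span_add in_span_base Sym_intros)
          (simp_all add: b12_eval)
    next
      case 6
      show ?thesis
        unfolding 6
        by (intro exI[of _ "\<lambda>v. (?A * ?A * ?B * ?B + 2 * ?A * ?A * ?A * ?B + ?A * ?A * ?A * ?A) * b12 0 v + (?B * ?B * ?B + 2 * ?A * ?B * ?B + 2 * ?A * ?A * ?B) * b12 1 v + (- ?B * ?B - 2 * ?A * ?B - 2 * ?A * ?A) * b12 2 v + (?A * ?B + ?A * ?A) * b12 5 v + (- ?B) * b12 3 v + 1 * b12 4 v"]
            exI[of _ 2] conjI in_span_add in_span_base Sym_intros)
          (simp_all add: b12_eval)
    qed
  qed (auto simp: lessThan_6 long_vertex_def form_def less_Suc_eq numeral_eq_Suc)
next
  fix a :: "nat \<Rightarrow> complex" and j :: "nat"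
  assume eq: "\<And>v. v \<in> long_roots \<Longrightarrow> (\<Sum>j\<in>{..<6}. a j * b12 j v (1, 1)) = 0" and j: "j \<in> {..<6}"
  show "a j = 0"
    using j eq[of "(3,1)"] eq[of "(3,2)"] eq[of "(0,1)"] eq[of "(-3,-1)"] eq[of "(-3,-2)"] eq[of "(0,-1)"]
    by (auto simp: lessThan_6 b12_def long_cofactor_def long_roots_def wt_eval_pair power_fun_apply complex_eq_iff)
next
  fix u v h and j :: "nat" assume "u \<in> W" "j \<in> {..<6}" "v \<in> long_roots"
  then show "act_Sym u (b12 j v) h = (\<lambda>u j. if j = 5 then \<epsilon>\<^sub>1 u else 1) u j * b12 ((\<lambda>_ j. j) u j) (u v) h"
    by (simp add: b12_def act_power long_cofactor_act)
qed auto

text \<open>\<open>orth v\<close> is one of the two long roots orthogonal to \<open>v\<close>, with the sign that makes it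
  transform by \<open>\<epsilon>\<^sub>1\<close>.\<close>

definition orth :: "weight \<Rightarrow> weight" where
  "orth v = (if v = (1,0) \<or> v = (-1,0) then (3,2) else if v = (2,1) \<or> v = (-2,-1) then (0,-1) else (-3,-1))"

text \<open>A congruence holds as soon as f v - f v' is an integral multiple of v - v'. The finite
  range for k lets enumeration decide the hypothesis: \<open>orth\<close> uses 0 and \<plusminus>3,
  \<open>fold_map\<close> uses \<plusminus>1.\<close>

lemma orbit_ring_wt_eval:
  assumes "\<forall>v\<in>V. \<forall>v'\<in>V. form v v' \<in> S \<longrightarrow>
    (\<exists>k\<in>{0, 1, -1, 3, -3}. f v - f v' = (k * fst (v - v'), k * snd (v - v')))"
  shows "(\<lambda>v. wt_eval (f v)) \<in> orbit_ring V S"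
  unfolding orbit_ring_def edge_cond_def
proof (intro CollectI conjI ballI allI impI)
  fix v v' h assume v: "v \<in> V" "v' \<in> V" "form v v' \<in> S" and eq: "wt_eval v h = wt_eval v' h"
  obtain k where "f v - f v' = (k * fst (v - v'), k * snd (v - v'))"
    using assms v by blast
  then have "wt_eval (f v - f v') h = of_int k * wt_eval (v - v') h"
    by (simp add: wt_eval_def case_prod_unfold algebra_simps)
  then show "wt_eval (f v) h = wt_eval (f v') h"
    using eq by (simp add: wt_eval_diff)
qed (rule Sym_wt_eval)

lemma orth_ring: "(\<lambda>v. wt_eval (orth v)) \<in> orbit_ring short_roots {1, -2}"
  by (rule orbit_ring_wt_eval) (simp add: short_roots_def form_def orth_def zero_prod_def)

lemma orth_act:
  assumes "u \<in> W" "v \<in> short_roots"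
  shows "act_Sym u (wt_eval (orth v)) h = \<epsilon>\<^sub>1 u * wt_eval (orth (u v)) h"
proof -
  have "\<forall>u\<in>W. \<forall>v\<in>short_roots. (\<epsilon>\<^sub>1 u = 1 \<and> u (orth v) = orth (u v)) \<or> (\<epsilon>\<^sub>1 u = -1 \<and> u (orth v) = - orth (u v))"
    by (simp add: W_eq W_mats_def short_roots_def orth_def \<epsilon>\<^sub>1_def class_function_values)
  then have "(\<epsilon>\<^sub>1 u = 1 \<and> u (orth v) = orth (u v)) \<or> (\<epsilon>\<^sub>1 u = -1 \<and> u (orth v) = - orth (u v))"
    using assms by blast
  then show ?thesis
    using act_Sym_wt_eval[OF assms(1)] by (auto simp: wt_eval_uminus)
qed

definition b13 :: "nat \<Rightarrow> weight \<Rightarrow> symt" where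
  "b13 j v = (if j < 4 then wt_eval v ^ j else wt_eval v ^ (j - 4) * wt_eval (orth v))"

lemma orbit_ring_mult: "\<phi> \<in> orbit_ring V S \<Longrightarrow> \<psi> \<in> orbit_ring V S \<Longrightarrow> (\<lambda>v. \<phi> v * \<psi> v) \<in> orbit_ring V S"
  by (auto simp: orbit_ring_def edge_cond_def intro: Sym_mult)

lemmas b13_eval = vertex_eval short_vertex_def b13_def orth_def

text \<open>Neighbours and opposite vertices are joined, which gives 0, 1, 1, 2, 2, 3 earlier
  neighbours. Besides the powers of v up to degree 3, this calls for one more element in each of the
  degrees 1 and 2: \<open>orth\<close>, which is constant on opposite pairs, and v times it.\<close>

interpretation b13: equivariant_basis short_roots "{1, -2}" "{..<6}" b13 "\<lambda>j. if j < 4 then j else j - 3" "\<lambda>_ j. j" "\<lambda>u j. if j < 4 then 1 else \<epsilon>\<^sub>1 u"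
proof
  show "b13 j v \<in> Sym_deg ((\<lambda>j. if j < 4 then j else j - 3) j)" if "j \<in> {..<6}" "v \<in> short_roots" for j :: "nat" and v
    using Sym_deg_mult[OF Sym_deg_wt_eval_power[of v "j - 4"] Sym_deg_wt_eval[of "orth v"]]
    by (cases "j < 4") (simp_all add: b13_def Sym_deg_wt_eval_power Suc_diff_Suc numeral_eq_Suc)
  show ring: "b13 j \<in> orbit_ring short_roots {1, -2}" if "j \<in> {..<6}" for j :: "nat"
    unfolding b13_def by (cases "j < 4") (simp_all add: orbit_ring_power orbit_ring_mult[OF orbit_ring_power orth_ring])
  fix \<phi> assume \<phi>: "\<phi> \<in> orbit_ring short_roots {1, -2}"
  show "in_span short_roots {..<6} b13 \<phi>"
  proof (rule triangular_span[OF short_vertices ring _ _ _ \<phi>, where E = "(!) [{}, {0}, {1}, {0, 2}, {1, 3}, {0, 2, 4}]"])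
    \<comment> \<open>On A, A + B, B the values of \<open>orth\<close> are A + 2B, A - B, -2A - B,
      repeated on the negatives. The coefficients below are integral solutions of the condition that
      e vanish at the earlier vertices; c is the resulting multiple.\<close>
    let ?A = "wt_eval (1, 0)" and ?B = "wt_eval (1, 1)"
    fix k :: nat assume "k < 6"
    then consider "k = 0" | "k = 1" | "k = 2" | "k = 3" | "k = 4" | "k = 5" by linarith
    then show "\<exists>e c. in_span short_roots {..<6} b13 e \<and> c \<noteq> 0 \<and> (\<forall>j<k. \<forall>h. e (short_vertex j) h = 0) \<and>
      (\<forall>h. e (short_vertex k) h = c * (\<Prod>j\<in>[{}, {0}, {1}, {0, 2}, {1, 3}, {0, 2, 4}] ! k. wt_eval (short_vertex k - short_vertex j) h))"
    proof cases
      case 1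
      show ?thesis
        unfolding 1
        by (intro exI[of _ "\<lambda>v. 1 * b13 0 v"]
            exI[of _ 1] conjI in_span_add in_span_base Sym_intros)
          (simp_all add: b13_eval)
    next
      case 2
      show ?thesis
        unfolding 2
        by (intro exI[of _ "\<lambda>v. (- ?A) * b13 0 v + 1 * b13 1 v"]
            exI[of _ 1] conjI in_span_add in_span_base Sym_intros)
          (simp_all add: b13_eval)
    next
      case 3
      show ?thesis
        unfolding 3
        by (intro exI[of _ "\<lambda>v. (- 2 * ?B - 4 * ?A) * b13 0 v + (3) * b13 1 v + 1 * b13 4 v"]
            exI[of _ 6] conjI in_span_add in_span_base Sym_intros)
          (simp_all add: b13_eval)
    next
      case 4
      show ?thesis
        unfolding 4
        by (intro exI[of _ "\<lambda>v. (2 * ?B * ?B + 8 * ?A * ?B + 2 * ?A * ?A) * b13 0 v + (- 9 * ?B - 9 * ?A) * b13 1 v + (- ?B + ?A) * b13 4 v + (6) * b13 2 v"]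
            exI[of _ 9] conjI in_span_add in_span_base Sym_intros)
          (simp_all add: b13_eval)
    next
      case 5
      show ?thesis
        unfolding 5
        by (intro exI[of _ "\<lambda>v. (4 * ?B * ?B + 4 * ?A * ?B - 2 * ?A * ?A) * b13 0 v + (- 6 * ?B - 3 * ?A) * b13 1 v + (- 2 * ?B - ?A) * b13 4 v + (3) * b13 2 v + (3) * b13 5 v"]
            exI[of _ 9] conjI in_span_add in_span_base Sym_intros)
          (simp_all add: b13_eval)
    next
      case 6
      show ?thesis
        unfolding 6
        by (intro exI[of _ "\<lambda>v. (2 * ?B * ?B * ?B + 5 * ?A * ?B * ?B + 5 * ?A * ?A * ?B) * b13 0 v + (- 2 * ?B * ?B - 5 * ?A * ?B - 5 * ?A * ?A) * b13 1 v + (- ?B * ?B - 2 * ?A * ?B) * b13 4 v + (- 3 * ?B) * b13 2 v + (?B + 2 * ?A) * b13 5 v + (3) * b13 3 v"]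
            exI[of _ 9] conjI in_span_add in_span_base Sym_intros)
          (simp_all add: b13_eval)
    qed
  qed (auto simp: lessThan_6 short_vertex_def form_def less_Suc_eq numeral_eq_Suc)
next
  fix a :: "nat \<Rightarrow> complex" and j :: "nat"
  assume eq: "\<And>v. v \<in> short_roots \<Longrightarrow> (\<Sum>j\<in>{..<6}. a j * b13 j v (1, 1)) = 0" and j: "j \<in> {..<6}"
  show "a j = 0"
    using j eq[of "(1,0)"] eq[of "(2,1)"] eq[of "(1,1)"] eq[of "(-1,0)"] eq[of "(-2,-1)"] eq[of "(-1,-1)"]
    by (auto simp: lessThan_6 b13_def orth_def short_roots_def wt_eval_pair power_fun_apply complex_eq_iff)
next
  fix u v h and j :: "nat" assume "u \<in> W" "j \<in> {..<6}" "v \<in> short_roots"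
  then show "act_Sym u (b13 j v) h = (\<lambda>u j. if j < 4 then 1 else \<epsilon>\<^sub>1 u) u j * b13 ((\<lambda>_ j. j) u j) (u v) h"
    by (simp add: b13_def act_power act_Sym_mult orth_act)
qed auto

text \<open>For each of the three pairs \<open>\<plusminus>\<delta>\<close> of short roots, \<open>fold_map \<delta>\<close> folds the hexagon of short roots
  along \<open>\<delta>\<close>. The group \<open>W\<close> permutes the pairs by \<open>1 + \<chi>\<^sub>2\<close>.\<close>

definition fold_map :: "weight \<Rightarrow> weight \<Rightarrow> weight" where
  "fold_map \<delta> v = (if v = \<delta> \<or> v = - \<delta> then 0 else refl \<delta> v)"

definition pos_part :: "weight \<Rightarrow> weight" where
  "pos_part \<delta> = (if \<delta> \<in> pos_roots then \<delta> else - \<delta>)"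

text \<open>The three functions \<open>fold_map \<delta>\<close> add up to v itself, so v is not
  listed again and the index 1 among the powers is given to \<open>orth\<close>.\<close>

definition b1 :: "nat + weight \<Rightarrow> weight \<Rightarrow> symt" where
  "b1 = case_sum (\<lambda>j v. if j = 1 then wt_eval (orth v) else wt_eval v ^ j) (\<lambda>\<delta> v. wt_eval (fold_map \<delta> v))"

text \<open>A neighbour v of \<delta> is reflected to v - \<delta>, a multiple of the label, so 0 is
  the compatible value at \<delta>; likewise at -\<delta>. The two remaining sides are parallel to
  \<delta> and are reversed by the reflection.\<close>

lemma fold_map_ring:
  assumes "\<delta> \<in> {(1,0), (1,1), (2,1)}"
  shows "(\<lambda>v. wt_eval (fold_map \<delta> v)) \<in> orbit_ring short_roots {1}"
proof (rule orbit_ring_wt_eval)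
  have "\<forall>\<delta>\<in>{(1,0), (1,1), (2,1)}. \<forall>v\<in>short_roots. \<forall>v'\<in>short_roots. form v v' \<in> {1} \<longrightarrow>
      (\<exists>k\<in>{0, 1, -1, 3, -3}. fold_map \<delta> v - fold_map \<delta> v' = (k * fst (v - v'), k * snd (v - v')))"
    by (simp add: short_roots_def form_def fold_map_def refl_simps zero_prod_def)
  then show "\<forall>v\<in>short_roots. \<forall>v'\<in>short_roots. form v v' \<in> {1} \<longrightarrow>
      (\<exists>k\<in>{0, 1, -1, 3, -3}. fold_map \<delta> v - fold_map \<delta> v' = (k * fst (v - v'), k * snd (v - v')))"
    using assms by blast
qed

lemma fold_map_act:
  assumes "u \<in> W" "\<delta> \<in> {(1,0), (1,1), (2,1)}" "v \<in> short_roots"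
  shows "act_Sym u (wt_eval (fold_map \<delta> v)) = wt_eval (fold_map (pos_part (u \<delta>)) (u v))"
proof -
  have "\<forall>u\<in>W. \<forall>\<delta>\<in>{(1,0), (1,1), (2,1)}. \<forall>v\<in>short_roots. u (fold_map \<delta> v) = fold_map (pos_part (u \<delta>)) (u v)"
    by (simp add: W_eq W_mats_def short_roots_def fold_map_def pos_part_def pos_roots_def refl_simps zero_prod_def)
  then have "u (fold_map \<delta> v) = fold_map (pos_part (u \<delta>)) (u v)"
    using assms by blast
  then show ?thesis
    using act_Sym_wt_eval[OF assms(1)] by simp
qed

lemma orbit_ring_mono: "S' \<subseteq> S \<Longrightarrow> \<phi> \<in> orbit_ring V S \<Longrightarrow> \<phi> \<in> orbit_ring V S'"
  by (auto simp: orbit_ring_def edge_cond_def)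

lemmas b1_eval = vertex_eval short_vertex_def b1_def orth_def fold_map_def refl_simps zero_prod_def Plus_def

text \<open>Only the sides of the hexagon remain, with 0, 1, 1, 1, 1, 2 earlier neighbours. The four
  elements needed in degree 1 are \<open>orth\<close> and the three fold maps.\<close>

interpretation b1: equivariant_basis short_roots "{1}" "{0, 1, 2} <+> {(1,0), (1,1), (2,1)}" b1 "case_sum (\<lambda>j. j) (\<lambda>_. 1)" "\<lambda>u. map_sum (\<lambda>j. j) (\<lambda>\<delta>. pos_part (u \<delta>))" "\<lambda>u. case_sum (\<lambda>j. if j = 1 then \<epsilon>\<^sub>1 u else 1) (\<lambda>_. 1)"
proof
  show "b1 j v \<in> Sym_deg ((case_sum (\<lambda>j. j) (\<lambda>_. 1)) j)" if "j \<in> {0, 1, 2} <+> {(1,0), (1,1), (2,1)}" "v \<in> short_roots" for j :: "nat + weight" and v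
    using that by (auto simp: b1_def Sym_deg_wt_eval_power Sym_deg_wt_eval Sym_deg_one simp del: One_nat_def one_fun_apply)
  show ring: "b1 j \<in> orbit_ring short_roots {1}" if "j \<in> {0, 1, 2} <+> {(1,0), (1,1), (2,1)}" for j :: "nat + weight"
    using that orbit_ring_mono[OF _ orth_ring, of "{1}"] fold_map_ring orbit_ring_power[of 0]
    by (auto simp: b1_def orbit_ring_power simp del: One_nat_def)
  fix \<phi> assume \<phi>: "\<phi> \<in> orbit_ring short_roots {1}"
  show "in_span short_roots ({0, 1, 2} <+> {(1,0), (1,1), (2,1)}) b1 \<phi>"
  proof (rule triangular_span[OF short_vertices ring _ _ _ \<phi>, where E = "(!) [{}, {0}, {1}, {2}, {3}, {0, 4}]"])
    let ?A = "wt_eval (1, 0)" and ?B = "wt_eval (1, 1)"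
    fix k :: nat assume "k < 6"
    then consider "k = 0" | "k = 1" | "k = 2" | "k = 3" | "k = 4" | "k = 5" by linarith
    then show "\<exists>e c. in_span short_roots ({0, 1, 2} <+> {(1,0), (1,1), (2,1)}) b1 e \<and> c \<noteq> 0 \<and> (\<forall>j<k. \<forall>h. e (short_vertex j) h = 0) \<and>
      (\<forall>h. e (short_vertex k) h = c * (\<Prod>j\<in>[{}, {0}, {1}, {2}, {3}, {0, 4}] ! k. wt_eval (short_vertex k - short_vertex j) h))"
    proof cases
      case 1
      show ?thesis
        unfolding 1
        by (intro exI[of _ "\<lambda>v. 1 * b1 (Inl 0) v"]
            exI[of _ 1] conjI in_span_add in_span_base Sym_intros)
          (simp_all add: b1_eval)
    next
      case 2
      show ?thesis
        unfolding 2
        by (intro exI[of _ "\<lambda>v. (?B + ?A) * b1 (Inl 0) v + (- 1) * b1 (Inr (1, 1)) v"]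
            exI[of _ 1] conjI in_span_add in_span_base Sym_intros)
          (simp_all add: b1_eval)
    next
      case 3
      show ?thesis
        unfolding 3
        by (intro exI[of _ "\<lambda>v. (- ?A) * b1 (Inl 0) v + 1 * b1 (Inr (1, 1)) v + 1 * b1 (Inr (2, 1)) v"]
            exI[of _ 2] conjI in_span_add in_span_base Sym_intros)
          (simp_all add: b1_eval)
    next
      case 4
      show ?thesis
        unfolding 4
        by (intro exI[of _ "\<lambda>v. (- ?B - ?A) * b1 (Inl 0) v + 1 * b1 (Inr (1, 1)) v + 1 * b1 (Inr (1, 0)) v"]
            exI[of _ 2] conjI in_span_add in_span_base Sym_intros)
          (simp_all add: b1_eval)
    next
      case 5
      show ?thesis
        unfolding 5
        by (intro exI[of _ "\<lambda>v. (- 2 * ?B - ?A) * b1 (Inl 0) v + (3) * b1 (Inr (1, 0)) v + 1 * b1 (Inl 1) v"]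
            exI[of _ 6] conjI in_span_add in_span_base Sym_intros)
          (simp_all add: b1_eval)
    next
      case 6
      show ?thesis
        unfolding 6
        by (intro exI[of _ "\<lambda>v. (- 4 * ?B * ?B - 10 * ?A * ?B - 10 * ?A * ?A) * b1 (Inl 0) v + (- 9 * ?B) * b1 (Inr (1, 1)) v + (9 * ?A) * b1 (Inr (1, 0)) v + (- 9 * ?B - 9 * ?A) * b1 (Inr (2, 1)) v + (2 * ?B + 4 * ?A) * b1 (Inl 1) v + (6) * b1 (Inl 2) v"]
            exI[of _ 36] conjI in_span_add in_span_base Sym_intros)
          (simp_all add: b1_eval)
    qed
  qed (auto simp: lessThan_6 short_vertex_def form_def less_Suc_eq numeral_eq_Suc)
next
  fix a :: "nat + weight \<Rightarrow> complex" and j :: "nat + weight"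
  assume eq: "\<And>v. v \<in> short_roots \<Longrightarrow> (\<Sum>j\<in>{0, 1, 2} <+> {(1,0), (1,1), (2,1)}. a j * b1 j v (1, 1)) = 0" and j: "j \<in> {0, 1, 2} <+> {(1,0), (1,1), (2,1)}"
  show "a j = 0"
    using j eq[of "(1,0)"] eq[of "(2,1)"] eq[of "(1,1)"] eq[of "(-1,0)"] eq[of "(-2,-1)"] eq[of "(-1,-1)"]
    by (auto simp: b1_def orth_def fold_map_def refl_simps zero_prod_def sum.Plus short_roots_def wt_eval_pair power_fun_apply complex_eq_iff)
next
  fix u v h and j :: "nat + weight" assume "u \<in> W" "j \<in> {0, 1, 2} <+> {(1,0), (1,1), (2,1)}" "v \<in> short_roots"
  then show "act_Sym u (b1 j v) h = (\<lambda>u. case_sum (\<lambda>j. if j = 1 then \<epsilon>\<^sub>1 u else 1) (\<lambda>_. 1)) u j * b1 ((\<lambda>u. map_sum (\<lambda>j. j) (\<lambda>\<delta>. pos_part (u \<delta>))) u j) (u v) h"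
    by (auto simp: b1_def act_power act_Sym_one orth_act fold_map_act simp del: One_nat_def)
next
  fix u :: weyl and j :: "nat + weight" assume u: "u \<in> W" and j: "j \<in> {0, 1, 2} <+> {(1,0), (1,1), (2,1)}"
  then show "map_sum (\<lambda>j. j) (\<lambda>\<delta>. pos_part (u \<delta>)) j \<in> {0, 1, 2} <+> {(1,0), (1,1), (2,1)}"
    by (auto simp: W_eq W_mats_def pos_part_def pos_roots_def)
  show "case_sum (\<lambda>j. j) (\<lambda>_. 1) (map_sum (\<lambda>j. j) (\<lambda>\<delta>. pos_part (u \<delta>)) j) = case_sum (\<lambda>j. j) (\<lambda>_. 1) j"
    by (cases j) auto
qed auto

text \<open>Without congruences the ring consists of all functions on the hexagon, and
  \<open>W\<close> permutes the indicator functions of its vertices.\<close>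

lemma (in weight_orbit) delta_basis:
  "equivariant_basis V {} V (\<lambda>x v. if v = x then 1 else 0) (\<lambda>_. 0) (\<lambda>u. u) (\<lambda>_ _. 1)"
proof
  show fin: "finite V" unfolding orbit using finite_W by simp
  show "(if v = x then 1 else 0) \<in> Sym_deg 0" for x v :: weight
    by (simp add: Sym_deg_one Sym_deg_zero del: zero_fun_apply one_fun_apply)
  show "(\<lambda>v. if v = x then 1 else 0) \<in> orbit_ring V {}" for x
    by (simp add: orbit_ring_def edge_cond_def Sym_one Sym_zero del: zero_fun_apply one_fun_apply)
  show "in_span V V (\<lambda>x v. if v = x then 1 else 0) \<phi>" if "\<phi> \<in> orbit_ring V {}" for \<phi>
    unfolding in_span_def
  proof (intro exI[of _ \<phi>] conjI ballI)
    fix v assume v: "v \<in> V"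
    have "(\<Sum>j\<in>V. \<phi> j * (if v = j then 1 else 0)) = (\<Sum>j\<in>V. if v = j then \<phi> j else 0)"
      by (intro sum.cong) auto
    then show "\<phi> v = (\<Sum>j\<in>V. \<phi> j * (if v = j then 1 else 0))"
      using fin v by (simp add: sum.delta' del: zero_fun_apply times_fun_apply)
  qed (use that in \<open>simp add: orbit_ring_Sym\<close>)
  show "a x = 0" if eq: "\<And>v. v \<in> V \<Longrightarrow> (\<Sum>j\<in>V. a j * ((if v = j then 1 else 0) :: symt) (1, 1)) = 0" and x: "x \<in> V" for a :: "weight \<Rightarrow> complex" and x
  proof -
    have "(\<Sum>j\<in>V. a j * ((if x = j then 1 else 0) :: symt) (1, 1)) = (\<Sum>j\<in>V. if x = j then a j else 0)"
      by (intro sum.cong) auto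
    then show ?thesis using eq[OF x] fin x by simp
  qed
  show "u x \<in> V" if "u \<in> W" "x \<in> V" for u x
    using that by (rule V_W)
  show "act_Sym u (if v = x then 1 else 0) h = 1 * (if u v = u x then 1 else 0) h" if "u \<in> W" for u x v h
  proof -
    have "u v = u x \<longleftrightarrow> v = x" using W_inv_apply(1)[OF that] by metis
    then show ?thesis by (simp add: act_Sym_def)
  qed
qed auto

section \<open>The Lie algebra of a matrix group\<close>

lemma cscale_component: "cscale c X $ i $ j = c * X $ i $ j"
  by (simp add: cscale_def matrix_matrix_mult_def mat_def if_distrib [of "\<lambda>z. z * _"] cong: if_cong)

interpretation cmat: Vector_Spaces.vector_space cscale
  by unfold_locales (simp_all add: vec_eq_iff cscale_component algebra_simps)

lemma cscale_mult_left: "cscale c X ** Y = cscale c (X ** Y)"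
  and cscale_mult_right: "X ** cscale c Y = cscale c (X ** Y)"
  by (simp_all add: vec_eq_iff cscale_component matrix_matrix_mult_def sum_distrib_left mult_ac)

lemma bilinear_matrix_mult: "bounded_bilinear ((**) :: 'n::finite cmat \<Rightarrow> 'n cmat \<Rightarrow> 'n cmat)"
proof -
  have "bilinear ((**) :: 'n cmat \<Rightarrow> 'n cmat \<Rightarrow> 'n cmat)"
    unfolding bilinear_def
    by (intro conjI allI linearI)
      (simp_all add: vec_eq_iff matrix_matrix_mult_def algebra_simps sum.distrib scaleR_sum_right)
  then show ?thesis
    using bilinear_conv_bounded_bilinear by blast
qed

interpretation mm: bounded_bilinear "(**) :: 'n::finite cmat \<Rightarrow> 'n cmat \<Rightarrow> 'n cmat"
  by (rule bilinear_matrix_mult)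

lemma bracket_add_left: "bracket (X + X') Y = bracket X Y + bracket X' Y"
  and bracket_add_right: "bracket X (Y + Y') = bracket X Y + bracket X Y'"
  by (simp_all add: bracket_def mm.add_left mm.add_right)

lemma bracket_cscale_left: "bracket (cscale c X) Y = cscale c (bracket X Y)"
  and bracket_cscale_right: "bracket X (cscale c Y) = cscale c (bracket X Y)"
  by (simp_all add: bracket_def cscale_mult_left cscale_mult_right cmat.scale_right_diff_distrib)

lemma bracket_zero_right: "bracket X 0 = 0" and bracket_zero_left: "bracket 0 X = 0"
  by (simp_all add: bracket_def mm.zero_left mm.zero_right)

lemma bracket_sum_right: "bracket X (sum f S) = (\<Sum>i\<in>S. bracket X (f i))"
  by (induction S rule: infinite_finite_induct) (simp_all add: bracket_zero_right bracket_add_right)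

lemma bracket_sum_left: "bracket (sum f S) X = (\<Sum>i\<in>S. bracket (f i) X)"
  by (induction S rule: infinite_finite_induct) (simp_all add: bracket_zero_left bracket_add_left)

lemma bracket_Jacobi: "bracket h (bracket X Y) = bracket (bracket h X) Y + bracket X (bracket h Y)"
  by (simp add: bracket_def mm.diff_left mm.diff_right matrix_mul_assoc)

section \<open>Matrix inverses and subgroups of the general linear group\<close>

lemma matrix_inv_right: "invertible A \<Longrightarrow> A ** matrix_inv A = mat 1"
  and matrix_inv_left: "invertible A \<Longrightarrow> matrix_inv A ** A = mat 1"
  for A :: "'n::finite cmat"
proof -
  assume "invertible A"
  then have "\<exists>B. A ** B = mat 1 \<and> B ** A = mat 1" by (simp add: invertible_def)
  then have "A ** matrix_inv A = mat 1 \<and> matrix_inv A ** A = mat 1"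
    unfolding matrix_inv_def by (rule someI_ex)
  then show "A ** matrix_inv A = mat 1" "matrix_inv A ** A = mat 1" by auto
qed

text \<open>For m inverse to c t, m - 1 = m (1 - c t) bounds the distance of m from 1 by a multiple
  of the norm of m times that of 1 - c t; once c t is close to 1, the contribution of m - 1 on the
  right is absorbed.\<close>

lemma matrix_inv_tendsto_one:
  fixes c :: "real \<Rightarrow> 'n::finite cmat"
  assumes inv: "\<And>t. invertible (c t)" and c: "tendsto c (mat 1) F"
  shows "tendsto (\<lambda>t. matrix_inv (c t)) (mat 1) F"
proof -
  obtain K where K: "K \<ge> 0" "\<And>(A :: 'n cmat) (B :: 'n cmat). norm (A ** B) \<le> norm A * norm B * K"
    using bounded_bilinear.nonneg_bounded[OF bilinear_matrix_mult[where 'n = 'n]] by blast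
  let ?I = "mat 1 :: 'n cmat"
  define n where "n t = norm (?I - c t)" for t
  have n: "tendsto n 0 F"
    unfolding n_def using tendsto_norm[OF tendsto_diff[OF tendsto_const[of ?I] c]] by simp
  have "tendsto (\<lambda>t. n t * K) 0 F"
    using tendsto_mult[OF n tendsto_const[of K]] by simp
  then have ev: "\<forall>\<^sub>F t in F. n t * K < 1 / 2"
    by (rule order_tendstoD) simp
  have bound: "norm (matrix_inv (c t) - ?I) \<le> 2 * K * norm ?I * n t" if "n t * K < 1 / 2" for t
  proof -
    define m where "m = matrix_inv (c t)"
    have "m - ?I = m ** (?I - c t)"
      using matrix_inv_left[OF inv[of t]] by (simp add: m_def mm.diff_right)
    then have "norm (m - ?I) \<le> norm m * (n t * K)"
      using K(2)[of m "?I - c t"] by (simp add: n_def mult.assoc)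
    also have "norm m \<le> norm (m - ?I) + norm ?I"
      using norm_triangle_ineq[of "m - ?I" ?I] by simp
    then have "norm m * (n t * K) \<le> (norm (m - ?I) + norm ?I) * (n t * K)"
      using K(1) by (intro mult_right_mono) (auto simp: n_def)
    also have "\<dots> \<le> norm (m - ?I) * (1 / 2) + norm ?I * (n t * K)"
      using mult_left_mono[OF less_imp_le[OF that] norm_ge_zero[of "m - ?I"]] by (simp add: distrib_right)
    finally have "norm (m - ?I) \<le> 2 * (norm ?I * (n t * K))" by simp
    then show ?thesis by (simp add: m_def mult_ac)
  qed
  have "tendsto (\<lambda>t. 2 * K * norm ?I * n t) 0 F"
    using tendsto_mult[OF tendsto_const[of "2 * K * norm ?I"] n] by simp
  then have "tendsto (\<lambda>t. matrix_inv (c t) - ?I) 0 F"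
    by (rule Lim_null_comparison[rotated]) (use ev bound in \<open>auto elim: eventually_mono\<close>)
  then show ?thesis
    by (simp add: LIM_zero_iff)
qed

lemma GLn_simps: "carrier GLn = {A. invertible A}" "x \<otimes>\<^bsub>GLn\<^esub> y = x ** y" "\<one>\<^bsub>GLn\<^esub> = mat 1"
  by (simp_all add: GLn_def)

lemma group_GLn: "Group.group (GLn :: 'n::finite cmat monoid)"
proof (rule groupI)
  fix x :: "'n cmat" assume x: "x \<in> carrier GLn"
  then have "matrix_inv x \<in> carrier GLn" "matrix_inv x ** x = mat 1"
    using matrix_inv_left matrix_inv_right by (auto simp: GLn_simps invertible_def)
  then show "\<exists>y\<in>carrier GLn. y \<otimes>\<^bsub>GLn\<^esub> x = \<one>\<^bsub>GLn\<^esub>" by (auto simp: GLn_simps)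
next
  show "\<one>\<^bsub>GLn\<^esub> \<in> carrier (GLn :: 'n cmat monoid)"
    by (auto simp: GLn_simps invertible_def intro!: exI[of _ "mat 1"])
qed (auto simp: GLn_simps invertible_mult matrix_mul_assoc)

lemma GLn_inv: "invertible x \<Longrightarrow> inv\<^bsub>GLn\<^esub> x = matrix_inv x" for x :: "'n::finite cmat"
  using matrix_inv_left[of x] matrix_inv_right[of x]
  by (intro group.inv_equality[OF group_GLn]) (auto simp: GLn_simps invertible_def)

locale matrix_group =
  fixes H :: "'n::finite cmat set"
  assumes subgroup: "Group.subgroup H GLn"
begin

lemma invertible: "A \<in> H \<Longrightarrow> invertible A"
  using subgroup.subset[OF subgroup] by (auto simp: GLn_simps)

lemma one_mem: "mat 1 \<in> H"
  using subgroup.one_closed[OF subgroup] by (simp add: GLn_simps)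

lemma mult_mem: "A \<in> H \<Longrightarrow> B \<in> H \<Longrightarrow> A ** B \<in> H"
  using subgroup.m_closed[OF subgroup] by (simp add: GLn_simps)

lemma inv_mem: "A \<in> H \<Longrightarrow> matrix_inv A \<in> H"
  using subgroup.m_inv_closed[OF subgroup] GLn_inv[OF invertible] by metis

lemma lie_add:
  assumes "X \<in> lie H" "Y \<in> lie H"
  shows "X + Y \<in> lie H"
proof -
  obtain c d where c: "\<And>r. c r \<in> H" "c 0 = mat 1" "(c has_vector_derivative X) (at 0)"
    and d: "\<And>r. d r \<in> H" "d 0 = mat 1" "(d has_vector_derivative Y) (at 0)"
    using assms unfolding lie_def by blast
  have "((\<lambda>r. c r ** d r) has_vector_derivative (c 0 ** Y + X ** d 0)) (at 0)"
    by (rule mm.has_vector_derivative[OF c(3) d(3)])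
  then have "((\<lambda>r. c r ** d r) has_vector_derivative (X + Y)) (at 0)"
    by (simp add: c d add.commute)
  then show ?thesis
    unfolding lie_def using c d mult_mem by (auto intro!: exI[of _ "\<lambda>r. c r ** d r"])
qed

lemma lie_scaleR:
  assumes "X \<in> lie H"
  shows "a *\<^sub>R X \<in> lie H"
proof -
  obtain c where c: "\<And>r. c r \<in> H" "c 0 = mat 1" "(c has_vector_derivative X) (at 0)"
    using assms unfolding lie_def by blast
  have 1: "((\<lambda>r. a * r) has_vector_derivative a) (at 0)"
    by (auto intro!: derivative_eq_intros simp: has_vector_derivative_def)
  have "(c \<circ> (\<lambda>r. a * r) has_vector_derivative (a *\<^sub>R X)) (at 0)"
    by (rule vector_diff_chain_at[OF 1]) (simp add: c)
  then show ?thesis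
    unfolding lie_def using c by (auto intro!: exI[of _ "c \<circ> (\<lambda>r. a * r)"])
qed

lemma lie_zero: "0 \<in> lie H"
  unfolding lie_def using one_mem by (auto intro!: exI[of _ "\<lambda>_. mat 1"])

lemma subspace_lie: "real_vector.subspace (lie H)"
  by (auto simp: real_vector.subspace_def lie_add lie_scaleR lie_zero)

lemma lie_Ad:
  assumes "g \<in> H" "Y \<in> lie H"
  shows "g ** Y ** matrix_inv g \<in> lie H"
proof -
  obtain c where c: "\<And>r. c r \<in> H" "c 0 = mat 1" "(c has_vector_derivative Y) (at 0)"
    using assms unfolding lie_def by blast
  have "bounded_linear (\<lambda>Z. g ** Z ** matrix_inv g)"
    by (rule bounded_linear_compose[OF mm.bounded_linear_left mm.bounded_linear_right])
  then have "((\<lambda>r. g ** c r ** matrix_inv g) has_vector_derivative (g ** Y ** matrix_inv g)) (at 0)"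
    using c(3) by (rule bounded_linear.has_vector_derivative)
  moreover have "g ** c r ** matrix_inv g \<in> H" for r
    by (intro mult_mem inv_mem assms c)
  moreover have "g ** c 0 ** matrix_inv g = mat 1"
    using matrix_inv_right[OF invertible[OF assms(1)]] by (simp add: c)
  ultimately show ?thesis
    unfolding lie_def by (auto intro!: exI[of _ "\<lambda>r. g ** c r ** matrix_inv g"])
qed

text \<open>The derivative of t \<mapsto> Ad(c t) Y at 0. The curve is differentiable at 0 only, so
  the derivative is computed as a limit: the commutator of the difference quotient of c with Y,
  times the inverse of c t, which tends to 1.\<close>

lemma bracket_limit:
  assumes "\<And>r. c r \<in> H" "c 0 = mat 1" and der: "(c has_vector_derivative X) (at 0)"
  shows "tendsto (\<lambda>t. (1 / t) *\<^sub>R (c t ** Y ** matrix_inv (c t) - Y)) (bracket X Y) (at 0)"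
proof -
  have q: "tendsto (\<lambda>t. (1 / t) *\<^sub>R (c t - mat 1)) X (at 0)"
  proof -
    have "tendsto (\<lambda>t. norm (c t - mat 1 - t *\<^sub>R X) / norm t) 0 (at 0)"
      using der assms(2) by (simp add: has_vector_derivative_def has_derivative_at)
    moreover have "\<forall>\<^sub>F t in at 0. norm (c t - mat 1 - t *\<^sub>R X) / norm t = norm ((1 / t) *\<^sub>R (c t - mat 1) - X)"
    proof (unfold eventually_at, intro exI[of _ 1] conjI ballI impI)
      fix t :: real assume "t \<noteq> 0 \<and> dist t 0 < 1"
      then have t: "t \<noteq> 0" by simp
      have "(1 / t) *\<^sub>R (c t - mat 1) - X = (1 / t) *\<^sub>R (c t - mat 1 - t *\<^sub>R X)"
        using t by (simp add: scaleR_right_diff_distrib)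
      then show "norm (c t - mat 1 - t *\<^sub>R X) / norm t = norm ((1 / t) *\<^sub>R (c t - mat 1) - X)"
        by simp
    qed simp
    ultimately have "tendsto (\<lambda>t. norm ((1 / t) *\<^sub>R (c t - mat 1) - X)) 0 (at 0)"
      by (rule Lim_transform_eventually)
    then show ?thesis
      by (rule LIM_zero_cancel[OF tendsto_norm_zero_cancel])
  qed
  have inv: "tendsto (\<lambda>t. matrix_inv (c t)) (mat 1) (at 0)"
  proof (rule matrix_inv_tendsto_one)
    show "invertible (c t)" for t using invertible assms(1) .
    have "isCont c 0" by (rule has_vector_derivative_continuous[OF der])
    then show "tendsto c (mat 1) (at 0)" using assms(2) by (simp add: isCont_def)
  qed
  have "(c t ** Y ** matrix_inv (c t) - Y) =
      ((c t - mat 1) ** Y - Y ** (c t - mat 1)) ** matrix_inv (c t)" for t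
    using matrix_inv_right[OF invertible[OF assms(1)[of t]]]
    by (simp add: mm.diff_left mm.diff_right flip: matrix_mul_assoc)
  then have "(\<lambda>t. (1 / t) *\<^sub>R (c t ** Y ** matrix_inv (c t) - Y)) =
      (\<lambda>t. (((1 / t) *\<^sub>R (c t - mat 1)) ** Y - Y ** ((1 / t) *\<^sub>R (c t - mat 1))) ** matrix_inv (c t))"
    by (simp add: fun_eq_iff mm.scaleR_left mm.scaleR_right flip: scaleR_diff_right)
  moreover have "\<dots> \<midarrow>0\<rightarrow> (X ** Y - Y ** X) ** mat 1"
    by (intro mm.tendsto tendsto_diff tendsto_const q inv)
  ultimately show ?thesis by (simp add: bracket_def)
qed

text \<open>The difference quotients of Ad(c t) Y lie in \<open>lie H\<close>, a real subspace of
  finite dimension and therefore closed.\<close>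

lemma lie_bracket:
  assumes "X \<in> lie H" "Y \<in> lie H"
  shows "bracket X Y \<in> lie H"
proof -
  obtain c where c: "\<And>r. c r \<in> H" "c 0 = mat 1" "(c has_vector_derivative X) (at 0)"
    using assms unfolding lie_def by blast
  have "closed (lie H)" by (rule closed_subspace[OF subspace_lie])
  then show ?thesis
  proof (rule Lim_in_closed_set[OF _ _ _ bracket_limit[OF c]])
    have "(1 / t) *\<^sub>R (c t ** Y ** matrix_inv (c t) - Y) \<in> lie H" for t
      by (intro lie_scaleR real_vector.subspace_diff[OF subspace_lie] lie_Ad c assms)
    then show "\<forall>\<^sub>F t in at 0. (1 / t) *\<^sub>R (c t ** Y ** matrix_inv (c t) - Y) \<in> lie H" by simp
  qed simp
qed

text \<open>Conjugation by elements of H fixes Y, so the difference quotients whose limit is the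
  bracket are 0.\<close>

lemma lie_abelian:
  assumes comm: "\<And>A B. A \<in> H \<Longrightarrow> B \<in> H \<Longrightarrow> A ** B = B ** A" and "X \<in> lie H" "Y \<in> lie H"
  shows "bracket X Y = 0"
proof -
  obtain c where c: "\<And>r. c r \<in> H" "c 0 = mat 1" "(c has_vector_derivative X) (at 0)"
    using assms unfolding lie_def by blast
  have "A ** Y ** matrix_inv A = Y" if A: "A \<in> H" for A
  proof -
    obtain d where d: "\<And>r. d r \<in> H" "d 0 = mat 1" "(d has_vector_derivative Y) (at 0)"
      using assms unfolding lie_def by blast
    have "((\<lambda>r. A ** d r) has_vector_derivative (A ** Y)) (at 0)"
      by (rule bounded_linear.has_vector_derivative[OF mm.bounded_linear_right d(3)])
    moreover have "((\<lambda>r. d r ** A) has_vector_derivative (Y ** A)) (at 0)"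
      by (rule bounded_linear.has_vector_derivative[OF mm.bounded_linear_left d(3)])
    moreover have "(\<lambda>r. A ** d r) = (\<lambda>r. d r ** A)" using comm A d(1) by auto
    ultimately have "A ** Y = Y ** A" using vector_derivative_unique_at by metis
    then show ?thesis
      using matrix_inv_right[OF invertible[OF A]] by (simp flip: matrix_mul_assoc)
  qed
  then have "(\<lambda>t. (1 / t) *\<^sub>R (c t ** Y ** matrix_inv (c t) - Y)) = (\<lambda>t. 0)"
    using c(1) by simp
  then have "tendsto (\<lambda>t. 0) (bracket X Y) (at (0::real))"
    using bracket_limit[OF c, of Y] by simp
  then show ?thesis using tendsto_unique[OF _ tendsto_const, of "at (0::real)"] by (metis trivial_limit_at)
qed

end

lemma connected_linear_group_matrix_group: "connected_linear_group H \<Longrightarrow> matrix_group H"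
  by (simp add: connected_linear_group_def matrix_group_def)

lemma torus_commute:
  fixes T :: "'n::finite cmat set"
  assumes T: "torus T" and A: "A \<in> T" "B \<in> T"
  shows "A ** B = B ** A"
proof -
  obtain P :: "'n cmat" where P: "invertible P" "\<And>A. A \<in> T \<Longrightarrow> diagonal_mat (matrix_inv P ** A ** P)"
    using T unfolding torus_def by blast
  let ?D = "\<lambda>A. matrix_inv P ** A ** P"
  have comm: "D ** E = E ** D" if "diagonal_mat D" "diagonal_mat E" for D :: "'n cmat" and E :: "'n cmat"
  proof -
    have "(D ** E) $ i $ j = (E ** D) $ i $ j" for i j
    proof -
      have D: "D $ i $ k = 0" if "k \<noteq> i" for k using \<open>diagonal_mat D\<close> that by (auto simp: diagonal_mat_def)
      have E: "E $ i $ k = 0" if "k \<noteq> i" for k using \<open>diagonal_mat E\<close> that by (auto simp: diagonal_mat_def)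
      have "(\<Sum>k\<in>UNIV. D $ i $ k * E $ k $ j) = D $ i $ i * E $ i $ j"
        by (rule trans[OF sum.remove[of _ i]]) (auto simp: D intro!: sum.neutral)
      moreover have "(\<Sum>k\<in>UNIV. E $ i $ k * D $ k $ j) = E $ i $ i * D $ i $ j"
        by (rule trans[OF sum.remove[of _ i]]) (auto simp: E intro!: sum.neutral)
      moreover have "D $ i $ i * E $ i $ j = E $ i $ i * D $ i $ j"
        using D E by (cases "i = j") auto
      ultimately show ?thesis by (simp add: matrix_matrix_mult_def)
    qed
    then show ?thesis by (simp add: vec_eq_iff)
  qed
  have conj_back: "P ** ?D A ** matrix_inv P = A" for A :: "'n cmat"
    using matrix_inv_right[OF P(1)] by (simp add: matrix_mul_assoc) (simp flip: matrix_mul_assoc)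
  have mult: "?D A ** ?D B = ?D (A ** B)" for A :: "'n cmat" and B :: "'n cmat"
  proof -
    have "?D A ** ?D B = matrix_inv P ** A ** (P ** matrix_inv P) ** B ** P"
      by (simp only: matrix_mul_assoc)
    then show ?thesis by (simp add: matrix_inv_right[OF P(1)] matrix_mul_assoc)
  qed
  have "?D (A ** B) = ?D (B ** A)"
    using comm[OF P(2)[OF A(1)] P(2)[OF A(2)]] by (simp only: mult)
  then show ?thesis using conj_back by metis
qed

section \<open>Hessenberg ideals\<close>

text \<open>Applying h and subtracting the eigenvalue of one summand removes that summand and
  multiplies the others by nonzero differences. For I = {0} this is the independence of eigenvectors
  with distinct eigenvalues.\<close>

lemma eigen_components:
  assumes I: "cmat.subspace I" and h: "\<And>Y. Y \<in> I \<Longrightarrow> bracket h Y \<in> I"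
    and S: "finite S" "inj_on a S" and X: "\<And>i. i \<in> S \<Longrightarrow> bracket h (X i) = cscale (a i) (X i)"
    and sum: "sum X S \<in> I" and i: "i \<in> S"
  shows "X i \<in> I"
  using S X sum i
proof (induction S arbitrary: X i rule: finite_induct)
  case (insert s S)
  let ?Y = "\<lambda>i. cscale (a i - a s) (X i)"
  have "bracket h (X s + sum X S) - cscale (a s) (X s + sum X S) = sum ?Y S"
    using insert.prems(2)
    by (simp add: bracket_add_right bracket_sum_right cmat.scale_right_distrib cmat.scale_sum_right
        cmat.scale_left_diff_distrib sum_subtractf)
  moreover have "bracket h (X s + sum X S) - cscale (a s) (X s + sum X S) \<in> I"
    using insert.prems(3) insert.hyps by (intro cmat.subspace_diff[OF I] h cmat.subspace_scale[OF I]) simp_all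
  ultimately have sumY: "sum ?Y S \<in> I" by simp
  have XS: "X j \<in> I" if j: "j \<in> S" for j
  proof -
    have "?Y j \<in> I"
      by (rule insert.IH[OF _ _ sumY j]) (use insert.prems in \<open>auto simp: bracket_cscale_right cmat.scale_left_commute\<close>)
    then have "cscale (1 / (a j - a s)) (?Y j) \<in> I" by (rule cmat.subspace_scale[OF I])
    moreover have "a j \<noteq> a s" using insert.prems(1) insert.hyps j by (auto simp: inj_on_def)
    ultimately show ?thesis by simp
  qed
  then have "sum X S \<in> I" by (rule cmat.subspace_sum[OF I])
  then have "X s \<in> I"
    using cmat.subspace_diff[OF I insert.prems(3), of "sum X S"] insert.hyps by simp
  then show ?case using XS insert.prems(4) by blast
qed simp

text \<open>Phrased through sums that are roots, because these are what brackets with b produce;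
  \<open>upward_closed_iff\<close> lists the sets that satisfy it.\<close>

definition upward_closed :: "weight set \<Rightarrow> bool" where
  "upward_closed \<Phi> \<longleftrightarrow> \<Phi> \<subseteq> pos_roots \<and> (\<forall>\<gamma>\<in>\<Phi>. \<forall>\<delta>\<in>pos_roots. \<delta> + \<gamma> \<in> roots \<longrightarrow> \<delta> + \<gamma> \<in> \<Phi>)"

section \<open>The root decomposition\<close>

locale type_G2_group =
  fixes \<G> :: "'n::finite g2"
  assumes type_G2: "type_G2 \<G>"
begin

abbreviation "g \<equiv> lie (gp \<G>)"
abbreviation "t \<equiv> lie (tor \<G>)"
abbreviation "rs \<equiv> root_space \<G>"

lemma decomposition:
  "g = t + root_sum \<G> roots" "lie (bor \<G>) = t + root_sum \<G> pos_roots"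
  using type_G2 by (simp_all add: type_G2_def)

sublocale G: matrix_group "gp \<G>"
  using type_G2 by (intro connected_linear_group_matrix_group) (simp add: type_G2_def)

lemma torus: "torus (tor \<G>)"
  using type_G2 by (simp add: type_G2_def maximal_torus_def)

sublocale T: matrix_group "tor \<G>"
  using torus by (intro connected_linear_group_matrix_group) (simp add: torus_def)

lemma t_abelian: "h \<in> t \<Longrightarrow> k \<in> t \<Longrightarrow> bracket h k = 0"
  using torus_commute[OF torus] by (rule T.lie_abelian)

lemma rs_line: "\<gamma> \<in> roots \<Longrightarrow> \<exists>e. e \<noteq> 0 \<and> rs \<gamma> = range (\<lambda>c. cscale c e)"
  using type_G2 unfolding type_G2_def by blast

lemma subspace_rs: "\<gamma> \<in> roots \<Longrightarrow> cmat.subspace (rs \<gamma>)"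
proof -
  assume "\<gamma> \<in> roots"
  then obtain e where e: "rs \<gamma> = range (\<lambda>c. cscale c e)" using rs_line by blast
  show ?thesis
    unfolding e
  proof (rule cmat.subspaceI)
    have "0 = cscale 0 e" by simp
    then show "0 \<in> range (\<lambda>c. cscale c e)" by blast
    fix x y assume "x \<in> range (\<lambda>c. cscale c e)" "y \<in> range (\<lambda>c. cscale c e)"
    then obtain a b where "x = cscale a e" "y = cscale b e" by blast
    then have "x + y = cscale (a + b) e" by (simp add: cmat.scale_left_distrib)
    then show "x + y \<in> range (\<lambda>c. cscale c e)" by blast
  next
    fix c x assume "x \<in> range (\<lambda>c. cscale c e)"
    then obtain a where "x = cscale a e" by blast
    then have "cscale c x = cscale (c * a) e" by simp
    then show "cscale c x \<in> range (\<lambda>c. cscale c e)" by blast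
  qed
qed

lemma rs_subset:
  assumes "\<gamma> \<in> roots" "cmat.subspace I" "X \<in> rs \<gamma>" "X \<in> I" "X \<noteq> 0"
  shows "rs \<gamma> \<subseteq> I"
proof
  fix Y assume "Y \<in> rs \<gamma>"
  obtain e where e: "rs \<gamma> = range (\<lambda>c. cscale c e)" using rs_line[OF assms(1)] by blast
  then obtain a b where ab: "X = cscale a e" "Y = cscale b e" using assms(3) \<open>Y \<in> rs \<gamma>\<close> by blast
  then have "Y = cscale (b / a) X" using assms(5) by auto
  then show "Y \<in> I" using cmat.subspace_scale[OF assms(2,4)] by simp
qed

text \<open>The value \<open>10\<close> is large enough for \<open>h0\<close> to separate \<open>0\<close>, all roots and all sums of two positive roots.\<close>

definition h0 :: "'n cmat" where "h0 = (SOME h. h \<in> t \<and> coords \<G> h = (1, 10))"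

lemma h0: "h0 \<in> t" "coords \<G> h0 = (1, 10)"
proof -
  have "bij_betw (coords \<G>) t UNIV" using type_G2 by (simp add: type_G2_def)
  then have "\<exists>h. h \<in> t \<and> coords \<G> h = (1, 10)" by (metis UNIV_I bij_betw_iff_bijections)
  from someI_ex[OF this] show "h0 \<in> t" "coords \<G> h0 = (1, 10)" by (simp_all add: h0_def)
qed

definition val :: "weight \<Rightarrow> complex" where "val \<mu> = of_int (fst \<mu> + 10 * snd \<mu>)"

text \<open>m + 10 n determines the pair (m, n) as long as the possible values of m lie less than 10
  apart.\<close>

lemma val_inj: "\<bar>fst \<mu> - fst \<nu>\<bar> < 10 \<Longrightarrow> val \<mu> = val \<nu> \<Longrightarrow> \<mu> = \<nu>"
  unfolding val_def of_int_eq_iff by (cases \<mu>, cases \<nu>) (simp; presburger)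

lemma roots_fst: "\<gamma> \<in> roots \<Longrightarrow> \<bar>fst \<gamma>\<bar> \<le> 3"
  by (auto simp: roots_eq)

lemma rs_h0: "X \<in> rs \<gamma> \<Longrightarrow> bracket h0 X = cscale (val \<gamma>) X"
  using h0 by (auto simp: root_space_def val_def wt_eval_def case_prod_unfold mult.commute)

lemma finite_roots: "finite roots" by (simp add: roots_eq)

text \<open>Elements of t and of root spaces are eigenvectors of \<open>h0\<close>. First
  coordinates run from -3 to 3 for roots and up to 6 for sums of two positive roots, so they differ
  by at most 9 and \<open>val\<close> separates them. The weight \<mu> may lie outside the root
  system; then its weight space in g is 0.\<close>

lemma independent:
  assumes "S \<subseteq> roots" "\<mu> \<notin> S" "\<mu> \<noteq> 0" and fst: "- 3 \<le> fst \<mu>" "fst \<mu> \<le> 6" and Z: "Z \<in> rs \<mu>"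
    and h: "h \<in> t" and X: "\<And>\<gamma>. \<gamma> \<in> S \<Longrightarrow> X \<gamma> \<in> rs \<gamma>" and eq: "Z = h + (\<Sum>\<gamma>\<in>S. X \<gamma>)"
  shows "Z = 0"
proof -
  \<comment> \<open>A family of eigenvectors with sum 0: h at index 0, -Z at \<mu>, and X on the
    roots in S.\<close>
  define Y where "Y \<gamma> = (if \<gamma> = 0 then h else if \<gamma> = \<mu> then cscale (- 1) Z else X \<gamma>)" for \<gamma>
  have S: "finite S" "0 \<notin> S" using assms(1) finite_roots finite_subset zero_notin_roots by auto
  have sumX: "(\<Sum>\<gamma>\<in>S. Y \<gamma>) = (\<Sum>\<gamma>\<in>S. X \<gamma>)"
    using S assms(2) by (intro sum.cong) (auto simp: Y_def)
  have "Y \<mu> \<in> {0}"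
  proof (rule eigen_components[where h = h0 and S = "insert 0 (insert \<mu> S)" and a = val])
    show "sum Y (insert 0 (insert \<mu> S)) \<in> {0}"
      using S assms(2,3) sumX eq by (simp add: Y_def cmat.scale_minus_left del: zero_prod_def)
    have bound: "- 3 \<le> fst x \<and> fst x \<le> 6" if "x \<in> insert 0 (insert \<mu> S)" for x
      using that roots_fst[of x] assms(1) fst by auto
    show "inj_on val (insert 0 (insert \<mu> S))"
    proof (rule inj_onI)
      fix x y assume "x \<in> insert 0 (insert \<mu> S)" "y \<in> insert 0 (insert \<mu> S)" and eq: "val x = val y"
      then have "\<bar>fst x - fst y\<bar> < 10" using bound[of x] bound[of y] by linarith
      then show "x = y" using eq by (rule val_inj)
    qed
    fix \<gamma> assume "\<gamma> \<in> insert 0 (insert \<mu> S)"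
    then consider "\<gamma> = 0" | "\<gamma> = \<mu>" "\<gamma> \<noteq> 0" | "\<gamma> \<in> S" "\<gamma> \<noteq> 0" "\<gamma> \<noteq> \<mu>" by blast
    then show "bracket h0 (Y \<gamma>) = cscale (val \<gamma>) (Y \<gamma>)"
    proof cases
      case 1
      then show ?thesis using t_abelian[OF h0(1) h] by (simp add: Y_def val_def)
    next
      case 2
      then have "Y \<gamma> = cscale (- 1) Z" by (simp only: Y_def if_False if_True simp_thms)
      then show ?thesis
        unfolding 2 by (simp only: bracket_cscale_right rs_h0[OF Z] cmat.scale_left_commute)
    next
      case 3
      then show ?thesis using rs_h0[OF X[OF 3(1)]] by (simp add: Y_def)
    qed
  qed (use S in \<open>auto simp: bracket_zero_right cmat.subspace_def\<close>)
  then have "cscale (- 1) Z = 0" using assms(3) by (simp add: Y_def)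
  then show ?thesis by simp
qed

lemma root_sumI: "(\<And>\<gamma>. \<gamma> \<in> S \<Longrightarrow> X \<gamma> \<in> rs \<gamma>) \<Longrightarrow> (\<Sum>\<gamma>\<in>S. X \<gamma>) \<in> root_sum \<G> S"
  by (auto simp: root_sum_def)

lemma root_sumE:
  assumes "Y \<in> root_sum \<G> S"
  obtains X where "\<And>\<gamma>. \<gamma> \<in> S \<Longrightarrow> X \<gamma> \<in> rs \<gamma>" "Y = (\<Sum>\<gamma>\<in>S. X \<gamma>)"
  using assms by (auto simp: root_sum_def)

lemma subspace_root_sum:
  assumes "S \<subseteq> roots"
  shows "cmat.subspace (root_sum \<G> S)"
proof (rule cmat.subspaceI)
  have rs: "\<gamma> \<in> S \<Longrightarrow> cmat.subspace (rs \<gamma>)" for \<gamma> using assms subspace_rs by blast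
  show "0 \<in> root_sum \<G> S"
    using root_sumI[of S "\<lambda>_. 0"] cmat.subspace_0[OF rs] by simp
  fix x y assume "x \<in> root_sum \<G> S" "y \<in> root_sum \<G> S"
  then obtain X Y where XY: "\<And>\<gamma>. \<gamma> \<in> S \<Longrightarrow> X \<gamma> \<in> rs \<gamma>" "x = (\<Sum>\<gamma>\<in>S. X \<gamma>)"
    "\<And>\<gamma>. \<gamma> \<in> S \<Longrightarrow> Y \<gamma> \<in> rs \<gamma>" "y = (\<Sum>\<gamma>\<in>S. Y \<gamma>)"
    by (elim root_sumE) blast
  then have "(\<Sum>\<gamma>\<in>S. X \<gamma> + Y \<gamma>) \<in> root_sum \<G> S"
    by (intro root_sumI cmat.subspace_add[OF rs])
  then show "x + y \<in> root_sum \<G> S" by (simp add: XY sum.distrib)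
next
  have rs: "\<gamma> \<in> S \<Longrightarrow> cmat.subspace (rs \<gamma>)" for \<gamma> using assms subspace_rs by blast
  fix c x assume "x \<in> root_sum \<G> S"
  then obtain X where X: "\<And>\<gamma>. \<gamma> \<in> S \<Longrightarrow> X \<gamma> \<in> rs \<gamma>" "x = (\<Sum>\<gamma>\<in>S. X \<gamma>)"
    by (elim root_sumE) blast
  then have "(\<Sum>\<gamma>\<in>S. cscale c (X \<gamma>)) \<in> root_sum \<G> S"
    by (intro root_sumI cmat.subspace_scale[OF rs])
  then show "cscale c x \<in> root_sum \<G> S" by (simp add: X cmat.scale_sum_right)
qed

lemma rs_subset_root_sum:
  assumes "S \<subseteq> roots" "\<gamma> \<in> S"
  shows "rs \<gamma> \<subseteq> root_sum \<G> S"
proof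
  fix X assume X: "X \<in> rs \<gamma>"
  have "(\<Sum>\<delta>\<in>S. if \<delta> = \<gamma> then X else 0) \<in> root_sum \<G> S"
    using X cmat.subspace_0[OF subspace_rs] assms by (intro root_sumI) auto
  moreover have "finite S" using assms(1) finite_roots finite_subset by blast
  ultimately show "X \<in> root_sum \<G> S" using assms(2) by simp
qed

lemma root_sum_least:
  assumes "cmat.subspace I" "\<And>\<gamma>. \<gamma> \<in> S \<Longrightarrow> rs \<gamma> \<subseteq> I"
  shows "root_sum \<G> S \<subseteq> I"
  using assms by (auto elim!: root_sumE intro!: cmat.subspace_sum)

lemma root_sum_subset_t_plus: "root_sum \<G> S \<subseteq> t + root_sum \<G> S"
proof
  fix x assume "x \<in> root_sum \<G> S"
  then have "0 + x \<in> t + root_sum \<G> S" by (rule set_plus_intro[OF T.lie_zero])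
  then show "x \<in> t + root_sum \<G> S" by simp
qed

lemma rs_subset_t_plus_iff:
  assumes "S \<subseteq> roots" "\<gamma> \<in> roots"
  shows "rs \<gamma> \<subseteq> t + root_sum \<G> S \<longleftrightarrow> \<gamma> \<in> S"
proof
  assume *: "rs \<gamma> \<subseteq> t + root_sum \<G> S"
  obtain e where e: "e \<noteq> 0" "rs \<gamma> = range (\<lambda>c. cscale c e)" using rs_line[OF assms(2)] by blast
  have "cscale 1 e \<in> rs \<gamma>" unfolding e(2) by blast
  then have e': "e \<in> rs \<gamma>" by simp
  then obtain h Y where hY: "h \<in> t" "Y \<in> root_sum \<G> S" "e = h + Y"
    using * by (blast elim: set_plus_elim)
  then obtain X where X: "\<And>\<gamma>. \<gamma> \<in> S \<Longrightarrow> X \<gamma> \<in> rs \<gamma>" "Y = (\<Sum>\<gamma>\<in>S. X \<gamma>)" by (elim root_sumE) blast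
  show "\<gamma> \<in> S"
  proof (rule ccontr)
    assume "\<gamma> \<notin> S"
    moreover have "\<gamma> \<noteq> 0" using assms(2) zero_notin_roots by blast
    ultimately have "e = 0"
      using independent[OF assms(1) _ _ _ _ e' hY(1) X(1)] hY(3) X(2) roots_fst[OF assms(2)] by (simp add: abs_le_iff)
    then show False using e(1) by simp
  qed
next
  assume "\<gamma> \<in> S"
  then have "rs \<gamma> \<subseteq> root_sum \<G> S" by (rule rs_subset_root_sum[OF assms(1)])
  then show "rs \<gamma> \<subseteq> t + root_sum \<G> S"
    using root_sum_subset_t_plus by blast
qed

lemma rs_subset_iff:
  assumes "S \<subseteq> roots" "\<gamma> \<in> roots"
  shows "rs \<gamma> \<subseteq> root_sum \<G> S \<longleftrightarrow> \<gamma> \<in> S"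
proof
  assume *: "rs \<gamma> \<subseteq> root_sum \<G> S"
  then have "rs \<gamma> \<subseteq> t + root_sum \<G> S" using root_sum_subset_t_plus by (rule order_trans)
  then show "\<gamma> \<in> S" by (simp only: rs_subset_t_plus_iff[OF assms])
qed (rule rs_subset_root_sum[OF assms(1)])

lemma root_set_root_sum: "S \<subseteq> roots \<Longrightarrow> root_set \<G> (root_sum \<G> S) = S"
  unfolding root_set_def using rs_subset_iff[of S] by blast

lemma root_set_dual:
  assumes "S \<subseteq> roots"
  shows "root_set \<G> (dual_subspace \<G> (root_sum \<G> S)) = roots - uminus ` S"
  unfolding dual_subspace_def root_set_root_sum[OF assms]
  unfolding root_set_def using rs_subset_t_plus_iff[of "roots - uminus ` S"] by blast

section \<open>Brackets of root spaces and stable subspaces of the nilradical\<close>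

lemma bracket_rs:
  assumes "X \<in> rs \<gamma>" "Y \<in> rs \<delta>"
  shows "bracket X Y \<in> rs (\<gamma> + \<delta>)"
  using assms G.lie_bracket[of X Y]
  by (auto simp: root_space_def bracket_Jacobi bracket_cscale_left bracket_cscale_right wt_eval_add cmat.scale_left_distrib)

text \<open>The bracket has weight \<gamma> + \<delta>, which is neither 0 nor a root, whereas g is
  the sum of t and the root spaces.\<close>

lemma bracket_rs_zero:
  assumes X: "X \<in> rs \<gamma>" "Y \<in> rs \<delta>" and pos: "\<gamma> \<in> pos_roots" "\<delta> \<in> pos_roots" and "\<gamma> + \<delta> \<notin> roots"
  shows "bracket X Y = 0"
proof -
  have Z: "bracket X Y \<in> rs (\<gamma> + \<delta>)" by (rule bracket_rs[OF X])
  then have "bracket X Y \<in> t + root_sum \<G> roots"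
    using decomposition by (simp add: root_space_def)
  then obtain h W where h: "h \<in> t" "W \<in> root_sum \<G> roots" "bracket X Y = h + W"
    by (elim set_plus_elim)
  obtain F where F: "\<And>\<gamma>. \<gamma> \<in> roots \<Longrightarrow> F \<gamma> \<in> rs \<gamma>" "W = (\<Sum>\<gamma>\<in>roots. F \<gamma>)"
    using h(2) by (elim root_sumE) blast
  have "\<gamma> + \<delta> \<noteq> 0" "- 3 \<le> fst (\<gamma> + \<delta>)" "fst (\<gamma> + \<delta>) \<le> 6"
    using pos by (auto simp: pos_roots_def zero_prod_def)
  then show ?thesis
    using h F by (intro independent[OF subset_refl assms(5) _ _ _ Z h(1) F(1)]) simp_all
qed

lemma hessenberg_ideal_root_sum:
  assumes "upward_closed \<Phi>"
  shows "hessenberg_ideal \<G> (root_sum \<G> \<Phi>)"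
proof -
  have \<Phi>: "\<Phi> \<subseteq> pos_roots" "\<Phi> \<subseteq> roots" "pos_roots \<subseteq> roots"
    using assms pos_roots_subset by (auto simp: upward_closed_def)
  have sub: "cmat.subspace (root_sum \<G> \<Phi>)" by (rule subspace_root_sum[OF \<Phi>(2)])
  have b: "bracket X Y \<in> root_sum \<G> \<Phi>" if "X \<in> rs \<delta>" "\<delta> \<in> pos_roots" "Y \<in> rs \<gamma>" "\<gamma> \<in> \<Phi>" for X Y \<delta> \<gamma>
  proof (cases "\<delta> + \<gamma> \<in> roots")
    case True
    then have "\<delta> + \<gamma> \<in> \<Phi>" using assms that by (simp add: upward_closed_def)
    then show ?thesis using bracket_rs[OF that(1,3)] rs_subset_root_sum[OF \<Phi>(2)] by blast
  next
    case False
    then have "bracket X Y = 0" using bracket_rs_zero[OF that(1,3,2)] that(4) \<Phi> by blast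
    then show ?thesis using cmat.subspace_0[OF sub] by simp
  qed
  have "bracket X Y \<in> root_sum \<G> \<Phi>" if X: "X \<in> lie (bor \<G>)" and Y: "Y \<in> root_sum \<G> \<Phi>" for X Y
  proof -
    obtain h X' where h: "h \<in> t" "X' \<in> root_sum \<G> pos_roots" "X = h + X'"
      using X unfolding decomposition by (elim set_plus_elim)
    obtain E where E: "\<And>\<delta>. \<delta> \<in> pos_roots \<Longrightarrow> E \<delta> \<in> rs \<delta>" "X' = (\<Sum>\<delta>\<in>pos_roots. E \<delta>)"
      using h(2) by (elim root_sumE) blast
    obtain F where F: "\<And>\<gamma>. \<gamma> \<in> \<Phi> \<Longrightarrow> F \<gamma> \<in> rs \<gamma>" "Y = (\<Sum>\<gamma>\<in>\<Phi>. F \<gamma>)"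
      using Y by (elim root_sumE) blast
    have "bracket h (F \<gamma>) \<in> root_sum \<G> \<Phi>" if "\<gamma> \<in> \<Phi>" for \<gamma>
    proof -
      have "bracket h (F \<gamma>) = cscale (wt_eval \<gamma> (coords \<G> h)) (F \<gamma>)"
        using F(1)[OF that] h(1) by (simp add: root_space_def)
      then show ?thesis
        using F(1)[OF that] rs_subset_root_sum[OF \<Phi>(2) that] cmat.subspace_scale[OF sub] by auto
    qed
    then have "(\<Sum>\<gamma>\<in>\<Phi>. bracket h (F \<gamma>)) + (\<Sum>\<gamma>\<in>\<Phi>. \<Sum>\<delta>\<in>pos_roots. bracket (E \<delta>) (F \<gamma>)) \<in> root_sum \<G> \<Phi>"
      by (intro cmat.subspace_add[OF sub] cmat.subspace_sum[OF sub]) (blast intro: b[OF E(1) _ F(1)])+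
    moreover have "bracket X Y = (\<Sum>\<gamma>\<in>\<Phi>. bracket h (F \<gamma>)) + (\<Sum>\<gamma>\<in>\<Phi>. \<Sum>\<delta>\<in>pos_roots. bracket (E \<delta>) (F \<gamma>))"
      unfolding h(3) E(2) F(2) bracket_sum_right bracket_add_left bracket_sum_left sum.distrib ..
    ultimately show ?thesis by simp
  qed
  moreover have "root_sum \<G> \<Phi> \<subseteq> nilrad \<G>"
    unfolding nilrad_def
    by (rule root_sum_least[OF subspace_root_sum[OF \<Phi>(3)]]) (use \<Phi> rs_subset_root_sum[OF \<Phi>(3)] in blast)
  ultimately show ?thesis
    using sub by (simp add: hessenberg_ideal_def)
qed

lemma hessenberg_ideal_eq_root_sum:
  assumes I: "hessenberg_ideal \<G> I"
  shows "\<exists>\<Phi>. upward_closed \<Phi> \<and> I = root_sum \<G> \<Phi>"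
proof (intro exI conjI)
  define \<Phi> where "\<Phi> = {\<gamma> \<in> pos_roots. rs \<gamma> \<subseteq> I}"
  have sub: "cmat.subspace I" and nil: "I \<subseteq> root_sum \<G> pos_roots"
    and ad: "\<And>X Y. X \<in> lie (bor \<G>) \<Longrightarrow> Y \<in> I \<Longrightarrow> bracket X Y \<in> I"
    using I by (simp_all add: hessenberg_ideal_def nilrad_def)
  have pos: "pos_roots \<subseteq> roots" using pos_roots_subset by blast
  have zero: "0 \<in> root_sum \<G> pos_roots" by (rule cmat.subspace_0[OF subspace_root_sum[OF pos]])
  have h0_bor: "h0 \<in> lie (bor \<G>)"
    unfolding decomposition using set_plus_intro[OF h0(1) zero] by simp
  have rs_bor: "rs \<delta> \<subseteq> lie (bor \<G>)" if "\<delta> \<in> pos_roots" for \<delta>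
    unfolding decomposition using rs_subset_t_plus_iff[OF pos] that pos by blast
  show "upward_closed \<Phi>"
    unfolding upward_closed_def
  proof (intro conjI ballI impI)
    fix \<gamma> \<delta> assume \<gamma>: "\<gamma> \<in> \<Phi>" and \<delta>: "\<delta> \<in> pos_roots" and r: "\<delta> + \<gamma> \<in> roots"
    have "\<gamma> \<in> roots" "\<delta> \<in> roots" using \<gamma> \<delta> pos by (auto simp: \<Phi>_def)
    \<comment> \<open>The non-vanishing brackets are part of \<open>type_G2\<close>. Root spaces are
      lines, so one nonzero bracket in I brings in the whole root space of \<delta> +
      \<gamma>.\<close>
    then obtain X Y where XY: "X \<in> rs \<delta>" "Y \<in> rs \<gamma>" "bracket X Y \<noteq> 0"
      using type_G2 r unfolding type_G2_def by blast
    have "bracket X Y \<in> I" using ad rs_bor[OF \<delta>] XY \<gamma> by (auto simp: \<Phi>_def)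
    then have "rs (\<delta> + \<gamma>) \<subseteq> I" by (rule rs_subset[OF r sub bracket_rs[OF XY(1,2)] _ XY(3)])
    moreover have "\<delta> + \<gamma> \<in> pos_roots" using r \<delta> \<gamma> by (auto simp: \<Phi>_def pos_roots_def roots_eq)
    ultimately show "\<delta> + \<gamma> \<in> \<Phi>" by (simp add: \<Phi>_def)
  qed (auto simp: \<Phi>_def)
  show "I = root_sum \<G> \<Phi>"
  proof
    show "root_sum \<G> \<Phi> \<subseteq> I" by (rule root_sum_least[OF sub]) (simp add: \<Phi>_def)
    show "I \<subseteq> root_sum \<G> \<Phi>"
    proof
      fix Y assume Y: "Y \<in> I"
      then obtain X where X: "\<And>\<gamma>. \<gamma> \<in> pos_roots \<Longrightarrow> X \<gamma> \<in> rs \<gamma>" "Y = (\<Sum>\<gamma>\<in>pos_roots. X \<gamma>)"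
        using nil by (blast elim: root_sumE)
      have fin: "finite pos_roots" by (simp add: pos_roots_def)
      have inI: "X \<gamma> \<in> I" if "\<gamma> \<in> pos_roots" for \<gamma>
      proof (rule eigen_components[OF sub _ fin, where h = h0 and a = val])
        show "bracket h0 Y \<in> I" if "Y \<in> I" for Y using ad[OF h0_bor that] .
        show "inj_on val pos_roots"
          by (rule inj_onI, rule val_inj) (auto simp: pos_roots_def)
        show "bracket h0 (X \<gamma>) = cscale (val \<gamma>) (X \<gamma>)" if "\<gamma> \<in> pos_roots" for \<gamma>
          using rs_h0 X(1) that by blast
        show "sum X pos_roots \<in> I" using Y X(2) by simp
      qed (rule that)
      have "X \<gamma> = 0" if "\<gamma> \<in> pos_roots - \<Phi>" for \<gamma>
      proof (rule ccontr)
        assume "X \<gamma> \<noteq> 0"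
        then have "rs \<gamma> \<subseteq> I" using that pos X(1) inI by (intro rs_subset[OF _ sub, of _ "X \<gamma>"]) auto
        then show False using that by (simp add: \<Phi>_def)
      qed
      then have "Y = (\<Sum>\<gamma>\<in>\<Phi>. X \<gamma>)"
        unfolding X(2) using fin by (intro sum.mono_neutral_right) (auto simp: \<Phi>_def)
      moreover have "(\<Sum>\<gamma>\<in>\<Phi>. X \<gamma>) \<in> root_sum \<G> \<Phi>"
        by (rule root_sumI) (use X(1) in \<open>auto simp: \<Phi>_def\<close>)
      ultimately show "Y \<in> root_sum \<G> \<Phi>" by simp
    qed
  qed
qed

end

text \<open>From \<alpha> + \<beta> upwards the positive roots form a chain, each step adding a
  simple root, with \<alpha> and \<beta> below it. An upward closed set is therefore determined by
  its lowest members.\<close>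

lemma upward_closed_iff:
  "upward_closed \<Phi> \<longleftrightarrow> \<Phi> \<in> {{}, {(3,2)}, {(3,1), (3,2)}, {(2,1), (3,1), (3,2)}, {(1,1), (2,1), (3,1), (3,2)},
    {(1,0), (1,1), (2,1), (3,1), (3,2)}, {(0,1), (1,1), (2,1), (3,1), (3,2)}, pos_roots}"
  (is "_ \<longleftrightarrow> _ \<in> ?C")
proof
  assume *: "upward_closed \<Phi>"
  then have sub: "\<Phi> \<subseteq> pos_roots"
    and up: "\<And>\<gamma> \<delta>. \<gamma> \<in> \<Phi> \<Longrightarrow> \<delta> \<in> pos_roots \<Longrightarrow> \<delta> + \<gamma> \<in> roots \<Longrightarrow> \<delta> + \<gamma> \<in> \<Phi>"
    by (auto simp: upward_closed_def)
  have imp: "(1,0) \<in> \<Phi> \<Longrightarrow> (1,1) \<in> \<Phi>" "(0,1) \<in> \<Phi> \<Longrightarrow> (1,1) \<in> \<Phi>" "(1,1) \<in> \<Phi> \<Longrightarrow> (2,1) \<in> \<Phi>"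
    "(2,1) \<in> \<Phi> \<Longrightarrow> (3,1) \<in> \<Phi>" "(3,1) \<in> \<Phi> \<Longrightarrow> (3,2) \<in> \<Phi>"
    using up[of "(1,0)" "(0,1)"] up[of "(0,1)" "(1,0)"] up[of "(1,1)" "(1,0)"] up[of "(2,1)" "(1,0)"] up[of "(3,1)" "(0,1)"]
    by (auto simp: pos_roots_def roots_eq)
  consider "(3,2) \<notin> \<Phi>" | "(3,2) \<in> \<Phi>" "(3,1) \<notin> \<Phi>" | "(3,1) \<in> \<Phi>" "(2,1) \<notin> \<Phi>"
    | "(2,1) \<in> \<Phi>" "(1,1) \<notin> \<Phi>" | "(1,1) \<in> \<Phi>" "(1,0) \<notin> \<Phi>" "(0,1) \<notin> \<Phi>"
    | "(1,0) \<in> \<Phi>" "(0,1) \<notin> \<Phi>" | "(1,0) \<notin> \<Phi>" "(0,1) \<in> \<Phi>" | "(1,0) \<in> \<Phi>" "(0,1) \<in> \<Phi>"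
    by blast
  then show "\<Phi> \<in> ?C"
  proof cases
    case 1
    then have "\<Phi> = {}" using sub imp by (auto simp: pos_roots_def)
    then show ?thesis by blast
  next
    case 2
    then have "\<Phi> = {(3,2)}" using sub imp by (auto simp: pos_roots_def)
    then show ?thesis by blast
  next
    case 3
    then have "\<Phi> = {(3,1), (3,2)}" using sub imp by (auto simp: pos_roots_def)
    then show ?thesis by blast
  next
    case 4
    then have "\<Phi> = {(2,1), (3,1), (3,2)}" using sub imp by (auto simp: pos_roots_def)
    then show ?thesis by blast
  next
    case 5
    then have "\<Phi> = {(1,1), (2,1), (3,1), (3,2)}" using sub imp by (auto simp: pos_roots_def)
    then show ?thesis by blast
  next
    case 6
    then have "\<Phi> = {(1,0), (1,1), (2,1), (3,1), (3,2)}" using sub imp by (auto simp: pos_roots_def)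
    then show ?thesis by blast
  next
    case 7
    then have "\<Phi> = {(0,1), (1,1), (2,1), (3,1), (3,2)}" using sub imp by (auto simp: pos_roots_def)
    then show ?thesis by blast
  next
    case 8
    then have "\<Phi> = pos_roots" using sub imp by (auto simp: pos_roots_def)
    then show ?thesis by blast
  qed
next
  assume "\<Phi> \<in> ?C"
  then show "upward_closed \<Phi>"
    unfolding insert_iff empty_iff
    by (elim disjE) (simp_all add: upward_closed_def pos_roots_def roots_eq zero_prod_def)
qed

section \<open>The characters\<close>

lemma (in equivariant_basis) trace_eq:
  "trace u i = (\<Sum>j\<in>J. if d j = i \<and> \<pi> u j = j then \<sigma> u j else 0)"
  unfolding trace_def sum.inter_filter[OF fin, symmetric] by (rule sum.cong) auto

text \<open>A common length of six, with zeros as padding, lets one expansion serve the four bases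
  with congruences.\<close>

lemma coeff_list: "poly.coeff [:a, b, c, d, e, f:] i =
  (if i = 0 then a else if i = 1 then b else if i = 2 then c else if i = 3 then d else if i = 4 then e else if i = 5 then f else 0)"
  by (auto simp: coeff_pCons numeral_eq_Suc split: nat.split)

lemma b123_trace: "b123.trace u i = poly.coeff [:1, 1, 1, 1, 1, 1:] i u"
  unfolding b123.trace_eq coeff_list unfolding lessThan_6 by auto

lemma b12_trace: "b12.trace u i = poly.coeff [:1, 1, 1 + \<epsilon>\<^sub>1, 1, 1, 0:] i u"
  unfolding b12.trace_eq coeff_list unfolding lessThan_6 by auto

lemma b13_trace: "b13.trace u i = poly.coeff [:1, 1 + \<epsilon>\<^sub>1, 1 + \<epsilon>\<^sub>1, 1, 0, 0:] i u"
  unfolding b13.trace_eq coeff_list unfolding lessThan_6 by auto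

lemma b1_trace:
  assumes "u \<in> W"
  shows "b1.trace u i = poly.coeff [:1, 1 + \<epsilon>\<^sub>1 + \<chi>\<^sub>2, 1, 0, 0, 0:] i u"
proof -
  \<comment> \<open>The permutation character of \<open>W\<close> on the three pairs of opposite
    short roots.\<close>
  have "\<forall>u\<in>W. (\<Sum>\<delta>\<in>{(1,0), (1,1), (2,1)}. if pos_part (u \<delta>) = \<delta> then 1 else 0) = 1 + \<chi>\<^sub>2 u"
    by (simp add: W_eq W_mats_def pos_part_def pos_roots_def \<chi>\<^sub>2_def class_function_values)
  then have *: "(\<Sum>\<delta>\<in>{(1,0), (1,1), (2,1)}. if pos_part (u \<delta>) = \<delta> then 1 else 0) = 1 + \<chi>\<^sub>2 u"
    using assms by blast
  have "b1.trace u i = (if 0 = i then 1 else 0) + (if 1 = i then \<epsilon>\<^sub>1 u else 0) + (if 2 = i then 1 else 0) +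
    (if 1 = i then (\<Sum>\<delta>\<in>{(1,0), (1,1), (2,1)}. if pos_part (u \<delta>) = \<delta> then 1 else 0) else 0)"
    unfolding b1.trace_eq by (subst sum.Plus) (auto simp: add.assoc)
  then show ?thesis
    unfolding * coeff_list by auto
qed

interpretation short_delta: equivariant_basis short_roots "{}" short_roots "\<lambda>x v. if v = x then 1 else 0"
    "\<lambda>_. 0" "\<lambda>u. u" "\<lambda>_ _. 1"
  by (rule short.delta_basis)

interpretation long_delta: equivariant_basis long_roots "{}" long_roots "\<lambda>x v. if v = x then 1 else 0"
    "\<lambda>_. 0" "\<lambda>u. u" "\<lambda>_ _. 1"
  by (rule long.delta_basis)

lemma short_delta_trace:
  assumes "u \<in> W"
  shows "short_delta.trace u i = poly.coeff [:1 + \<epsilon>\<^sub>2 + \<chi>\<^sub>1 + \<chi>\<^sub>2:] i u"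
proof -
  have "\<forall>u\<in>W. (\<Sum>v\<in>short_roots. if u v = v then 1 else 0) = 1 + \<epsilon>\<^sub>2 u + \<chi>\<^sub>1 u + \<chi>\<^sub>2 u"
    by (simp add: W_eq W_mats_def short_roots_def \<epsilon>\<^sub>2_def \<chi>\<^sub>1_def \<chi>\<^sub>2_def class_function_values)
  then show ?thesis
    using assms by (cases i) (simp_all add: short_delta.trace_eq)
qed

lemma long_delta_trace:
  assumes "u \<in> W"
  shows "long_delta.trace u i = poly.coeff [:1 + \<epsilon>\<^sub>1 + \<chi>\<^sub>1 + \<chi>\<^sub>2:] i u"
proof -
  have "\<forall>u\<in>W. (\<Sum>v\<in>long_roots. if u v = v then 1 else 0) = 1 + \<epsilon>\<^sub>1 u + \<chi>\<^sub>1 u + \<chi>\<^sub>2 u"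
    by (simp add: W_eq W_mats_def long_roots_def \<epsilon>\<^sub>1_def \<chi>\<^sub>1_def \<chi>\<^sub>2_def class_function_values)
  then show ?thesis
    using assms by (cases i) (simp_all add: long_delta.trace_eq)
qed

lemma uminus_notin_iff: "- \<delta> \<in> roots - uminus ` \<Phi> \<longleftrightarrow> \<delta> \<notin> \<Phi>" if "\<delta> \<in> pos_roots" for \<delta> :: weight
  using that roots_uminus[OF pos_roots_subset] by (auto simp: image_iff)

text \<open>Reduces a case to a finite check on the positive roots outside \<Phi>: \<open>1\<close>
  asks for stability under s_\<gamma> and form values in S, \<open>2\<close> that every value in S
  taken on V arises from one of these roots.\<close>

lemma (in weight_orbit) gkm_character_split:
  assumes B: "equivariant_basis V S J b d \<pi> \<sigma>" and \<gamma>: "\<gamma> \<notin> \<Phi>"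
    and 1: "\<forall>\<delta>\<in>pos_roots - \<Phi>. \<delta> \<noteq> \<gamma> \<longrightarrow> refl \<gamma> \<delta> \<in> pos_roots - \<Phi> \<and> form \<omega> (refl \<delta> \<omega>) \<in> S"
    and 2: "\<forall>v\<in>V. form \<omega> v \<in> S \<longrightarrow> (\<exists>\<delta>\<in>pos_roots - \<Phi>. \<delta> \<noteq> \<gamma> \<and> form \<omega> (refl \<delta> \<omega>) = form \<omega> v)"
    and trace: "\<And>u i. u \<in> W \<Longrightarrow> equivariant_basis.trace J d \<pi> \<sigma> u i = poly.coeff Q i u"
    and P: "P = Q * [:1, 1:]"
  shows "gkm_character (roots - uminus ` \<Phi>) P"
  unfolding gkm_character_def
proof (intro allI ballI)
  fix i u assume u: "u \<in> W"
  have "poly.coeff P i u = equivariant_basis.trace J d \<pi> \<sigma> u i +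
      (if 1 \<le> i then equivariant_basis.trace J d \<pi> \<sigma> u (i - 1) else 0)"
    unfolding trace[OF u] by (cases i) (simp_all add: P)
  moreover have "dot_trace (roots - uminus ` \<Phi>) i u (equivariant_basis.trace J d \<pi> \<sigma> u i +
      (if 1 \<le> i then equivariant_basis.trace J d \<pi> \<sigma> u (i - 1) else 0))"
  proof (rule has_trace_split[OF B _ _ _ _ u])
    show "- \<gamma> \<in> roots - uminus ` \<Phi>" using uminus_notin_iff[OF pos] \<gamma> by blast
    fix \<delta> assume \<delta>: "\<delta> \<in> pos_roots" "- \<delta> \<in> roots - uminus ` \<Phi>" "\<delta> \<noteq> \<gamma>"
    then have "\<delta> \<in> pos_roots - \<Phi>" using uminus_notin_iff[of \<delta> \<Phi>] by blast
    then have *: "refl \<gamma> \<delta> \<in> pos_roots - \<Phi>" "form \<omega> (refl \<delta> \<omega>) \<in> S" using 1 \<delta>(3) by blast+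
    then show "refl \<gamma> \<delta> \<in> pos_roots \<and> - refl \<gamma> \<delta> \<in> roots - uminus ` \<Phi>"
      using uminus_notin_iff[of "refl \<gamma> \<delta>" \<Phi>] by blast
    show "form \<omega> (refl \<delta> \<omega>) \<in> S" by (rule *)
  next
    fix s v assume "s \<in> S" "v \<in> V" "form \<omega> v = s"
    then obtain \<delta> where "\<delta> \<in> pos_roots - \<Phi>" "\<delta> \<noteq> \<gamma>" "form \<omega> (refl \<delta> \<omega>) = s" using 2 by blast
    then show "\<exists>\<delta>\<in>pos_roots. - \<delta> \<in> roots - uminus ` \<Phi> \<and> \<delta> \<noteq> \<gamma> \<and> form \<omega> (refl \<delta> \<omega>) = s"
      using uminus_notin_iff[of \<delta> \<Phi>] by blast
  qed
  ultimately show "dot_trace (roots - uminus ` \<Phi>) i u (poly.coeff P i u)" by simp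
qed

section \<open>The characters for the eight ideals\<close>

lemma gkm_character_empty: "gkm_character (roots - uminus ` {}) [: 1, 2, 2, 2, 2, 2, 1 :]"
  by (rule short.gkm_character_split[OF b123.equivariant_basis_axioms _ _ _ b123_trace])
    (simp_all add: pos_roots_def insert_Diff_if short_roots_def refl_simps form_def algebra_simps)

text \<open>Here \<gamma> = \<alpha>, because s_\<alpha> fixes the omitted root 3\<alpha> +
  2\<beta>, whereas s_\<beta> exchanges it with 3\<alpha> + \<beta>.\<close>

lemma gkm_character_32: "gkm_character (roots - uminus ` {(3,2)}) [: 1, 2, 2 + \<epsilon>\<^sub>1, 2 + \<epsilon>\<^sub>1, 2, 1 :]"
  by (rule long.gkm_character_split[OF b12.equivariant_basis_axioms _ _ _ b12_trace])
    (simp_all add: pos_roots_def insert_Diff_if long_roots_def refl_simps form_def algebra_simps)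

text \<open>s_\<beta> exchanges the two omitted roots, so \<gamma> = \<beta> applies. Of the
  remaining roots, \<alpha> and \<alpha> + \<beta> give the sides of the short hexagon and 2\<alpha>
  + \<beta> its long diagonals.\<close>

lemma gkm_character_31: "gkm_character (roots - uminus ` {(3,1), (3,2)}) [: 1, 2 + \<epsilon>\<^sub>1, 2 + 2 * \<epsilon>\<^sub>1, 2 + \<epsilon>\<^sub>1, 1 :]"
  by (rule short.gkm_character_split[OF b13.equivariant_basis_axioms _ _ _ b13_trace])
    (simp_all add: pos_roots_def insert_Diff_if short_roots_def refl_simps form_def algebra_simps)

lemma gkm_character_21: "gkm_character (roots - uminus ` {(2,1), (3,1), (3,2)}) [: 1, 2 + \<epsilon>\<^sub>1 + \<chi>\<^sub>2, 2 + \<epsilon>\<^sub>1 + \<chi>\<^sub>2, 1 :]"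
  by (rule short.gkm_character_split[OF b1.equivariant_basis_axioms _ _ _ b1_trace])
    (simp_all add: pos_roots_def insert_Diff_if short_roots_def refl_simps form_def algebra_simps)

lemma gkm_character_alpha: "gkm_character (roots - uminus ` {(1,0), (1,1), (2,1), (3,1), (3,2)}) ([: 1 + \<chi>\<^sub>2 + \<chi>\<^sub>1 + \<epsilon>\<^sub>2 :] * [: 1, 1 :])"
  by (rule short.gkm_character_split[OF short_delta.equivariant_basis_axioms _ _ _ short_delta_trace])
    (simp_all add: pos_roots_def insert_Diff_if short_roots_def refl_simps form_def algebra_simps)

lemma gkm_character_beta: "gkm_character (roots - uminus ` {(0,1), (1,1), (2,1), (3,1), (3,2)}) ([: 1 + \<epsilon>\<^sub>1 + \<chi>\<^sub>2 + \<chi>\<^sub>1 :] * [: 1, 1 :])"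
  by (rule long.gkm_character_split[OF long_delta.equivariant_basis_axioms _ _ _ long_delta_trace])
    (simp_all add: pos_roots_def insert_Diff_if long_roots_def refl_simps form_def algebra_simps)

lemma gkm_mono: "D' \<subseteq> D \<Longrightarrow> f \<in> gkm D \<Longrightarrow> f \<in> gkm D'"
  unfolding gkm_iff by blast

text \<open>s_\<beta> sends \<alpha> to \<alpha> + \<beta>, so the splitting along \<beta> does not
  respect the edges of type \<alpha>. Taking w \<alpha> as the factor of the second summand repairs
  this: it vanishes on these edges and agrees at both ends of an edge of type \<beta> where w
  \<beta> = 0. All congruences of type \<alpha> thus fall on the first summand.\<close>

lemma gkm_character_11:
  "gkm_character (roots - uminus ` {(1,1), (2,1), (3,1), (3,2)}) [: 1, 2 + \<epsilon>\<^sub>1 + 2 * \<chi>\<^sub>2 + \<chi>\<^sub>1 + \<epsilon>\<^sub>2, 1 :]"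
  (is "gkm_character ?D _")
  unfolding gkm_character_def
proof (intro allI ballI)
  fix i u assume u: "u \<in> W"
  have D: "\<delta> \<in> pos_roots \<Longrightarrow> - \<delta> \<in> ?D \<Longrightarrow> \<delta> = (1,0) \<or> \<delta> = (0,1)" for \<delta>
    by (auto simp: uminus_notin_iff pos_roots_def)
  have \<alpha>D: "- (1,0) \<in> ?D" "- (0,1) \<in> ?D" by (auto simp: roots_eq)
  have w\<omega>: "wt_eval (w (2,1)) = 2 * wt_eval (w (1,0)) + wt_eval (w (0,1))"
    "wt_eval (w (1,1)) = wt_eval (w (2,1)) - wt_eval (w (1,0))"
    "wt_eval (w (3,1)) = wt_eval (w (0,1)) + 3 * wt_eval (w (1,0))" if "w \<in> W" for w
    using that by (auto elim!: W_linE simp: fun_eq_iff wt_eval_pair algebra_simps)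
  have "dot_trace ?D i u
      (b1.trace u i + (if 1 \<le> i then (\<lambda>_. 1) u * short_delta.trace u (i - 1) else 0))"
  proof (rule has_trace_direct_sum[OF b1.equivariant_basis_axioms short_delta.equivariant_basis_axioms
        short.orbit _ short.fixed, where G = "\<lambda>w. wt_eval (w (1,0))" and \<chi>' = "\<lambda>_. 1"])
    show "(0, 1) \<in> roots" by (simp add: roots_eq)
    show "wt_eval (w (1,0)) \<in> Sym_deg 1" for w by (rule Sym_deg_wt_eval)
    show "act_Sym u (wt_eval (w (1,0))) h = 1 * wt_eval ((u \<circ> w) (1,0)) h" if "u \<in> W" for u w h
      using act_Sym_wt_eval[OF that] by simp
    show "wt_eval (w (1,0)) (1, 1) \<noteq> wt_eval ((w \<circ> s\<^sub>\<beta>) (1,0)) (1, 1)" if "w \<in> W" for w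
    proof -
      have "w (1,1) = w (1,0) + w (0,1)" using W_add[OF that, of "(1,0)" "(0,1)"] by simp
      then have "wt_eval ((w \<circ> s\<^sub>\<beta>) (1,0)) (1, 1) = wt_eval (w (1,0)) (1, 1) + wt_eval (w (0,1)) (1, 1)"
        by (simp add: refl_simps wt_eval_add)
      moreover have "wt_eval (w (0,1)) (1, 1) \<noteq> 0"
        by (rule wt_eval_root_nonzero[OF W_roots[OF that]]) (simp add: roots_eq)
      ultimately show ?thesis by simp
    qed
    show "pull_back_W (2,1) \<phi> \<in> gkm ?D" if "\<phi> \<in> orbit_ring short_roots {1}" for \<phi>
      by (rule short.pull_back_gkm[OF that]) (auto dest!: D simp: refl_simps form_def)
    show "(\<lambda>w. wt_eval (w (1,0)) * pull_back_W (2,1) \<phi> w) \<in> gkm ?D" if \<phi>: "\<phi> \<in> orbit_ring short_roots {}" for \<phi>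
    proof (rule gkmI)
      fix w \<delta> h assume w: "w \<in> W" and \<delta>: "\<delta> \<in> pos_roots" "- \<delta> \<in> ?D" and h: "wt_eval (w \<delta>) h = 0"
      have "w \<circ> refl \<delta> \<in> W" using \<delta>(1) by (intro W_comp[OF w] refl_in_W pos_roots_subset)
      consider "\<delta> = (1,0)" | "\<delta> = (0,1)" using D[OF \<delta>] by blast
      then show "(wt_eval (w (1,0)) * pull_back_W (2,1) \<phi> w) h =
        (wt_eval ((w \<circ> refl \<delta>) (1,0)) * pull_back_W (2,1) \<phi> (w \<circ> refl \<delta>)) h"
      proof cases
        case 1
        have "w (-1, 0) = - w (1, 0)" using W_uminus[OF w, of "(1,0)"] by simp
        then show ?thesis using 1 h by (simp add: refl_simps wt_eval_uminus)
      next
        case 2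
        have "w (1,1) = w (1,0) + w (0,1)" using W_add[OF w, of "(1,0)" "(0,1)"] by simp
        then show ?thesis
          using 2 h w \<open>w \<circ> refl \<delta> \<in> W\<close> by (simp add: refl_simps wt_eval_add pull_back_W_def)
      qed
    next
      fix w assume "w \<in> W"
      then show "wt_eval (w (1,0)) * pull_back_W (2,1) \<phi> w \<in> Sym"
        using orbit_ring_Sym[OF \<phi> short.V_W[OF _ short.omega_V]]
        by (simp add: pull_back_W_def Sym_mult Sym_wt_eval)
    qed (simp add: pull_back_W_def)
  next
    fix f assume f: "f \<in> gkm ?D"
    have "f \<in> gkm {- (0,1)}" by (rule gkm_mono[OF _ f]) (use \<alpha>D in simp)
    then obtain \<phi> \<psi> where \<phi>: "\<phi> \<in> orbit_ring short_roots {}" "\<psi> \<in> orbit_ring short_roots {}"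
      and fw: "\<And>w. w \<in> W \<Longrightarrow> f w = \<phi> (w (2,1)) + wt_eval (w (0,1)) * \<psi> (w (2,1))"
      using short.gkm_split[of f "{- (0,1)}" "{}"] by auto
    \<comment> \<open>With \<omega> = 2\<alpha> + \<beta> and v = w \<omega>, w \<beta> = v - 2 w
      \<alpha>, hence \<phi> + (w \<beta>) \<psi> = (\<phi> + v \<psi>) + (w \<alpha>)(-2
      \<psi>).\<close>
    define \<phi>' where "\<phi>' v = \<phi> v + wt_eval v * \<psi> v" for v
    define \<psi>' where "\<psi>' v = (\<lambda>h. (- 2) * \<psi> v h)" for v
    have "\<phi>' \<in> orbit_ring short_roots {1}"
      unfolding orbit_ring_def edge_cond_def
    proof (intro CollectI conjI ballI allI impI)
      show "\<phi>' v \<in> Sym" if "v \<in> short_roots" for v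
        unfolding \<phi>'_def using orbit_ring_Sym[OF \<phi>(1) that] orbit_ring_Sym[OF \<phi>(2) that]
        by (intro Sym_add Sym_mult Sym_wt_eval)
      fix v v' h assume v: "v \<in> short_roots" "v' \<in> short_roots" "form v v' \<in> {1}" and eq: "wt_eval v h = wt_eval v' h"
      \<comment> \<open>Vertices with form value 1 are the ends of an edge of type \<alpha>, because
        s_\<alpha> sends 2\<alpha> + \<beta> to \<alpha> + \<beta>.\<close>
      obtain w where w: "w \<in> W" "v = w (2,1)" "v' = w (1,1)"
        using short.pair_transitive[OF v(1,2), of "(1,1)"] v(3) by (auto simp: short_roots_def form_def)
      have ws: "w \<circ> s\<^sub>\<alpha> \<in> W" by (intro W_comp[OF w(1)] refl_in_W) (simp add: roots_eq)
      have \<alpha>: "wt_eval (w (1,0)) h = 0"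
        using eq w w\<omega>(2)[OF w(1)] by simp
      have "f w h = f (w \<circ> s\<^sub>\<alpha>) h"
        by (rule gkm_edge[OF f w(1) _ \<alpha>D(1) \<alpha>]) (simp add: pos_roots_def)
      then have "\<phi> v h + wt_eval (w (0,1)) h * \<psi> v h = \<phi> v' h + wt_eval (w (3,1)) h * \<psi> v' h"
        using fw[OF w(1)] fw[OF ws] w by (simp add: refl_simps)
      moreover have "wt_eval (w (0,1)) h = wt_eval v h" "wt_eval (w (3,1)) h = wt_eval v' h"
        using w\<omega>[OF w(1)] \<alpha> w eq by simp_all
      ultimately show "\<phi>' v h = \<phi>' v' h" by (simp add: \<phi>'_def)
    qed
    moreover have "\<psi>' \<in> orbit_ring short_roots {}"
      unfolding orbit_ring_def edge_cond_def \<psi>'_def using orbit_ring_Sym[OF \<phi>(2)] by (blast intro: Sym_scale)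
    moreover have "f w = \<phi>' (w (2,1)) + wt_eval (w (1,0)) * \<psi>' (w (2,1))" if "w \<in> W" for w
      using fw[OF that] w\<omega>(1)[OF that] by (simp add: fun_eq_iff \<phi>'_def \<psi>'_def algebra_simps)
    ultimately show "\<exists>\<phi>\<in>orbit_ring short_roots {1}. \<exists>\<psi>\<in>orbit_ring short_roots {}.
        \<forall>w\<in>W. f w = \<phi> (w (2,1)) + wt_eval (w (1,0)) * \<psi> (w (2,1))" by blast
  qed (rule u)
  moreover have "b1.trace u i + (if 1 \<le> i then (\<lambda>_. 1) u * short_delta.trace u (i - 1) else 0) =
      poly.coeff [: 1, 2 + \<epsilon>\<^sub>1 + 2 * \<chi>\<^sub>2 + \<chi>\<^sub>1 + \<epsilon>\<^sub>2, 1 :] i u"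
    unfolding b1_trace[OF u] short_delta_trace[OF u]
    by (cases i) (auto simp: coeff_pCons split: nat.split)
  ultimately show "dot_trace ?D i u (poly.coeff [: 1, 2 + \<epsilon>\<^sub>1 + 2 * \<chi>\<^sub>2 + \<chi>\<^sub>1 + \<epsilon>\<^sub>2, 1 :] i u)"
    by simp
qed

text \<open>No edge is left, so nothing makes the antisymmetric part divisible by a root.
  Multiplication by the sign, which also changes under s_\<beta>, makes it symmetric without raising
  the degree; the result is the regular representation in degree 0.\<close>

lemma gkm_character_nilrad:
  "gkm_character (roots - uminus ` pos_roots) [: 1 + \<epsilon>\<^sub>1 + 2 * \<chi>\<^sub>2 + 2 * \<chi>\<^sub>1 + \<epsilon>\<^sub>2 + \<epsilon> :]"
  (is "gkm_character ?D _")
  unfolding gkm_character_def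
proof (intro allI ballI)
  fix i u assume u: "u \<in> W"
  have sign_mult: "\<forall>u\<in>W. \<forall>w\<in>W. \<epsilon> u * \<epsilon> (u \<circ> w) = \<epsilon> w"
    by (simp add: W_eq W_mats_def \<epsilon>_def class_function_values del: o_apply)
  have sign_sq: "\<epsilon> w * \<epsilon> w = 1" "\<epsilon> w \<noteq> 0" "\<epsilon> (w \<circ> s\<^sub>\<beta>) = - \<epsilon> w" if "w \<in> W" for w
    using that by (auto simp: W_eq W_mats_def \<epsilon>_def class_function_values refl_simps simp del: o_apply)
  have D: "\<delta> \<in> pos_roots \<Longrightarrow> - \<delta> \<in> ?D \<Longrightarrow> False" for \<delta>
    by (auto simp: uminus_notin_iff)
  have "dot_trace ?D i u
      (short_delta.trace u i + (if 0 \<le> i then \<epsilon> u * short_delta.trace u (i - 0) else 0))"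
  proof (rule has_trace_direct_sum[OF short_delta.equivariant_basis_axioms short_delta.equivariant_basis_axioms
        short.orbit _ short.fixed, where G = "\<lambda>w h. \<epsilon> w"])
    show "(0, 1) \<in> roots" by (simp add: roots_eq)
    show "(\<lambda>h. \<epsilon> w) \<in> Sym_deg 0" for w by (rule Sym_deg_const)
    show "act_Sym u (\<lambda>h. \<epsilon> w) h = \<epsilon> u * \<epsilon> (u \<circ> w)" if "u \<in> W" "w \<in> W" for u w h
      using sign_mult that by (simp add: act_Sym_def)
    show "\<epsilon> w \<noteq> \<epsilon> (w \<circ> s\<^sub>\<beta>)" if "w \<in> W" for w
      using sign_sq[OF that] by simp
    show p: "pull_back_W (2,1) \<phi> \<in> gkm ?D" if "\<phi> \<in> orbit_ring short_roots {}" for \<phi>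
      by (rule short.pull_back_gkm[OF that]) (use D in blast)
    show "(\<lambda>w. (\<lambda>h. \<epsilon> w) * pull_back_W (2,1) \<phi> w) \<in> gkm ?D" if "\<phi> \<in> orbit_ring short_roots {}" for \<phi>
      by (rule gkmI) (use D p[OF that] gkm_outside[OF p[OF that]] gkm_Sym[OF p[OF that]] in
          \<open>auto intro!: Sym_mult Sym_const simp del: times_fun_apply zero_fun_apply\<close>)
  next
    fix f assume f: "f \<in> gkm ?D"
    have ws: "w \<circ> s\<^sub>\<beta> \<in> W" "w \<circ> s\<^sub>\<beta> \<circ> s\<^sub>\<beta> = w" if "w \<in> W" for w
      using W_comp[OF that short.refl_W] short.refl_W2 by (simp_all add: comp_assoc)
    define f1 where "f1 w = (\<lambda>h. (1/2) * (f w + f (w \<circ> s\<^sub>\<beta>)) h)" for w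
    define f2 where "f2 w = (\<lambda>h. (\<epsilon> w / 2) * (f w - f (w \<circ> s\<^sub>\<beta>)) h)" for w
    obtain \<phi> where \<phi>: "\<And>w. w \<in> W \<Longrightarrow> f1 w = \<phi> (w (2,1))"
      using short.factor_through_orbit[of f1] ws by (auto simp: f1_def add.commute)
    obtain \<psi> where \<psi>: "\<And>w. w \<in> W \<Longrightarrow> f2 w = \<psi> (w (2,1))"
    proof -
      have "f2 (w \<circ> s\<^sub>\<beta>) = f2 w" if w: "w \<in> W" for w
        unfolding f2_def ws(2)[OF w] sign_sq(3)[OF w] by (simp add: fun_eq_iff algebra_simps)
      then show thesis using short.factor_through_orbit[of f2] that by blast
    qed
    have "\<phi> v \<in> Sym \<and> \<psi> v \<in> Sym" if v: "v \<in> short_roots" for v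
    proof -
      obtain w where w: "w \<in> W" "v = w (2,1)" using v unfolding short.orbit by blast
      have f_Sym: "f w \<in> Sym" "f (w \<circ> s\<^sub>\<beta>) \<in> Sym"
        using gkm_Sym[OF f] w(1) ws(1) by blast+
      have "f1 w \<in> Sym" unfolding f1_def by (rule Sym_scale[OF Sym_add[OF f_Sym]])
      moreover have "f2 w \<in> Sym" unfolding f2_def by (rule Sym_scale[OF Sym_diff[OF f_Sym]])
      ultimately show ?thesis using \<phi>[OF w(1)] \<psi>[OF w(1)] w(2) by simp
    qed
    then have "\<phi> \<in> orbit_ring short_roots {}" "\<psi> \<in> orbit_ring short_roots {}"
      by (simp_all add: orbit_ring_def edge_cond_def)
    moreover have "f w = \<phi> (w (2,1)) + (\<lambda>h. \<epsilon> w) * \<psi> (w (2,1))" if w: "w \<in> W" for w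
    proof
      fix h
      have sq: "\<epsilon> w * ((\<epsilon> w / 2) * x) = x / 2" for x
        using sign_sq(1)[OF w] by (simp flip: mult.assoc)
      then show "f w h = (\<phi> (w (2,1)) + (\<lambda>h. \<epsilon> w) * \<psi> (w (2,1))) h"
        unfolding \<phi>[OF w, symmetric] \<psi>[OF w, symmetric] 
        by (simp only: f1_def f2_def times_fun_apply plus_fun_apply minus_apply sq) (simp add: field_simps)
    qed
    ultimately show "\<exists>\<phi>\<in>orbit_ring short_roots {}. \<exists>\<psi>\<in>orbit_ring short_roots {}.
        \<forall>w\<in>W. f w = \<phi> (w (2,1)) + (\<lambda>h. \<epsilon> w) * \<psi> (w (2,1))" by blast
  qed (rule u)
  \<comment> \<open>Multiplication by the sign turns \<open>\<epsilon>\<^sub>2\<close> into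
    \<open>\<epsilon>\<^sub>1\<close> and 1 into \<epsilon>, and fixes the two characters of degree
    2.\<close>
  moreover have "\<forall>u\<in>W. (1 + \<epsilon> u) * (1 + \<epsilon>\<^sub>2 u + \<chi>\<^sub>1 u + \<chi>\<^sub>2 u) = 1 + \<epsilon>\<^sub>1 u + 2 * \<chi>\<^sub>2 u + 2 * \<chi>\<^sub>1 u + \<epsilon>\<^sub>2 u + \<epsilon> u"
    by (simp add: W_eq W_mats_def \<epsilon>_def \<epsilon>\<^sub>1_def \<epsilon>\<^sub>2_def \<chi>\<^sub>1_def \<chi>\<^sub>2_def class_function_values)
  then have "(1 + \<epsilon> u) * (1 + \<epsilon>\<^sub>2 u + \<chi>\<^sub>1 u + \<chi>\<^sub>2 u) = 1 + \<epsilon>\<^sub>1 u + 2 * \<chi>\<^sub>2 u + 2 * \<chi>\<^sub>1 u + \<epsilon>\<^sub>2 u + \<epsilon> u"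
    using u by blast
  then have "short_delta.trace u i + (if 0 \<le> i then \<epsilon> u * short_delta.trace u (i - 0) else 0) =
      poly.coeff [: 1 + \<epsilon>\<^sub>1 + 2 * \<chi>\<^sub>2 + 2 * \<chi>\<^sub>1 + \<epsilon>\<^sub>2 + \<epsilon> :] i u"
    unfolding short_delta_trace[OF u] by (cases i) (simp_all add: distrib_right)
  ultimately show "dot_trace ?D i u (poly.coeff [: 1 + \<epsilon>\<^sub>1 + 2 * \<chi>\<^sub>2 + 2 * \<chi>\<^sub>1 + \<epsilon>\<^sub>2 + \<epsilon> :] i u)"
    by simp
qed

lemma pos_roots_above:
  "{\<delta> \<in> pos_roots. root_le (3,2) \<delta>} = {(3,2)}"
  "{\<delta> \<in> pos_roots. root_le (3,1) \<delta>} = {(3,1), (3,2)}"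
  "{\<delta> \<in> pos_roots. root_le (2,1) \<delta>} = {(2,1), (3,1), (3,2)}"
  "{\<delta> \<in> pos_roots. root_le (1,1) \<delta>} = {(1,1), (2,1), (3,1), (3,2)}"
  "{\<delta> \<in> pos_roots. root_le (1,0) \<delta>} = {(1,0), (1,1), (2,1), (3,1), (3,2)}"
  "{\<delta> \<in> pos_roots. root_le (0,1) \<delta>} = {(0,1), (1,1), (2,1), (3,1), (3,2)}"
  by (auto simp: pos_roots_def root_le_def)

theorem theorem5p9:
  fixes \<G> :: "'n::finite g2"
  assumes "type_G2 \<G>"
  shows
    "let G2_list =
      {({0},             [: 1, 2, 2, 2, 2, 2, 1 :]),
       (I_above \<G> (3,2), [: 1, 2, 2 + \<epsilon>\<^sub>1, 2 + \<epsilon>\<^sub>1, 2, 1 :]),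
       (I_above \<G> (3,1), [: 1, 2 + \<epsilon>\<^sub>1, 2 + 2 * \<epsilon>\<^sub>1, 2 + \<epsilon>\<^sub>1, 1 :]),
       (I_above \<G> (2,1), [: 1, 2 + \<epsilon>\<^sub>1 + \<chi>\<^sub>2, 2 + \<epsilon>\<^sub>1 + \<chi>\<^sub>2, 1 :]),
       (I_above \<G> (1,1), [: 1, 2 + \<epsilon>\<^sub>1 + 2 * \<chi>\<^sub>2 + \<chi>\<^sub>1 + \<epsilon>\<^sub>2, 1 :]),
       (I_above \<G> (1,0), [: 1 + \<chi>\<^sub>2 + \<chi>\<^sub>1 + \<epsilon>\<^sub>2 :] * [: 1, 1 :]),
       (I_above \<G> (0,1), [: 1 + \<epsilon>\<^sub>1 + \<chi>\<^sub>2 + \<chi>\<^sub>1 :] * [: 1, 1 :]),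
       (nilrad \<G>,        [: 1 + \<epsilon>\<^sub>1 + 2 * \<chi>\<^sub>2 + 2 * \<chi>\<^sub>1 + \<epsilon>\<^sub>2 + \<epsilon> :])}
     in
      {I. hessenberg_ideal \<G> I} = fst ` G2_list \<and>
      (\<forall>(I, P) \<in> G2_list.
        let M = dual_subspace \<G> I in
          gkm_character (root_set \<G> M) P \<and>
          (\<forall>y \<rho>. regular_semisimple \<G> y \<and> dot_action \<G> M y \<rho>
             \<longrightarrow> cohomology_character (Hess \<G> M y) \<rho> P))"
proof -
  interpret type_G2_group \<G> by (rule type_G2_group.intro[OF assms])
  have I: "I_above \<G> (3,2) = root_sum \<G> {(3,2)}" "I_above \<G> (3,1) = root_sum \<G> {(3,1), (3,2)}"
    "I_above \<G> (2,1) = root_sum \<G> {(2,1), (3,1), (3,2)}"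
    "I_above \<G> (1,1) = root_sum \<G> {(1,1), (2,1), (3,1), (3,2)}"
    "I_above \<G> (1,0) = root_sum \<G> {(1,0), (1,1), (2,1), (3,1), (3,2)}"
    "I_above \<G> (0,1) = root_sum \<G> {(0,1), (1,1), (2,1), (3,1), (3,2)}"
    "nilrad \<G> = root_sum \<G> pos_roots" "{0} = root_sum \<G> {}"
    by (simp_all only: I_above_def pos_roots_above nilrad_def) (simp add: root_sum_def)
  have ideals: "{I. hessenberg_ideal \<G> I} = root_sum \<G> ` {\<Phi>. upward_closed \<Phi>}"
    using hessenberg_ideal_root_sum hessenberg_ideal_eq_root_sum by blast
  have char: "gkm_character (root_set \<G> (dual_subspace \<G> (root_sum \<G> \<Phi>))) P"
    "\<forall>y \<rho>. regular_semisimple \<G> y \<and> dot_action \<G> (dual_subspace \<G> (root_sum \<G> \<Phi>)) y \<rho> \<longrightarrow>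
        cohomology_character (Hess \<G> (dual_subspace \<G> (root_sum \<G> \<Phi>)) y) \<rho> P"
    if "gkm_character (roots - uminus ` \<Phi>) P" "upward_closed \<Phi>" for \<Phi> P
  proof -
    have "\<Phi> \<subseteq> roots" using that(2) pos_roots_subset by (auto simp: upward_closed_def)
    then show *: "gkm_character (root_set \<G> (dual_subspace \<G> (root_sum \<G> \<Phi>))) P"
      using that(1) by (simp add: root_set_dual)
    show "\<forall>y \<rho>. regular_semisimple \<G> y \<and> dot_action \<G> (dual_subspace \<G> (root_sum \<G> \<Phi>)) y \<rho> \<longrightarrow>
        cohomology_character (Hess \<G> (dual_subspace \<G> (root_sum \<G> \<Phi>)) y) \<rho> P"
      using cohomology_character_transfer[OF _ *] by blast
  qed
  have up: "upward_closed {}" "upward_closed {(3,2)}" "upward_closed {(3,1), (3,2)}"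
    "upward_closed {(2,1), (3,1), (3,2)}" "upward_closed {(1,1), (2,1), (3,1), (3,2)}"
    "upward_closed {(1,0), (1,1), (2,1), (3,1), (3,2)}" "upward_closed {(0,1), (1,1), (2,1), (3,1), (3,2)}"
    "upward_closed pos_roots"
    by (simp_all only: upward_closed_iff insert_iff simp_thms)
  have closed: "Collect upward_closed = {{}, {(3,2)}, {(3,1), (3,2)}, {(2,1), (3,1), (3,2)},
      {(1,1), (2,1), (3,1), (3,2)}, {(1,0), (1,1), (2,1), (3,1), (3,2)},
      {(0,1), (1,1), (2,1), (3,1), (3,2)}, pos_roots}"
    by (rule Set.set_eqI) (simp only: mem_Collect_eq upward_closed_iff)
  show ?thesis
    unfolding Let_def I ideals closed
    by (rule conjI)
      (simp only: image_insert image_empty fst_conv,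
       simp only: ball_simps case_prod_conv simp_thms,
       intro conjI char up gkm_character_empty gkm_character_32 gkm_character_31 gkm_character_21
        gkm_character_11 gkm_character_alpha gkm_character_beta gkm_character_nilrad)
qed

end
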